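(* Let $\Omega$ be a bounded convex domain in $\mathbb{C}^n$, $n\geq 2$. Assume that $\phi\in C^1(\overline{\Omega})$ and that, for some $q$ with $1\leq q\leq n-1$, there exists a holomorphic embedding $\psi:\mathbb{D}^q\to b\Omega$ such that $\phi\circ\psi$ is not holomorphic. Then the Hankel operator $H^{q-1}_{\phi}$ is not compact on $A^2_{(0,q-1)}(\Omega)$; that is, the restriction $H^{q-1}_\phi|_{A^2_{(0,q-1)}(\Omega)}: A^2_{(0,q-1)}(\Omega)\to L^2_{(0,q-1)}(\Omega)$ is not a compact operator (and a fortiori $H^{q-1}_\phi$ is not compact on $K^2_{(0,q-1)}(\Omega)$).
   Context: $b\Omega$ denotes the boundary of $\Omega$. $\mathbb{D}$ is the open unit disc in $\mathbb{C}$ and $\mathbb{D}^q$ is the $q$-fold product, the unit polydisc in $\mathbb{C}^q$. A holomorphic embedding $\psi:\mathbb{D}^q\to b\Omega$ is a holomorphic embedding of $\mathbb{D}^q$ into $\mathbb{C}^n$ whose image lies in $b\Omega$. For $0\le p\le n$, $L^2_{(0,p)}(\Omega)$ is the Hilbert space of $(0,p)$-forms with square integrable coefficients; $K^2_{(0,p)}(\Omega)\subset L^2_{(0,p)}(\Omega)$ is the closed subspace of $\overline{\partial}$-closed forms; $A^2_{(0,p)}(\Omega)\subset K^2_{(0,p)}(\Omega)$ is the subspace of $(0,p)$-forms whose coefficients (with respect to the $d\overline{z}_J$) are square integrable holomorphic functions. For $p=0$ both spaces equal the Bergman space of square integrable holomorphic functions. $P_p:L^2_{(0,p)}(\Omega)\to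 K^2_{(0,p)}(\Omega)$ is the orthogonal projection (the Bergman projection). For $\phi\in L^\infty(\Omega)$ the Hankel operator with symbol $\phi$ is $H^p_\phi:K^2_{(0,p)}(\Omega)\to L^2_{(0,p)}(\Omega)$, $H^p_\phi f=\phi f-P_p(\phi f)$. *)

theory Defs
  imports "HOL-Analysis.Analysis"
begin

text \<open>
  Complex Euclidean space is \<^typ>\<open>complex ^ 'n\<close>. It carries Lebesgue measure and the real
  differential calculus of the underlying real vector space; complex linearity is expressed
  through \<^term>\<open>(*s)\<close>.
\<close>

definition holomorphic_fun_on :: "(complex ^ 'n \<Rightarrow> complex) \<Rightarrow> (complex ^ 'n) set \<Rightarrow> bool" where
  "holomorphic_fun_on f U \<longleftrightarrow>
     (\<forall>z\<in>U. \<exists>L. (f has_derivative L) (at z) \<and> (\<forall>c v. L (c *s v) = c * L v))"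

definition holomorphic_map_on ::
    "(complex ^ 'm \<Rightarrow> complex ^ 'n) \<Rightarrow> (complex ^ 'm) set \<Rightarrow> bool" where
  "holomorphic_map_on F U \<longleftrightarrow> (\<forall>i. holomorphic_fun_on (\<lambda>z. F z $ i) U)"

definition polydisc :: "(complex ^ 'q) set" where
  "polydisc = {z. \<forall>i. cmod (z $ i) < 1}"

definition holomorphic_embedding_on ::
    "(complex ^ 'm \<Rightarrow> complex ^ 'n) \<Rightarrow> (complex ^ 'm) set \<Rightarrow> bool" where
  "holomorphic_embedding_on F U \<longleftrightarrow>
     holomorphic_map_on F U \<and>
     (\<forall>z\<in>U. inj (frechet_derivative F (at z))) \<and>
     embedding_map (top_of_set U) euclidean F"

text \<open>
  The space $C^1(\overline\Omega)$: continuous on the closure, with a derivative in the open set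
  that extends continuously to the closure.
\<close>

definition C1_closure :: "(complex ^ 'n) set \<Rightarrow> (complex ^ 'n \<Rightarrow> complex) \<Rightarrow> bool" where
  "C1_closure \<Omega> \<phi> \<longleftrightarrow>
     continuous_on (closure \<Omega>) \<phi> \<and>
     (\<exists>D :: (complex ^ 'n) \<Rightarrow> ((complex ^ 'n) \<Rightarrow>\<^sub>L complex).
        continuous_on (closure \<Omega>) D \<and>
        (\<forall>z\<in>\<Omega>. (\<phi> has_derivative blinfun_apply (D z)) (at z)))"

primrec C_k :: "nat \<Rightarrow> ('a::euclidean_space \<Rightarrow> complex) \<Rightarrow> bool" where
  "C_k 0 f \<longleftrightarrow> continuous_on UNIV f"
| "C_k (Suc m) f \<longleftrightarrow>
     f differentiable_on UNIV \<and> (\<forall>v. C_k m (\<lambda>x. frechet_derivative f (at x) v))"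

definition test_function :: "'a::euclidean_space set \<Rightarrow> ('a \<Rightarrow> complex) \<Rightarrow> bool" where
  "test_function \<Omega> \<eta> \<longleftrightarrow>
     (\<forall>m. C_k m \<eta>) \<and> (\<exists>S. compact S \<and> S \<subseteq> \<Omega> \<and> (\<forall>z. z \<notin> S \<longrightarrow> \<eta> z = 0))"

text \<open>The Wirtinger derivative $\partial\eta/\partial\overline z_k$.\<close>

definition dbar_partial :: "'n \<Rightarrow> (complex ^ 'n \<Rightarrow> complex) \<Rightarrow> complex ^ 'n \<Rightarrow> complex" where
  "dbar_partial k \<eta> z =
     (frechet_derivative \<eta> (at z) (axis k 1) + \<i> * frechet_derivative \<eta> (at z) (axis k \<i>)) / 2"

text \<open>
  A $(0,p)$-form $f = \sum_{|J| = p} f_J\, d\overline z_J$ on \<open>\<Omega>\<close> is represented by its coefficients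
  \<open>f J\<close>; a strictly increasing multi-index $J$ is encoded as the set of its entries. Only the
  values \<open>f J z\<close> with \<open>card J = p\<close> and \<open>z \<in> \<Omega>\<close> are meaningful. Elements of $L^2$ are
  given by representatives: forms that agree almost everywhere on \<open>\<Omega>\<close> stand for the same
  element, i.e. forms at distance 0 with respect to \<open>L2_norm\<close>.
\<close>

type_synonym 'n form = "'n set \<Rightarrow> (complex, 'n) vec \<Rightarrow> complex"

definition L2_forms :: "nat \<Rightarrow> (complex ^ 'n) set \<Rightarrow> 'n::finite form set" where
  "L2_forms p \<Omega> = {f. \<forall>J. card J = p \<longrightarrow>
     f J \<in> borel_measurable (lebesgue_on \<Omega>) \<and>
     integrable (lebesgue_on \<Omega>) (\<lambda>z. (cmod (f J z))\<^sup>2)}"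

definition L2_inner ::
    "nat \<Rightarrow> (complex ^ 'n) set \<Rightarrow> 'n::finite form \<Rightarrow> 'n form \<Rightarrow> complex" where
  "L2_inner p \<Omega> f g = (\<Sum>J | card J = p. LINT z|lebesgue_on \<Omega>. f J z * cnj (g J z))"

definition L2_norm :: "nat \<Rightarrow> (complex ^ 'n) set \<Rightarrow> 'n::finite form \<Rightarrow> real" where
  "L2_norm p \<Omega> f = sqrt (\<Sum>J | card J = p. LINT z|lebesgue_on \<Omega>. (cmod (f J z))\<^sup>2)"

text \<open>
  $\overline\partial f = 0$ in the sense of distributions. Since
  $d\overline z_k \wedge d\overline z_J = \pm\, d\overline z_{J \cup \{k\}}$ for $k \notin J$, with sign
  $(-1)^{|\{j \in J : j < k\}|}$, the $d\overline z_K$-coefficient of $\overline\partial f$ is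
  $\sum_{k \in K} (-1)^{|\{j \in K : j < k\}|}\, \partial f_{K - \{k\}} / \partial\overline z_k$.
\<close>

definition dbar_closed ::
    "nat \<Rightarrow> (complex, 'n) vec set \<Rightarrow> 'n::{finite,linorder} form \<Rightarrow> bool" where
  "dbar_closed p \<Omega> f \<longleftrightarrow>
     (\<forall>K \<eta>. card K = Suc p \<longrightarrow> test_function \<Omega> \<eta> \<longrightarrow>
        (\<Sum>k\<in>K. (-1) ^ card {j\<in>K. j < k} *
           (LINT z|lebesgue_on \<Omega>. f (K - {k}) z * dbar_partial k \<eta> z)) = 0)"

definition K2_forms :: "nat \<Rightarrow> (complex, 'n) vec set \<Rightarrow> 'n::{finite,linorder} form set" where
  "K2_forms p \<Omega> = {f \<in> L2_forms p \<Omega>. dbar_closed p \<Omega> f}"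

definition A2_forms :: "nat \<Rightarrow> (complex, 'n) vec set \<Rightarrow> 'n::{finite,linorder} form set" where
  "A2_forms p \<Omega> = {f \<in> K2_forms p \<Omega>. \<forall>J. card J = p \<longrightarrow> holomorphic_fun_on (f J) \<Omega>}"

text \<open>
  A representative of the orthogonal projection of \<open>u\<close> to the closed subspace \<open>K2_forms p \<Omega>\<close>; it is
  unique up to a null set.
\<close>

definition bergman_projection ::
    "nat \<Rightarrow> (complex, 'n) vec set \<Rightarrow> 'n::{finite,linorder} form \<Rightarrow> 'n form" where
  "bergman_projection p \<Omega> u =
     (SOME g. g \<in> K2_forms p \<Omega> \<and>
        (\<forall>h \<in> K2_forms p \<Omega>. L2_inner p \<Omega> (\<lambda>J z. u J z - g J z) h = 0))"

definition hankel ::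
    "nat \<Rightarrow> (complex, 'n) vec set \<Rightarrow> ((complex, 'n) vec \<Rightarrow> complex) \<Rightarrow>
      'n::{finite,linorder} form \<Rightarrow> 'n form" where
  "hankel p \<Omega> \<phi> f =
     (\<lambda>J z. \<phi> z * f J z - bergman_projection p \<Omega> (\<lambda>J z. \<phi> z * f J z) J z)"

text \<open>
  Compactness of an operator from a subspace \<open>X\<close> of $L^2_{(0,p)}(\Omega)$ to $L^2_{(0,p)}(\Omega)$: bounded
  sequences are mapped to sequences having a norm convergent subsequence. Linearity is not part
  of the predicate: an operator given on representatives is linear only modulo null sets.
\<close>

definition compact_operator_on ::
    "nat \<Rightarrow> (complex ^ 'n) set \<Rightarrow> 'n::finite form set \<Rightarrow> ('n form \<Rightarrow> 'n form) \<Rightarrow> bool" where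
  "compact_operator_on p \<Omega> X T \<longleftrightarrow>
     (\<forall>f :: nat \<Rightarrow> 'n form.
        (\<forall>m. f m \<in> X) \<longrightarrow> (\<exists>B. \<forall>m. L2_norm p \<Omega> (f m) \<le> B) \<longrightarrow>
        (\<exists>r g. strict_mono r \<and> g \<in> L2_forms p \<Omega> \<and>
           (\<lambda>m. L2_norm p \<Omega> (\<lambda>J z. T (f (r m)) J z - g J z)) \<longlonglongrightarrow> 0))"

end

theory Submission
  imports Defs "HOL-Complex_Analysis.Complex_Analysis"
begin

text \<open>
  Let \<open>L\<close> be the derivative of \<open>\<psi>\<close> at a point where the $\overline\partial$-derivative of
  $\varphi\circ\psi$ does not vanish, \<open>p\<close> the image of that point and \<open>V\<close> the range of \<open>L\<close>, a complex
  space of dimension $q$. Convexity makes the disc affine: for small \<open>x\<close> in \<open>V\<close> the point \<open>p + x\<close> lies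
  in the closure of \<open>\<Omega>\<close>, since a functional separating it would compose with \<open>\<psi>\<close> to a holomorphic
  function with positive real part and too large a derivative (\<open>tangent_disc_in_closure\<close>).
  Consequently every homothetic copy of \<open>\<Omega>\<close> with ratio at most $1/2$, centred at a point \<open>a\<close> close to \<open>p\<close> on a segment into
  \<open>\<Omega>\<close> can be moved a fixed distance in the directions of \<open>V\<close> without leaving \<open>\<Omega>\<close>, however close
  \<open>a\<close> is to the boundary (\<open>anisotropic_ellipsoids\<close>).

  Let $K(a)$ be the norm of the evaluation at \<open>a\<close> on the bounded holomorphic functions with the
  $L^2$ norm. It tends to infinity as \<open>a\<close> tends to \<open>p\<close>, because a complex hyperplane supports \<open>\<Omega>\<close> at
  \<open>p\<close> (\<open>evaluation_norm_blowup\<close>). Choose functions $g_k$ of norm at most 1 that attain $K$ up to a factor 2 at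
  points $a_k$ so sparse that the earlier functions are at most $K(a_k)/4$ at $a_k$.
  The difference \<open>f\<close> of two of them is then at least $K(a_k)/4$ at $a_k$; composing \<open>f\<close> with the homothety
  with fixed point $a_k$ and a fixed ratio, and evaluating the result at $a_k$, shows that \<open>f\<close> has at least
  a fixed $L^2$ mass on the homothetic copy $G_k$ of \<open>\<Omega>\<close>.

  The forms are $\alpha_k = g_k\,\theta$ with a constant form \<open>\<theta>\<close> such that only the derivative of
  \<open>\<phi>\<close> in one direction of \<open>V\<close> survives when $\overline\partial\varphi\wedge\theta$ is evaluated on a
  frame of \<open>V\<close>. The difference \<open>u\<close> of two images under the Hankel operator is
  $\varphi f\theta - \kappa$ with a closed form \<open>\<kappa>\<close>. Pair the equation
  $\overline\partial u = f\,\overline\partial\varphi\wedge\theta$ with a bump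
  supported near \<open>z\<close> in $G_k$, long in the directions of \<open>V\<close> and thin in the others. Evaluated on
  the frame, only derivatives of the bump along \<open>V\<close> occur (\<open>frame_pairing\<close>), so the thinness costs
  nothing, and the bump is circular, so that the average of \<open>f\<close> is its value at \<open>z\<close>. This bounds \<open>f\<close> at
  \<open>z\<close> by averages of \<open>u\<close> and of \<open>\<omega> f\<close>, where \<open>\<omega>\<close> is the oscillation of the derivative of \<open>\<phi>\<close>; taking $L^2$ norms
  over $G_k$ gives \<open>key_estimate\<close>. First making \<open>\<omega>\<close> small by shortening the bumps and then \<open>u\<close>
  small along a subsequence on which the images converge contradicts the mass of \<open>f\<close> on $G_k$.
\<close>

section \<open>Circular averages of holomorphic functions\<close>

lemma nn_integral_lborel_translate:
  fixes f :: "'a::euclidean_space \<Rightarrow> ennreal"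
  assumes [measurable]: "f \<in> borel_measurable borel"
  shows "(\<integral>\<^sup>+x. f (c + x) \<partial>lborel) = (\<integral>\<^sup>+x. f x \<partial>lborel)"
proof -
  have "(\<integral>\<^sup>+x. f x \<partial>lborel) = (\<integral>\<^sup>+x. f x \<partial>distr lborel borel ((+) c))"
    by (simp add: lborel_distr_plus)
  also have "\<dots> = (\<integral>\<^sup>+x. f (c + x) \<partial>lborel)"
    by (subst nn_integral_distr) auto
  finally show ?thesis by simp
qed

text \<open>
  The usual uniqueness argument for Haar measure: integrating \<open>indicator A (R x) * indicator B (y - R x)\<close>
  in both orders identifies the image measure with Lebesgue measure up to a factor, and the factor is 1
  because the unit ball \<open>B\<close> is invariant.
\<close>

lemma lborel_distr_isometry:
  fixes R :: "'a::euclidean_space \<Rightarrow> 'a"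
  assumes R: "linear R" and nR: "\<And>x. norm (R x) = norm x"
  shows "distr lborel borel R = lborel"
proof (rule measure_eqI)
  have [measurable]: "R \<in> borel_measurable borel"
    using R by (intro borel_measurable_continuous_onI linear_continuous_on)
       (simp add: linear_conv_bounded_linear)
  show "sets (distr lborel borel R) = sets lborel" by simp
  fix A assume "A \<in> sets (distr lborel borel R)"
  then have A[measurable]: "A \<in> sets borel" by simp
  define B :: "'a set" where "B = ball 0 1"
  have B[measurable]: "B \<in> sets borel" by (simp add: B_def)
  have "inj R"
    using R nR by (metis linear_injective_0 norm_eq_zero)
  with R have surj: "surj R" by (rule linear_inj_imp_surj)
  have mB: "(\<integral>\<^sup>+y. indicator B (c + y) \<partial>lborel) = emeasure lborel B" for c
    by (subst nn_integral_lborel_translate) auto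
  have "(\<integral>\<^sup>+x. \<integral>\<^sup>+y. indicator A (R x) * indicator B (- R x + y) \<partial>lborel \<partial>lborel)
      = (\<integral>\<^sup>+x. indicator A (R x) * emeasure lborel B \<partial>lborel)"
    by (subst nn_integral_cmult) (simp_all add: mB del: uminus_add_conv_diff)
  also have "\<dots> = emeasure (distr lborel borel R) A * emeasure lborel B"
    by (simp add: nn_integral_multc nn_integral_distr[symmetric, of R lborel borel "indicator A"])
  finally have 1: "(\<integral>\<^sup>+x. \<integral>\<^sup>+y. indicator A (R x) * indicator B (- R x + y) \<partial>lborel \<partial>lborel)
      = emeasure (distr lborel borel R) A * emeasure lborel B" .
  have "(\<integral>\<^sup>+x. \<integral>\<^sup>+y. indicator A (R x) * indicator B (- R x + y) \<partial>lborel \<partial>lborel)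
     = (\<integral>\<^sup>+y. \<integral>\<^sup>+x. indicator A (R x) * indicator B (- R x + y) \<partial>lborel \<partial>lborel)"
    by (rule lborel_pair.Fubini') measurable
  also have "\<dots> = (\<integral>\<^sup>+y. \<integral>\<^sup>+x. indicator A (y + R x) * indicator B x \<partial>lborel \<partial>lborel)"
  proof (rule nn_integral_cong)
    fix y
    obtain y' where y': "R y' = y" using surj by (metis surjD)
    have "(\<integral>\<^sup>+x. indicator A (R x) * indicator B (- R x + y) \<partial>lborel)
       = (\<integral>\<^sup>+x. indicator A (R (y' + x)) * indicator B (- R (y' + x) + y) \<partial>lborel :: ennreal)"
      by (rule nn_integral_lborel_translate[symmetric]) measurable
    also have "\<dots> = (\<integral>\<^sup>+x. indicator A (y + R x) * indicator B x \<partial>lborel)"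
      by (intro nn_integral_cong) (simp add: linear_add[OF R] y' B_def indicator_def nR)
    finally show "(\<integral>\<^sup>+x. indicator A (R x) * indicator B (- R x + y) \<partial>lborel)
       = (\<integral>\<^sup>+x. indicator A (y + R x) * indicator B x \<partial>lborel :: ennreal)" .
  qed
  also have "\<dots> = (\<integral>\<^sup>+x. \<integral>\<^sup>+y. indicator A (y + R x) * indicator B x \<partial>lborel \<partial>lborel)"
    by (rule lborel_pair.Fubini') measurable
  also have "\<dots> = (\<integral>\<^sup>+x. emeasure lborel A * indicator B x \<partial>lborel)"
  proof (rule nn_integral_cong)
    fix x
    have "(\<integral>\<^sup>+y. indicator A (y + R x) * indicator B x \<partial>lborel)
        = (\<integral>\<^sup>+y. indicator A (R x + y) \<partial>lborel) * indicator B x"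
      by (simp add: nn_integral_multc add.commute)
    also have "(\<integral>\<^sup>+y. indicator A (R x + y) \<partial>lborel) = emeasure lborel A"
      by (subst nn_integral_lborel_translate) auto
    finally show "(\<integral>\<^sup>+y. indicator A (y + R x) * indicator B x \<partial>lborel) = emeasure lborel A * indicator B x" .
  qed
  also have "\<dots> = emeasure lborel A * emeasure lborel B"
    by (simp add: nn_integral_cmult)
  finally have "emeasure (distr lborel borel R) A * emeasure lborel B = emeasure lborel A * emeasure lborel B"
    using 1 by simp
  moreover have "emeasure lborel B \<noteq> 0" 
  proof -
    have "\<not> negligible B" unfolding B_def by (rule open_not_negligible) auto
    then show ?thesis by (auto simp: negligible_iff_null_sets null_sets_def)
  qed
  moreover have "emeasure lborel B \<noteq> \<infinity>" 
    using emeasure_bounded_finite[of B] by (simp add: B_def)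
  ultimately show "emeasure (distr lborel borel R) A = emeasure lborel A"
    using ennreal_mult_divide_eq[of "emeasure lborel B"] by (metis infinity_ennreal_def)
qed

lemma norm_vscale: "norm (c *s w) = cmod c * norm (w :: complex ^ 'n)"
  by (simp add: norm_vec_def norm_mult L2_set_right_distrib)

lemma linear_vscale: "linear (\<lambda>w::complex ^ 'n. c *s w)"
  by (rule linearI) (simp_all add: vec_eq_iff algebra_simps)

lemma continuous_on_vscale [continuous_intros]:
  fixes w :: "'a::topological_space \<Rightarrow> complex ^ 'n"
  assumes "continuous_on S c" "continuous_on S w"
  shows "continuous_on S (\<lambda>x. c x *s w x)"
  unfolding vector_scalar_mult_def by (intro continuous_intros assms)

lemma integral_lborel_unimodular:
  fixes h :: "complex ^ 'n \<Rightarrow> complex"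
  assumes "cmod c = 1" and [measurable]: "h \<in> borel_measurable borel"
  shows "(LINT w|lborel. h (c *s w)) = (LINT w|lborel. h w)"
proof -
  have m: "(\<lambda>w::complex ^ 'n. c *s w) \<in> borel_measurable borel"
    by (intro borel_measurable_continuous_onI continuous_intros)
  have "(LINT w|lborel. h w) = (LINT w|distr lborel borel (\<lambda>w. c *s w). h w)"
    by (subst lborel_distr_isometry) (auto simp: linear_vscale norm_vscale assms)
  also have "\<dots> = (LINT w|lborel. h (c *s w))"
    using m by (subst integral_distr) auto
  finally show ?thesis by simp
qed

lemma has_derivative_line:
  fixes z w :: "complex ^ 'n"
  shows "((\<lambda>\<zeta>. z + \<zeta> *s w) has_derivative (\<lambda>h. h *s w)) (at \<zeta>)"
proof -
  have "linear (\<lambda>\<zeta>. \<zeta> *s w)" by (rule linearI) (simp_all add: vec_eq_iff algebra_simps)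
  then have "((\<lambda>\<zeta>. \<zeta> *s w) has_derivative (\<lambda>h. h *s w)) (at \<zeta>)"
    by (rule linear_imp_has_derivative)
  then show ?thesis by (auto intro!: derivative_eq_intros)
qed

lemma holomorphic_fun_on_line:
  fixes f :: "complex ^ 'n \<Rightarrow> complex"
  assumes "holomorphic_fun_on f U" and "\<And>\<zeta>. \<zeta> \<in> S \<Longrightarrow> z + \<zeta> *s w \<in> U"
  shows "(\<lambda>\<zeta>. f (z + \<zeta> *s w)) holomorphic_on S"
  unfolding holomorphic_on_def
proof
  fix \<zeta> assume "\<zeta> \<in> S"
  then obtain L where L: "(f has_derivative L) (at (z + \<zeta> *s w))" "\<And>c v. L (c *s v) = c * L v"
    using assms unfolding holomorphic_fun_on_def by blast
  from has_derivative_compose[OF has_derivative_line L(1)]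
  moreover have "(\<lambda>h. L (h *s w)) = (*) (L w)" by (simp add: fun_eq_iff L(2))
  ultimately have "((\<lambda>\<zeta>. f (z + \<zeta> *s w)) has_field_derivative L w) (at \<zeta>)"
    unfolding has_field_derivative_def by simp
  then show "(\<lambda>\<zeta>. f (z + \<zeta> *s w)) field_differentiable at \<zeta> within S"
    using field_differentiable_def has_field_derivative_at_within by blast
qed

lemma holomorphic_fun_onE:
  assumes "holomorphic_fun_on f U"
  obtains f' where "\<And>x. x \<in> U \<Longrightarrow> (f has_derivative f' x) (at x)"
    "\<And>x c v. x \<in> U \<Longrightarrow> f' x (c *s v) = c * f' x v"
proof -
  have "\<forall>x. \<exists>L. x \<in> U \<longrightarrow> (f has_derivative L) (at x) \<and> (\<forall>c v. L (c *s v) = c * L v)"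
    using assms unfolding holomorphic_fun_on_def by blast
  from choice[OF this] show ?thesis using that by blast
qed

lemma holomorphic_fun_on_imp_continuous_on:
  assumes "holomorphic_fun_on f U" 
  shows "continuous_on U f"
  using assms unfolding holomorphic_fun_on_def
  by (meson continuous_at_imp_continuous_on has_derivative_continuous)

text \<open>
  Cauchy's formula as an integral over the parameter of the circle, the form needed under an outer integral.
\<close>

lemma circle_mean_value:
  assumes "h holomorphic_on cball 0 1"
  shows "((\<lambda>t. h (exp (2 * of_real pi * \<i> * of_real t))) has_integral h 0) {0..1}"
proof -
  let ?e = "\<lambda>t::real. exp (2 * of_real pi * \<i> * of_real t) :: complex"
  have "((\<lambda>u. h u / (u - 0)) has_contour_integral (2 * of_real pi * \<i> * h 0)) (circlepath 0 1)"
    by (rule Cauchy_integral_circlepath_simple) (use assms in auto)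
  then have I: "((\<lambda>t. h (circlepath 0 1 t) / (circlepath 0 1 t) * vector_derivative (circlepath 0 1) (at t within {0..1}))
      has_integral (2 * of_real pi * \<i> * h 0)) {0..1}"
    by (simp add: has_contour_integral_def)
  define c :: complex where "c = 2 * of_real pi * \<i>"
  have "h (circlepath 0 1 t) / (circlepath 0 1 t) * vector_derivative (circlepath 0 1) (at t within {0..1}) = c * h (?e t)"
    if "t \<in> {0..1}" for t
    using that by (subst vector_derivative_circlepath01) (auto simp: circlepath c_def)
  from has_integral_eq[OF this I] have "((\<lambda>t. c * h (?e t)) has_integral (c * h 0)) {0..1}"
    by (simp add: c_def)
  then have "((\<lambda>t. inverse c * (c * h (?e t))) has_integral (inverse c * (c * h 0))) {0..1}"
    by (rule has_integral_mult_right)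
  moreover have "c \<noteq> 0" by (simp add: c_def)
  ultimately show ?thesis by (simp add: mult.assoc[symmetric])
qed

text \<open>
  Replacing \<open>w\<close> by \<open>c *s w\<close> with \<open>cmod c = 1\<close> changes neither Lebesgue measure nor the weight, so the
  integral is unchanged if \<open>f (z + w)\<close> is replaced by its average over \<open>f (z + c *s w)\<close>; by Cauchy's
  formula on the complex line through \<open>z\<close> and \<open>w\<close> this average is \<open>f z\<close>.
\<close>

lemma holomorphic_circular_mean_value:
  fixes f :: "complex ^ 'n \<Rightarrow> complex" and g :: "complex ^ 'n \<Rightarrow> complex"
  assumes hol: "holomorphic_fun_on f U"
    and S: "compact S" "\<And>w. w \<in> S \<Longrightarrow> z + w \<in> U"
    and bal: "\<And>c w. w \<in> S \<Longrightarrow> cmod c \<le> 1 \<Longrightarrow> c *s w \<in> S"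
    and g: "continuous_on UNIV g" "\<And>w. w \<notin> S \<Longrightarrow> g w = 0"
    and circ: "\<And>c w. cmod c = 1 \<Longrightarrow> g (c *s w) = g w"
  shows "(LINT w|lborel. f (z + w) * g w) = f z * (LINT w|lborel. g w)"
proof -
  let ?e = "\<lambda>t::real. exp (2 * of_real pi * \<i> * of_real t) :: complex"
  have ne: "cmod (?e t) = 1" for t by (simp add: norm_exp)
  have cf: "continuous_on U f" by (rule holomorphic_fun_on_imp_continuous_on[OF hol])
  define H where "H w = indicator S w *\<^sub>R (f (z + w) * g w)" for w
  have cH0: "continuous_on S (\<lambda>w. f (z + w) * g w)"
    using S(2) by (intro continuous_intros continuous_on_compose2[OF cf] continuous_on_subset[OF g(1)]) auto
  have iH: "integrable lborel H" unfolding H_def by (rule borel_integrable_compact[OF S(1) cH0])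
  then have mH[measurable]: "H \<in> borel_measurable borel" by simp
  have H: "H w = f (z + w) * g w" for w using g(2)[of w] by (simp add: H_def indicator_def)
  define K where "K p = (case p of (t, w) \<Rightarrow> indicator ({0..1::real} \<times> S) (t, w) *\<^sub>R (f (z + ?e t *s w) * g w))" for p
  have "continuous_on ({0..1} \<times> S) (\<lambda>p. f (z + ?e (fst p) *s snd p) * g (snd p))"
    using S(2) bal ne
    by (intro continuous_intros continuous_on_compose2[OF cf] continuous_on_compose2[OF g(1)])
       (auto intro!: S(2) bal simp: ne)
  from borel_integrable_compact[OF compact_Times[OF compact_Icc S(1)] this]
  have iK: "integrable (lborel \<Otimes>\<^sub>M lborel) K"
    by (simp only: K_def[abs_def] lborel_prod case_prod_beta' prod.collapse)
  then have iK': "integrable (lborel \<Otimes>\<^sub>M lborel) (\<lambda>(t,w). K (t, w))" by simp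
  have "(LINT t|lborel. LINT w|lborel. K (t, w)) = (LINT t|lborel. indicator {0..1::real} t *\<^sub>R (LINT w|lborel. H w))"
  proof (rule Bochner_Integration.integral_cong[OF refl])
    fix t :: real
    show "(LINT w|lborel. K (t, w)) = indicator {0..1} t *\<^sub>R (LINT w|lborel. H w)"
    proof (cases "t \<in> {0..1}")
      case True
      have "K (t, w) = H (?e t *s w)" for w
      proof (cases "w \<in> S")
        case True
        then show ?thesis using \<open>t \<in> {0..1}\<close> bal[of w "?e t"] ne by (simp add: K_def H circ)
      next
        case False
        have "?e (-t) *s (?e t *s w) = w"
          by (simp add: vec_eq_iff exp_minus mult.assoc[symmetric])
        then have "?e t *s w \<notin> S" using False bal[of "?e t *s w" "?e (-t)"] ne by auto
        then show ?thesis using False by (simp add: K_def H_def)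
      qed
      then show ?thesis using True integral_lborel_unimodular[OF ne mH, of t] by simp
    qed (auto simp: K_def indicator_def)
  qed
  also have "\<dots> = (LINT w|lborel. H w)" by simp
  finally have 1: "(LINT t|lborel. LINT w|lborel. K (t, w)) = (LINT w|lborel. H w)" .
  have "(LINT t|lborel. LINT w|lborel. K (t, w)) = (LINT w|lborel. LINT t|lborel. K (t, w))"
    using lborel_pair.Fubini_integral[OF iK'] by simp
  also have "\<dots> = (LINT w|lborel. f z * g w)"
  proof (rule Bochner_Integration.integral_cong[OF refl])
    fix w
    show "(LINT t|lborel. K (t, w)) = f z * g w"
    proof (cases "w \<in> S")
      case True
      have hl: "(\<lambda>\<zeta>. f (z + \<zeta> *s w)) holomorphic_on cball 0 1"
        by (rule holomorphic_fun_on_line[OF hol]) (use True in \<open>auto intro!: S(2) bal\<close>)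
      have m: "((\<lambda>t. f (z + ?e t *s w)) has_integral f z) {0..1}"
        using circle_mean_value[OF hl] by simp
      have "continuous_on {0..1} (\<lambda>t. f (z + ?e t *s w))"
        by (intro continuous_intros continuous_on_compose2[OF cf]) (auto intro!: S(2) bal True simp: ne)
      then have si: "set_integrable lborel {0..1} (\<lambda>t. f (z + ?e t *s w))"
        unfolding set_integrable_def by (rule borel_integrable_compact[OF compact_Icc])
      have "(LINT t:{0..1}|lborel. f (z + ?e t *s w)) = f z"
        using set_borel_integral_eq_integral(2)[OF si] m by (simp add: integral_unique)
      moreover have "K (t, w) = (indicator {0..1} t *\<^sub>R f (z + ?e t *s w)) * g w" for t
        using True by (simp add: K_def indicator_def)
      ultimately show ?thesis by (simp only: set_lebesgue_integral_def integral_mult_left_zero)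
    qed (simp add: K_def g(2))
  qed
  also have "\<dots> = f z * (LINT w|lborel. g w)" by simp
  finally show ?thesis using 1 by (simp add: H[symmetric])
qed

section \<open>Smooth bump functions\<close>

lemma C_k_const: "C_k m (\<lambda>x. c)"
  by (induction m arbitrary: c) (auto simp: frechet_derivative_const)

lemma C_k_Suc_imp: "C_k (Suc m) f \<Longrightarrow> C_k m f"
proof (induction m arbitrary: f)
  case 0
  then show ?case by (auto intro: differentiable_imp_continuous_on)
next
  case (Suc m)
  then show ?case by auto
qed

lemma C_k_add: "C_k m f \<Longrightarrow> C_k m g \<Longrightarrow> C_k m (\<lambda>x. f x + g x)"
proof (induction m arbitrary: f g)
  case 0
  then show ?case by (auto intro: continuous_on_add)
next
  case (Suc m)
  have d: "f differentiable at x" "g differentiable at x" for x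
    using Suc.prems by (auto simp: differentiable_on_def)
  have "frechet_derivative (\<lambda>x. f x + g x) (at x) = (\<lambda>v. frechet_derivative f (at x) v + frechet_derivative g (at x) v)" for x
    by (rule frechet_derivative_at[symmetric]) (intro has_derivative_add d[THEN frechet_derivative_works[THEN iffD1]])
  then show ?case using Suc d by (auto simp: differentiable_on_def intro!: differentiable_add)
qed

lemma C_k_mult: "C_k m f \<Longrightarrow> C_k m g \<Longrightarrow> C_k m (\<lambda>x. f x * g x)"
proof (induction m arbitrary: f g)
  case 0
  then show ?case by (auto intro: continuous_on_mult)
next
  case (Suc m)
  have d: "f differentiable at x" "g differentiable at x" for x
    using Suc.prems by (auto simp: differentiable_on_def)
  have "frechet_derivative (\<lambda>x. f x * g x) (at x)
      = (\<lambda>v. f x * frechet_derivative g (at x) v + frechet_derivative f (at x) v * g x)" for x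
    by (rule frechet_derivative_at[symmetric]) (intro has_derivative_mult d[THEN frechet_derivative_works[THEN iffD1]])
  then show ?case using Suc.prems d C_k_Suc_imp[OF Suc.prems(1)] C_k_Suc_imp[OF Suc.prems(2)]
    by (auto simp: differentiable_on_def intro!: differentiable_mult C_k_add Suc.IH)
qed

lemma C_k_linear:
  assumes "bounded_linear f"
  shows "C_k m f"
proof (cases m)
  case 0
  then show ?thesis using assms by (simp add: linear_continuous_on)
next
  case (Suc k)
  have "frechet_derivative f (at x) = f" for x
    using bounded_linear_imp_has_derivative[OF assms] by (metis frechet_derivative_at)
  then show ?thesis using Suc assms
    by (auto simp: C_k_const differentiable_on_def intro: bounded_linear_imp_differentiable)
qed

text \<open>
  The functions $p(1/t)\,e^{-1/t}$, extended by 0 to $t \le 0$, for polynomials \<open>p\<close>: a class closed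
  under differentiation, which turns smoothness into an induction.
\<close>

definition exp_flat :: "real poly \<Rightarrow> real \<Rightarrow> real" where
  "exp_flat p t = (if t > 0 then poly p (1 / t) * exp (- (1 / t)) else 0)"

definition exp_flat_deriv :: "real poly \<Rightarrow> real poly" where
  "exp_flat_deriv p = monom 1 2 * (p - pderiv p)"

lemma tendsto_poly_exp: "((\<lambda>x::real. poly p x * exp (- x)) \<longlongrightarrow> 0) at_top"
proof -
  have "((\<lambda>x::real. \<Sum>i\<le>degree p. coeff p i * (x ^ i / exp x)) \<longlongrightarrow> (\<Sum>i\<le>degree p. coeff p i * 0)) at_top"
    by (intro tendsto_sum tendsto_mult tendsto_const tendsto_power_div_exp_0)
  then show ?thesis
    by (simp add: poly_altdef sum_distrib_right sum_distrib_left exp_minus divide_inverse mult_ac)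
qed

lemma exp_flat_DERIV: "(exp_flat p has_real_derivative exp_flat (exp_flat_deriv p) t) (at t)"
proof -
  consider "t > 0" | "t < 0" | "t = 0" by linarith
  then show ?thesis
  proof cases
    case 1
    have "((\<lambda>t. poly p (1 / t) * exp (- (1 / t))) has_real_derivative
        poly p (1 / t) * (exp (- (1 / t)) * (1 / t ^ 2)) + poly (pderiv p) (1 / t) * (- (1 / t ^ 2)) * exp (- (1 / t))) (at t)"
      using 1 by (auto intro!: derivative_eq_intros DERIV_chain'[where g="poly p"] simp: power2_eq_square field_simps)
    also have "poly p (1 / t) * (exp (- (1 / t)) * (1 / t ^ 2)) + poly (pderiv p) (1 / t) * (- (1 / t ^ 2)) * exp (- (1 / t))
       = exp_flat (exp_flat_deriv p) t"
      using 1 by (simp add: exp_flat_def exp_flat_deriv_def poly_monom algebra_simps power_one_over)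
    finally show ?thesis
      by (rule has_field_derivative_transform_within_open[where S="{0<..}"])
         (use 1 in \<open>auto simp: exp_flat_def\<close>)
  next
    case 2
    have "((\<lambda>t. 0) has_real_derivative exp_flat (exp_flat_deriv p) t) (at t)"
      using 2 by (simp add: exp_flat_def)
    then show ?thesis
      by (rule has_field_derivative_transform_within_open[where S="{..<0}"])
         (use 2 in \<open>auto simp: exp_flat_def\<close>)
  next
    case 3
    have r: "((\<lambda>y. exp_flat p y / y) \<longlongrightarrow> 0) (at_right 0)"
    proof -
      have "((\<lambda>x. poly (monom 1 1 * p) x * exp (- x)) \<longlongrightarrow> 0) at_top"
        by (rule tendsto_poly_exp)
      then have "((\<lambda>y. poly (monom 1 1 * p) (inverse y) * exp (- inverse y)) \<longlongrightarrow> 0) (at_right 0)"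
        by (rule filterlim_compose) (rule filterlim_inverse_at_top_right)
      then show ?thesis
        by (rule Lim_transform_eventually)
           (auto simp: eventually_at_filter exp_flat_def poly_monom field_simps)
    qed
    have l: "((\<lambda>y. exp_flat p y / y) \<longlongrightarrow> 0) (at_left 0)"
      by (rule tendsto_eventually) (auto simp: eventually_at_filter exp_flat_def)
    have "((\<lambda>y. exp_flat p y / y) \<longlongrightarrow> 0) (at 0)"
      using l r by (simp add: filterlim_at_split)
    then show ?thesis using 3 by (simp add: has_field_derivative_iff exp_flat_def)
  qed
qed

lemma exp_flat_quadratic_has_derivative:
  fixes A :: "'a::euclidean_space \<Rightarrow> 'b::euclidean_space"
  assumes A: "linear A"
  shows "((\<lambda>x. complex_of_real (exp_flat p (1 - (norm (A (x - z)))\<^sup>2))) has_derivative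
      (\<lambda>v. complex_of_real (exp_flat (exp_flat_deriv p) (1 - (norm (A (x - z)))\<^sup>2)) * complex_of_real (- 2 * (A (x - z) \<bullet> A v)))) (at x)"
proof -
  define P where "P x = 1 - (norm (A (x - z)))\<^sup>2" for x
  have bl: "bounded_linear A" using A by (simp add: linear_conv_bounded_linear)
  have dP: "(P has_derivative (\<lambda>v. - 2 * (A (x - z) \<bullet> A v))) (at x)" for x
  proof -
    have "((\<lambda>x. A (x - z)) has_derivative A) (at x)"
      using has_derivative_compose[of "\<lambda>x. x - z" "\<lambda>v. v" x UNIV A A] bounded_linear_imp_has_derivative[OF bl]
      by (auto intro!: derivative_eq_intros bounded_linear.has_derivative[OF bl])
    then have "((\<lambda>x. 1 - A (x - z) \<bullet> A (x - z)) has_derivative (\<lambda>v. - (A (x - z) \<bullet> A v + A v \<bullet> A (x - z)))) (at x)"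
      by (auto intro!: derivative_eq_intros)
    then show ?thesis by (simp add: P_def[abs_def] power2_norm_eq_inner inner_commute algebra_simps)
  qed
  have "(exp_flat p has_derivative (\<lambda>h. h * exp_flat (exp_flat_deriv p) (P x))) (at (P x))"
    using exp_flat_DERIV[of p "P x"] by (simp add: has_field_derivative_def mult.commute[of _ "exp_flat _ _"])
  from has_derivative_of_real[OF has_derivative_compose[OF dP this]]
  show ?thesis by (simp add: mult.commute P_def)
qed

lemma continuous_on_exp_flat: "continuous_on UNIV (exp_flat p)"
  using exp_flat_DERIV by (meson DERIV_isCont continuous_at_imp_continuous_on)

text \<open>
  A derivative is again such a function, with another polynomial, times an affine function; this drives the induction on the order.
\<close>

lemma C_k_exp_flat_quadratic:
  fixes A :: "'a::euclidean_space \<Rightarrow> 'b::euclidean_space"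
  assumes A: "linear A"
  shows "C_k m (\<lambda>x. complex_of_real (exp_flat p (1 - (norm (A (x - z)))\<^sup>2)))"
proof (induction m arbitrary: p)
  case 0
  show ?case
    unfolding C_k.simps
    by (intro continuous_at_imp_continuous_on ballI has_derivative_continuous[OF exp_flat_quadratic_has_derivative[OF A]])
next
  case (Suc m)
  define P where "P x = 1 - (norm (A (x - z)))\<^sup>2" for x
  have bl: "bounded_linear A" using A by (simp add: linear_conv_bounded_linear)
  note dE = exp_flat_quadratic_has_derivative[OF A, of p z, folded P_def]
  have fd: "frechet_derivative (\<lambda>x. complex_of_real (exp_flat p (P x))) (at x) =
      (\<lambda>v. complex_of_real (exp_flat (exp_flat_deriv p) (P x)) * complex_of_real (- 2 * (A (x - z) \<bullet> A v)))" for x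
    using dE by (metis frechet_derivative_at)
  have lin: "C_k m (\<lambda>x. complex_of_real (- 2 * (A (x - z) \<bullet> A v)))" for v
  proof -
    have "bounded_linear (\<lambda>x. complex_of_real (- 2 * (A x \<bullet> A v)))"
      by (intro bounded_linear_compose[OF bounded_linear_of_real] bounded_linear_compose[OF bounded_linear_mult_right]
           bounded_linear_compose[OF bounded_linear_inner_left bl])
    then have "C_k m (\<lambda>x. complex_of_real (- 2 * (A x \<bullet> A v)) + complex_of_real (2 * (A z \<bullet> A v)))"
      by (intro C_k_add C_k_linear C_k_const)
    moreover have "(\<lambda>x. complex_of_real (- 2 * (A x \<bullet> A v)) + complex_of_real (2 * (A z \<bullet> A v)))
       = (\<lambda>x. complex_of_real (- 2 * (A (x - z) \<bullet> A v)))"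
      by (simp add: linear_diff[OF A] inner_diff_left algebra_simps fun_eq_iff)
    ultimately show ?thesis by simp
  qed
  have "C_k (Suc m) (\<lambda>x. complex_of_real (exp_flat p (P x)))"
    using dE Suc.IH[folded P_def] lin
    by (auto simp: differentiable_on_def differentiable_def fd intro!: C_k_mult simp del: of_real_mult of_real_minus of_real_numeral)
  then show ?case by (simp add: P_def)
qed

section \<open>Contraction and exterior multiplication of coefficient families\<close>

text \<open>
  Coefficient families are indexed by sets as in \<^typ>\<open>'n form\<close>, at a fixed point. With the sign of
  \<^const>\<open>dbar_closed\<close>, \<open>wedge1 a\<close> is exterior multiplication by $\sum_k a_k\,d\overline z_k$, and
  \<open>contract1 v\<close> is insertion of $\overline v$ into the first slot.
\<close>

definition koszul_sign :: "'n::linorder \<Rightarrow> 'n set \<Rightarrow> complex" where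
  "koszul_sign k J = (-1) ^ card {j\<in>J. j < k}"

definition wedge1 :: "('n::{finite,linorder} \<Rightarrow> complex) \<Rightarrow> ('n set \<Rightarrow> complex) \<Rightarrow> 'n set \<Rightarrow> complex" where
  "wedge1 a F K = (\<Sum>k\<in>K. koszul_sign k K * (a k * F (K - {k})))"

definition contract1 :: "(complex, 'n::{finite,linorder}) vec \<Rightarrow> ('n set \<Rightarrow> complex) \<Rightarrow> 'n set \<Rightarrow> complex" where
  "contract1 v F J = (\<Sum>k\<in>-J. koszul_sign k J * (cnj (v $ k) * F (insert k J)))"

definition conj_pair :: "('n \<Rightarrow> complex) \<Rightarrow> complex ^ 'n \<Rightarrow> complex" where
  "conj_pair a v = (\<Sum>k\<in>UNIV. a k * cnj (v $ k))"

fun contract_list :: "(complex, 'n::{finite,linorder}) vec list \<Rightarrow> ('n set \<Rightarrow> complex) \<Rightarrow> 'n set \<Rightarrow> complex" where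
  "contract_list [] F = F"
| "contract_list (v # vs) F = contract_list vs (contract1 v F)"

fun wedge_list :: "('n \<Rightarrow> complex) list \<Rightarrow> ('n::{finite,linorder} set \<Rightarrow> complex)" where
  "wedge_list [] = (\<lambda>J. if J = {} then 1 else 0)"
| "wedge_list (w # ws) = wedge1 w (wedge_list ws)"

lemma koszul_sign_square [simp]: "koszul_sign k J * koszul_sign k J = 1"
  by (simp add: koszul_sign_def flip: power_mult_distrib)

lemma koszul_sign_insert_self [simp]: "koszul_sign k (insert k J) = koszul_sign k J"
  unfolding koszul_sign_def by (rule arg_cong[where f="\<lambda>A. (-1) ^ card A"]) auto

lemma koszul_sign_remove_self [simp]: "koszul_sign k (J - {k}) = koszul_sign k J"
  unfolding koszul_sign_def by (rule arg_cong[where f="\<lambda>A. (-1) ^ card A"]) auto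

lemma norm_koszul_sign [simp]: "cmod (koszul_sign k J) = 1"
  by (simp add: koszul_sign_def norm_power)

lemma koszul_sign_insert:
  fixes J :: "'n::{finite,linorder} set"
  assumes "l \<notin> J"
  shows "koszul_sign k (insert l J) = (if l < k then - koszul_sign k J else koszul_sign k J)"
proof (cases "l < k")
  case True
  have "{j \<in> insert l J. j < k} = insert l {j \<in> J. j < k}" using True by auto
  then show ?thesis using True assms by (simp add: koszul_sign_def)
next
  case False
  have "{j \<in> insert l J. j < k} = {j \<in> J. j < k}" using False by auto
  then show ?thesis using False by (simp add: koszul_sign_def)
qed

lemma koszul_sign_swap:
  fixes J :: "'n::{finite,linorder} set"
  assumes "k \<notin> J" "l \<in> J"
  shows "koszul_sign k J * koszul_sign l (insert k J) = - (koszul_sign l J * koszul_sign k (J - {l}))"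
proof -
  have 1: "koszul_sign l (insert k J) = (if k < l then - koszul_sign l J else koszul_sign l J)"
    using assms by (rule_tac koszul_sign_insert)
  have "koszul_sign k (insert l (J - {l})) = (if l < k then - koszul_sign k (J - {l}) else koszul_sign k (J - {l}))"
    by (rule koszul_sign_insert) simp
  then have 2: "koszul_sign k J = (if l < k then - koszul_sign k (J - {l}) else koszul_sign k (J - {l}))"
    using assms by (simp add: insert_absorb)
  have "k \<noteq> l" using assms by auto
  then consider "k < l" "\<not> l < k" | "l < k" "\<not> k < l" by fastforce
  then show ?thesis by cases (simp_all only: 1 2 if_True if_False mult_ac minus_mult_left[symmetric] minus_mult_right[symmetric])
qed

text \<open>
  The Clifford relation. For \<open>k \<noteq> l\<close> the two orders of inserting \<open>k\<close> and removing \<open>l\<close> differ by a sign,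
  by \<open>koszul_sign_swap\<close>, and cancel; the terms \<open>k = l\<close> add up to the pairing.
\<close>

lemma contract1_wedge1:
  "contract1 v (wedge1 a F) J = conj_pair a v * F J - wedge1 a (contract1 v F) J"
proof -
  let ?S = "\<Sum>k\<in>-J. \<Sum>l\<in>J. koszul_sign l J * koszul_sign k (J - {l}) * (cnj (v $ k) * a l * F (insert k J - {l}))"
  have "contract1 v (wedge1 a F) J
      = (\<Sum>k\<in>-J. cnj (v $ k) * a k * F J
           - (\<Sum>l\<in>J. koszul_sign l J * koszul_sign k (J - {l}) * (cnj (v $ k) * a l * F (insert k J - {l}))))"
    unfolding contract1_def wedge1_def
  proof (rule sum.cong, rule refl)
    fix k assume "k \<in> - J"
    then have k: "k \<notin> J" by simp
    have "koszul_sign k J * (cnj (v $ k) * (\<Sum>l\<in>insert k J. koszul_sign l (insert k J) * (a l * F (insert k J - {l}))))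
       = koszul_sign k J * (cnj (v $ k) * (koszul_sign k J * (a k * F J)))
         + (\<Sum>l\<in>J. (koszul_sign k J * koszul_sign l (insert k J)) * (cnj (v $ k) * a l * F (insert k J - {l})))"
      using k by (simp add: sum.insert[OF finite] sum_distrib_left distrib_left mult.assoc mult.left_commute)
    also have "koszul_sign k J * (cnj (v $ k) * (koszul_sign k J * (a k * F J)))
       = (koszul_sign k J * koszul_sign k J) * (cnj (v $ k) * a k * F J)"
      by (simp only: mult_ac)
    also have "(\<Sum>l\<in>J. (koszul_sign k J * koszul_sign l (insert k J)) * (cnj (v $ k) * a l * F (insert k J - {l})))
       = - (\<Sum>l\<in>J. koszul_sign l J * koszul_sign k (J - {l}) * (cnj (v $ k) * a l * F (insert k J - {l})))"
      by (subst sum_negf[symmetric], rule sum.cong) (use k in \<open>simp_all add: koszul_sign_swap[of k J]\<close>)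
    finally show "koszul_sign k J * (cnj (v $ k) * (\<Sum>l\<in>insert k J. koszul_sign l (insert k J) * (a l * F (insert k J - {l}))))
      = cnj (v $ k) * a k * F J
           - (\<Sum>l\<in>J. koszul_sign l J * koszul_sign k (J - {l}) * (cnj (v $ k) * a l * F (insert k J - {l})))"
      by simp
  qed
  also have "\<dots> = (\<Sum>k\<in>-J. cnj (v $ k) * a k * F J) - ?S"
    by (simp add: sum_subtractf)
  finally have A: "contract1 v (wedge1 a F) J = (\<Sum>k\<in>-J. cnj (v $ k) * a k * F J) - ?S" .
  have "wedge1 a (contract1 v F) J
      = (\<Sum>l\<in>J. cnj (v $ l) * a l * F J
           + (\<Sum>k\<in>-J. koszul_sign l J * koszul_sign k (J - {l}) * (cnj (v $ k) * a l * F (insert k J - {l}))))"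
    unfolding contract1_def wedge1_def
  proof (rule sum.cong, rule refl)
    fix l assume l: "l \<in> J"
    have *: "- (J - {l}) = insert l (-J)" using l by auto
    have eq: "(\<Sum>k\<in>-J. koszul_sign l J * koszul_sign k (J - {l}) * (cnj (v $ k) * a l * F (insert k (J - {l}))))
      = (\<Sum>k\<in>-J. koszul_sign l J * koszul_sign k (J - {l}) * (cnj (v $ k) * a l * F (insert k J - {l})))"
    proof (rule sum.cong, rule refl)
      fix k assume "k \<in> - J"
      then have "insert k (J - {l}) = insert k J - {l}" using l by auto
      then show "koszul_sign l J * koszul_sign k (J - {l}) * (cnj (v $ k) * a l * F (insert k (J - {l})))
        = koszul_sign l J * koszul_sign k (J - {l}) * (cnj (v $ k) * a l * F (insert k J - {l}))" by simp
    qed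
    have "koszul_sign l J * (a l * (\<Sum>k\<in>-(J - {l}). koszul_sign k (J - {l}) * (cnj (v $ k) * F (insert k (J - {l})))))
       = koszul_sign l J * (a l * (koszul_sign l J * (cnj (v $ l) * F J)))
         + (\<Sum>k\<in>-J. koszul_sign l J * koszul_sign k (J - {l}) * (cnj (v $ k) * a l * F (insert k (J - {l}))))"
      unfolding * using l by (simp add: sum.insert[OF finite] sum_distrib_left distrib_left mult.assoc mult.left_commute insert_absorb)
    also have "koszul_sign l J * (a l * (koszul_sign l J * (cnj (v $ l) * F J)))
       = (koszul_sign l J * koszul_sign l J) * (cnj (v $ l) * a l * F J)"
      by (simp only: mult_ac)
    finally show "koszul_sign l J * (a l * (\<Sum>k\<in>-(J - {l}). koszul_sign k (J - {l}) * (cnj (v $ k) * F (insert k (J - {l})))))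
      = cnj (v $ l) * a l * F J
           + (\<Sum>k\<in>-J. koszul_sign l J * koszul_sign k (J - {l}) * (cnj (v $ k) * a l * F (insert k J - {l})))"
      by (simp only: eq koszul_sign_square mult_1_left)
  qed
  also have "\<dots> = (\<Sum>k\<in>J. cnj (v $ k) * a k * F J) + ?S"
    unfolding sum.distrib by (subst sum.swap[of _ "-J" J]) (rule refl)
  finally have B: "wedge1 a (contract1 v F) J = (\<Sum>k\<in>J. cnj (v $ k) * a k * F J) + ?S" .
  have "conj_pair a v * F J = (\<Sum>k\<in>UNIV. cnj (v $ k) * a k * F J)"
    unfolding conj_pair_def sum_distrib_right by (rule sum.cong) (auto simp: mult_ac)
  also have "\<dots> = (\<Sum>k\<in>J. cnj (v $ k) * a k * F J) + (\<Sum>k\<in>-J. cnj (v $ k) * a k * F J)"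
    using sum.union_disjoint[of J "-J" "\<lambda>k. cnj (v $ k) * a k * F J"] by (simp add: Compl_partition)
  finally have C: "conj_pair a v * F J = (\<Sum>k\<in>J. cnj (v $ k) * a k * F J) + (\<Sum>k\<in>-J. cnj (v $ k) * a k * F J)" .
  have "y - s = (x + y) - (x + s)" for x y s :: complex by simp
  then show ?thesis unfolding A B C .
qed

text \<open>
  Moving the contraction past each factor costs only a sign, and nothing is left to contract in degree 0.
\<close>

lemma contract1_wedge_list_0:
  assumes "\<And>w. w \<in> set ws \<Longrightarrow> conj_pair w v = 0"
  shows "contract1 v (wedge_list ws) = (\<lambda>J. 0)"
  using assms
proof (induction ws)
  case Nil
  then show ?case by (auto simp: contract1_def)
next
  case (Cons w ws)
  then have "contract1 v (wedge_list ws) = (\<lambda>J. 0)" by simp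
  moreover have "conj_pair w v = 0" using Cons.prems by simp
  ultimately have "contract1 v (wedge1 w (wedge_list ws)) J = 0" for J
    unfolding contract1_wedge1 by (simp add: wedge1_def)
  then show ?case by auto
qed

lemma wedge1_zero [simp]: "wedge1 a (\<lambda>J. 0) = (\<lambda>J. 0)" by (auto simp: wedge1_def)
lemma contract1_zero [simp]: "contract1 a (\<lambda>J. 0) = (\<lambda>J. 0)" by (auto simp: contract1_def)
lemma contract_list_zero [simp]: "contract_list vs (\<lambda>J. 0) = (\<lambda>J. 0)" by (induction vs) auto

lemma contract1_scale: "contract1 v (\<lambda>J. c * F J) = (\<lambda>J. c * contract1 v F J)"
  by (auto simp: contract1_def sum_distrib_left mult_ac)
lemma contract1_diff: "contract1 v (\<lambda>J. F J - G J) = (\<lambda>J. contract1 v F J - contract1 v G J)"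
  by (auto simp: contract1_def algebra_simps sum_subtractf)
lemma contract_list_scale: "contract_list vs (\<lambda>J. c * F J) = (\<lambda>J. c * contract_list vs F J)"
  by (induction vs arbitrary: F) (auto simp: contract1_scale)
lemma contract_list_diff: "contract_list vs (\<lambda>J. F J - G J) = (\<lambda>J. contract_list vs F J - contract_list vs G J)"
  by (induction vs arbitrary: F G) (auto simp: contract1_diff)
lemma wedge1_diff: "wedge1 a (\<lambda>J. F J - G J) = (\<lambda>J. wedge1 a F J - wedge1 a G J)"
  by (auto simp: wedge1_def algebra_simps sum_subtractf)

lemma contract_wedge1_Cons:
  "contract_list (v # vs) (wedge1 a F) {} =
     conj_pair a v * contract_list vs F {} - contract_list vs (wedge1 a (contract1 v F)) {}"
proof -
  have "contract1 v (wedge1 a F) = (\<lambda>J. conj_pair a v * F J - wedge1 a (contract1 v F) J)"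
    by (auto simp: contract1_wedge1)
  then show ?thesis by (simp add: contract_list_diff contract_list_scale)
qed

text \<open>
  A frame evaluated on the exterior product of the dual coframe gives 1; the Clifford relation removes one pair at a time.
\<close>

lemma contract_list_dual:
  assumes "list_all2 (\<lambda>v w. conj_pair w v = 1) vs ws"
    and "\<And>i j. i < length vs \<Longrightarrow> j < length ws \<Longrightarrow> i \<noteq> j \<Longrightarrow> conj_pair (ws ! j) (vs ! i) = 0"
  shows "contract_list vs (wedge_list ws) {} = 1"
  using assms
proof (induction rule: list_all2_induct)
  case Nil
  then show ?case by simp
next
  case (Cons v vs w ws)
  have z: "contract1 v (wedge_list ws) = (\<lambda>J. 0)"
  proof (rule contract1_wedge_list_0)
    fix u assume "u \<in> set ws"
    then obtain j where "j < length ws" "u = ws ! j" by (auto simp: in_set_conv_nth)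
    then show "conj_pair u v = 0" using Cons.prems[of 0 "Suc j"] by simp
  qed
  have "contract_list vs (wedge_list ws) {} = 1"
    by (rule Cons.IH) (use Cons.prems[of "Suc _" "Suc _"] in auto)
  then show ?case using Cons.hyps
    by (simp only: wedge_list.simps contract_wedge1_Cons z) simp
qed

text \<open>
  Since \<open>v\<close> contracts \<open>wedge_list ws\<close> to 0, it has to be paired with \<open>a\<close>.
\<close>

lemma contract_wedge1_wedge_list:
  assumes "\<And>w. w \<in> set ws \<Longrightarrow> conj_pair w v = 0"
    and "contract_list vs (wedge_list ws) {} = 1"
  shows "contract_list (v # vs) (wedge1 a (\<lambda>J. c * wedge_list ws J)) {} = c * conj_pair a v"
proof -
  have "contract1 v (wedge_list ws) = (\<lambda>J. 0)" by (rule contract1_wedge_list_0[OF assms(1)])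
  then have "contract1 v (\<lambda>J. c * wedge_list ws J) = (\<lambda>J. 0)"
    by (simp add: contract1_scale[of v c])
  then show ?thesis
    unfolding contract_wedge1_Cons contract_list_scale[of vs c] by (simp add: assms(2))
qed

lemma contract_list_expand:
  "\<exists>c. \<forall>F. contract_list vs F J = (\<Sum>K | card K = card J + length vs. c K * F K)"
proof (induction vs)
  case Nil
  have "contract_list [] F J = (\<Sum>K | card K = card J + length []. (if K = J then 1 else 0) * F K)" for F
    by (simp add: if_distrib[where f="\<lambda>x. x * _"] sum.delta cong: if_cong)
  then show ?case by (intro exI[of _ "\<lambda>K. if K = J then 1 else 0"] allI)
next
  case (Cons v vs)
  then obtain c where c: "\<And>F. contract_list vs F J = (\<Sum>K | card K = card J + length vs. c K * F K)"
    by blast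
  let ?A = "{K::'a set. card K = card J + length vs}"
  let ?B = "{K::'a set. card K = Suc (card J + length vs)}"
  define d where "d L = (\<Sum>K\<in>?A. \<Sum>k\<in>-K. if insert k K = L then c K * koszul_sign k K * cnj (v $ k) else 0)" for L
  have "contract_list (v # vs) F J = (\<Sum>L\<in>?B. d L * F L)" for F
  proof -
    have "contract_list (v # vs) F J = (\<Sum>K\<in>?A. \<Sum>k\<in>-K. c K * koszul_sign k K * cnj (v $ k) * F (insert k K))"
      by (simp add: c contract1_def sum_distrib_left mult_ac)
    also have "\<dots> = (\<Sum>K\<in>?A. \<Sum>k\<in>-K. \<Sum>L\<in>?B. (if insert k K = L then c K * koszul_sign k K * cnj (v $ k) else 0) * F L)"
      by (intro sum.cong refl) (auto simp: if_distrib[where f="\<lambda>x. x * _"] sum.delta' cong: if_cong)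
    also have "\<dots> = (\<Sum>K\<in>?A. \<Sum>L\<in>?B. \<Sum>k\<in>-K. (if insert k K = L then c K * koszul_sign k K * cnj (v $ k) else 0) * F L)"
      by (intro sum.cong refl) (rule sum.swap)
    also have "\<dots> = (\<Sum>L\<in>?B. \<Sum>K\<in>?A. \<Sum>k\<in>-K. (if insert k K = L then c K * koszul_sign k K * cnj (v $ k) else 0) * F L)"
      by (rule sum.swap)
    also have "\<dots> = (\<Sum>L\<in>?B. d L * F L)"
      by (simp add: d_def sum_distrib_right)
    finally show ?thesis .
  qed
  then show ?case by (intro exI[of _ d]) simp
qed

text \<open>
  Evaluated on the frame \<open>vs\<close>, an exterior product with \<open>a\<close> involves \<open>a\<close> only through its pairings with the
  frame. For \<open>a\<close> the $\overline\partial$-gradient of a bump this means that its large derivatives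
  transversal to the frame do not enter.
\<close>

lemma contract_wedge1_bound:
  "\<exists>C\<ge>0. \<forall>a F. cmod (contract_list vs (wedge1 a F) {})
      \<le> C * (\<Sum>v\<leftarrow>vs. cmod (conj_pair a v)) * (\<Sum>J | Suc (card J) = length vs. cmod (F J))"
proof (induction vs)
  case Nil
  show ?case by (auto simp: wedge1_def)
next
  case (Cons v vs)
  then obtain C where C: "C \<ge> 0" and CI: "\<And>a F. cmod (contract_list vs (wedge1 a F) {})
      \<le> C * (\<Sum>v\<leftarrow>vs. cmod (conj_pair a v)) * (\<Sum>J | Suc (card J) = length vs. cmod (F J))" by blast
  obtain c where c: "\<And>F. contract_list vs F {} = (\<Sum>K | card K = card ({}::'a set) + length vs. c K * F K)"
    using contract_list_expand[of vs "{}"] by blast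
  define D where "D = (\<Sum>K\<in>UNIV. cmod (c K))"
  define N where "N = real (card (UNIV :: 'a set set)) * (\<Sum>k\<in>UNIV. cmod (v $ k))"
  have D: "D \<ge> 0" and N: "N \<ge> 0" by (auto simp: D_def N_def sum_nonneg)
  let ?n = "length vs"
  have b1: "cmod (contract_list vs F {}) \<le> D * (\<Sum>J | card J = ?n. cmod (F J))" for F
  proof -
    have "cmod (contract_list vs F {}) \<le> (\<Sum>K | card K = ?n. cmod (c K) * cmod (F K))"
      by (simp add: c norm_mult[symmetric] norm_sum)
    also have "\<dots> \<le> (\<Sum>K | card K = ?n. D * cmod (F K))"
      by (intro sum_mono mult_right_mono) (auto simp: D_def intro!: member_le_sum)
    finally show ?thesis by (simp add: sum_distrib_left)
  qed
  have b2: "(\<Sum>J | Suc (card J) = ?n. cmod (contract1 v F J)) \<le> N * (\<Sum>J | card J = ?n. cmod (F J))" for F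
  proof -
    have "cmod (contract1 v F J) \<le> (\<Sum>k\<in>UNIV. cmod (v $ k)) * (\<Sum>J | card J = ?n. cmod (F J))"
      if J: "Suc (card J) = ?n" for J
    proof -
      have "cmod (contract1 v F J) \<le> (\<Sum>k\<in>-J. cmod (v $ k) * cmod (F (insert k J)))"
        unfolding contract1_def by (rule order_trans[OF norm_sum]) (simp add: norm_mult)
      also have "\<dots> \<le> (\<Sum>k\<in>-J. cmod (v $ k) * (\<Sum>J | card J = ?n. cmod (F J)))"
        using J by (intro sum_mono mult_left_mono member_le_sum) auto
      also have "\<dots> \<le> (\<Sum>k\<in>UNIV. cmod (v $ k) * (\<Sum>J | card J = ?n. cmod (F J)))"
        by (intro sum_mono2) (auto intro!: mult_nonneg_nonneg sum_nonneg)
      finally show ?thesis by (simp add: sum_distrib_right)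
    qed
    then have "(\<Sum>J | Suc (card J) = ?n. cmod (contract1 v F J))
       \<le> real (card {J::'a set. Suc (card J) = ?n}) * ((\<Sum>k\<in>UNIV. cmod (v $ k)) * (\<Sum>J | card J = ?n. cmod (F J)))"
      by (intro sum_bounded_above) simp
    also have "\<dots> \<le> real (card (UNIV :: 'a set set)) * ((\<Sum>k\<in>UNIV. cmod (v $ k)) * (\<Sum>J | card J = ?n. cmod (F J)))"
      by (intro mult_right_mono mult_nonneg_nonneg sum_nonneg of_nat_mono card_mono) simp_all
    finally show ?thesis by (simp only: N_def mult.assoc)
  qed
  have "cmod (contract_list (v # vs) (wedge1 a F) {})
      \<le> (D + C * N) * (\<Sum>v\<leftarrow>v # vs. cmod (conj_pair a v)) * (\<Sum>J | Suc (card J) = length (v # vs). cmod (F J))" for a F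
  proof -
    let ?X = "\<Sum>J | card J = ?n. cmod (F J)"
    let ?s = "\<Sum>v\<leftarrow>vs. cmod (conj_pair a v)"
    have s: "?s \<ge> 0" by (rule sum_list_nonneg) auto
    have X: "?X \<ge> 0" by (rule sum_nonneg) auto
    have "cmod (contract_list (v # vs) (wedge1 a F) {})
       \<le> cmod (conj_pair a v) * cmod (contract_list vs F {}) + cmod (contract_list vs (wedge1 a (contract1 v F)) {})"
      unfolding contract_wedge1_Cons by (rule order_trans[OF norm_triangle_ineq4]) (simp add: norm_mult)
    also have "\<dots> \<le> cmod (conj_pair a v) * (D * ?X) + C * ?s * (N * ?X)"
      by (intro add_mono mult_left_mono b1 order_trans[OF CI] mult_mono b2 order_refl)
         (use C s X N in \<open>auto intro!: mult_nonneg_nonneg sum_nonneg\<close>)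
    also have "\<dots> \<le> (D + C * N) * (cmod (conj_pair a v) + ?s) * ?X"
    proof -
      have "0 \<le> C * N * cmod (conj_pair a v) * ?X + D * ?s * ?X"
        using C D N X s by (intro add_nonneg_nonneg mult_nonneg_nonneg) auto
      then show ?thesis by (simp add: algebra_simps)
    qed
    finally show ?thesis by simp
  qed
  moreover have "D + C * N \<ge> 0" using C D N by simp
  ultimately show ?case by blast
qed

section \<open>Integration by parts and Wirtinger derivatives\<close>

lemma integral_lborel_translate:
  fixes f :: "'a::euclidean_space \<Rightarrow> 'b::{banach,second_countable_topology}"
  assumes [measurable]: "f \<in> borel_measurable borel"
  shows "(LINT x|lborel. f (c + x)) = (LINT x|lborel. f x)"
proof -
  have "(LINT x|lborel. f x) = (LINT x|distr lborel borel ((+) c). f x)"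
    by (simp add: lborel_distr_plus)
  also have "\<dots> = (LINT x|lborel. f (c + x))"
    by (subst integral_distr) auto
  finally show ?thesis by simp
qed

text \<open>
  The difference quotients have integral 0 by translation invariance; they are dominated because the derivative is bounded.
\<close>

lemma integral_directional_derivative_zero:
  fixes g g' :: "'a::euclidean_space \<Rightarrow> complex"
  assumes cont: "continuous_on UNIV g"
    and deriv: "\<And>x. ((\<lambda>h. g (x + h *\<^sub>R v)) has_vector_derivative g' x) (at 0)"
    and bound: "\<And>x. norm (g' x) \<le> M"
    and S: "compact S" "\<And>x. x \<notin> S \<Longrightarrow> g x = 0"
  shows "integrable lborel g'" and "(LINT x|lborel. g' x) = 0"
proof -
  have M: "0 \<le> M" using bound[of undefined] norm_ge_zero order_trans by blast
  have [measurable]: "g \<in> borel_measurable borel"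
    using cont by (rule borel_measurable_continuous_onI)
  have "(\<lambda>x. indicator S x *\<^sub>R g x) = g"
    by (auto simp: fun_eq_iff indicator_def S(2))
  then have ig: "integrable lborel g"
    using borel_integrable_compact[OF S(1) continuous_on_subset[OF cont]] by simp
  define S' where "S' = (\<lambda>(x, t). x - t *\<^sub>R v) ` (S \<times> {0..1})"
  have cS': "compact S'"
    unfolding S'_def case_prod_beta'
    by (intro compact_continuous_image continuous_intros compact_Times S(1) compact_Icc)
  have deriv': "((\<lambda>h. g (x + h *\<^sub>R v)) has_vector_derivative g' (x + t *\<^sub>R v)) (at t within T)" for x t T
  proof -
    have "((\<lambda>h. g ((x + t *\<^sub>R v) + h *\<^sub>R v)) has_derivative (\<lambda>h. h *\<^sub>R g' (x + t *\<^sub>R v))) (at (t - t))"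
      using deriv[of "x + t *\<^sub>R v"] by (simp add: has_vector_derivative_def)
    then have "((\<lambda>s. g ((x + t *\<^sub>R v) + (s - t) *\<^sub>R v)) has_derivative (\<lambda>h. h *\<^sub>R g' (x + t *\<^sub>R v))) (at t)"
      by (rule has_derivative_compose[rotated]) (auto intro!: derivative_eq_intros)
    then have "((\<lambda>s. g (x + s *\<^sub>R v)) has_derivative (\<lambda>h. h *\<^sub>R g' (x + t *\<^sub>R v))) (at t)"
      by (simp add: algebra_simps)
    then show ?thesis by (simp add: has_vector_derivative_def has_derivative_at_withinI)
  qed
  have lip: "norm (g (x + h *\<^sub>R v) - g x) \<le> M * h" if "h > 0" for x h
  proof -
    have "norm (g (x + h *\<^sub>R v) - g (x + 0 *\<^sub>R v)) \<le> M * norm (h - 0)"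
    proof (rule differentiable_bound[where S="{0..h}" and f="\<lambda>h. g (x + h *\<^sub>R v)"])
      fix t
      show "((\<lambda>h. g (x + h *\<^sub>R v)) has_derivative (\<lambda>h. h *\<^sub>R g' (x + t *\<^sub>R v))) (at t within {0..h})"
        using deriv' by (simp add: has_vector_derivative_def)
      show "onorm (\<lambda>h. h *\<^sub>R g' (x + t *\<^sub>R v)) \<le> M"
        by (rule onorm_bound[OF M]) (simp add: mult.commute[of M] mult_left_mono bound)
    qed (use that in auto)
    then show ?thesis using that by simp
  qed
  define h where "h n = 1 / real (Suc n)" for n
  have h: "h n > 0" "h n \<le> 1" for n by (auto simp: h_def)
  have h0: "h \<longlonglongrightarrow> 0" unfolding h_def by (rule LIMSEQ_Suc[OF lim_1_over_n])
  define s where "s n x = (g (h n *\<^sub>R v + x) - g x) /\<^sub>R h n" for n x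
  have [measurable]: "s n \<in> borel_measurable lborel" for n
    unfolding s_def by measurable
  have lim: "(\<lambda>n. s n x) \<longlonglongrightarrow> g' x" for x
  proof -
    have "((\<lambda>t. (g (x + t *\<^sub>R v) - g x) /\<^sub>R t) \<longlongrightarrow> g' x) (at 0)"
    proof (rule LIM_zero_cancel, rule tendsto_norm_zero_cancel)
      have "((\<lambda>t. norm (g (x + t *\<^sub>R v) - g x - t *\<^sub>R g' x) / norm t) \<longlongrightarrow> 0) (at 0)"
        using deriv[of x] by (simp add: has_vector_derivative_def has_derivative_at)
      moreover have eq: "norm (g (x + t *\<^sub>R v) - g x - t *\<^sub>R g' x) / norm t = norm ((g (x + t *\<^sub>R v) - g x) /\<^sub>R t - g' x)"
        if "t \<noteq> 0" for t
      proof -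
        have "norm (g (x + t *\<^sub>R v) - g x - t *\<^sub>R g' x) / norm t
          = norm ((g (x + t *\<^sub>R v) - g x - t *\<^sub>R g' x) /\<^sub>R t)"
          by (simp add: divide_inverse mult.commute)
        also have "(g (x + t *\<^sub>R v) - g x - t *\<^sub>R g' x) /\<^sub>R t = (g (x + t *\<^sub>R v) - g x) /\<^sub>R t - g' x"
          using that by (simp add: scaleR_diff_right)
        finally show ?thesis .
      qed
      have "\<forall>\<^sub>F t in at 0. norm (g (x + t *\<^sub>R v) - g x - t *\<^sub>R g' x) / norm t = norm ((g (x + t *\<^sub>R v) - g x) /\<^sub>R t - g' x)"
        unfolding eventually_at_filter using eq by simp
      ultimately show "((\<lambda>t. norm ((g (x + t *\<^sub>R v) - g x) /\<^sub>R t - g' x)) \<longlongrightarrow> 0) (at 0)"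
        by (rule Lim_transform_eventually)
    qed
    moreover have "filterlim h (at 0) sequentially"
      using h0 h by (auto simp: filterlim_at eventually_sequentially less_imp_neq[symmetric] intro!: exI[of _ 0])
    ultimately show ?thesis
      unfolding s_def by (auto dest: filterlim_compose simp: add.commute)
  qed
  have bs: "norm (s n x) \<le> indicator S' x *\<^sub>R M" for n x
  proof (cases "x \<in> S'")
    case True
    have "norm (s n x) = norm (g (x + h n *\<^sub>R v) - g x) / h n"
      using h[of n] by (simp add: s_def add.commute divide_inverse mult.commute)
    also have "\<dots> \<le> M" using lip[OF h(1), of x n] h[of n] by (simp add: pos_divide_le_eq)
    finally show ?thesis using True by simp
  next
    case False
    have "x \<notin> S"
    proof
      assume "x \<in> S"
      then have "x - 0 *\<^sub>R v \<in> S'" unfolding S'_def by (intro image_eqI[of _ _ "(x, 0)"]) auto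
      then show False using False by simp
    qed
    moreover have "h n *\<^sub>R v + x \<notin> S"
    proof
      assume "h n *\<^sub>R v + x \<in> S"
      then have "(h n *\<^sub>R v + x) - h n *\<^sub>R v \<in> S'" unfolding S'_def
        by (intro image_eqI[of _ _ "(h n *\<^sub>R v + x, h n)"]) (use h[of n] in auto)
      then show False using False by simp
    qed
    ultimately show ?thesis using False by (simp add: s_def S(2))
  qed
  have [measurable]: "g' \<in> borel_measurable lborel"
    by (rule borel_measurable_LIMSEQ_metric[OF _ lim]) measurable
  have iw: "integrable lborel (\<lambda>x. indicator S' x *\<^sub>R M)"
    by (rule borel_integrable_compact[OF cS']) (rule continuous_on_const)
  have int0: "(LINT x|lborel. s n x) = 0" for n
  proof -
    have "integrable lborel (\<lambda>x. g (h n *\<^sub>R v + x))"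
    proof -
      have "integrable (distr lborel borel ((+) (h n *\<^sub>R v))) g" using ig by (simp add: lborel_distr_plus)
      then show ?thesis by (subst (asm) integrable_distr_eq) auto
    qed
    then show ?thesis unfolding s_def using ig by (simp add: integral_lborel_translate)
  qed
  have dc: "integrable lborel g'"
    by (rule integrable_dominated_convergence[OF _ _ iw, where s=s]) (use lim bs in auto)
  have dc2: "(\<lambda>n. LINT x|lborel. s n x) \<longlonglongrightarrow> (LINT x|lborel. g' x)"
    by (rule integral_dominated_convergence[OF _ _ iw]) (use lim bs in auto)
  show "integrable lborel g'" by (fact dc)
  show "(LINT x|lborel. g' x) = 0"
    using dc2 unfolding int0 by (simp add: LIMSEQ_const_iff)
qed

lemma test_functionE:
  assumes "test_function \<Omega> \<eta>"
  obtains S where "compact S" "S \<subseteq> \<Omega>" "\<And>z. z \<notin> S \<Longrightarrow> \<eta> z = 0"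
    "\<And>x. (\<eta> has_derivative frechet_derivative \<eta> (at x)) (at x)"
    "\<And>v. continuous_on UNIV (\<lambda>x. frechet_derivative \<eta> (at x) v)"
proof -
  have C: "C_k 1 \<eta>" using assms by (simp add: test_function_def)
  then have "\<eta> differentiable at x" for x by (simp add: differentiable_on_def)
  then have "(\<eta> has_derivative frechet_derivative \<eta> (at x)) (at x)" for x
    by (simp add: frechet_derivative_works)
  moreover have "continuous_on UNIV (\<lambda>x. frechet_derivative \<eta> (at x) v)" for v using C by simp
  ultimately show ?thesis using that assms unfolding test_function_def by blast
qed

lemma integration_by_parts_compact:
  fixes F \<eta> :: "'a::euclidean_space \<Rightarrow> complex"
  assumes U: "open U" and S: "compact S" "S \<subseteq> U"
    and F: "\<And>x. x \<in> U \<Longrightarrow> (F has_derivative F' x) (at x)"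
    and bF: "\<And>x. x \<in> S \<Longrightarrow> norm (F' x v) \<le> B"
    and eta: "\<And>x. (\<eta> has_derivative \<eta>' x) (at x)" "continuous_on UNIV (\<lambda>x. \<eta>' x v)"
       "\<And>x. x \<notin> S \<Longrightarrow> \<eta> x = 0"
  shows "integrable lborel (\<lambda>x. F x * \<eta>' x v)" and "integrable lborel (\<lambda>x. F' x v * \<eta> x)"
    and "(LINT x|lborel. F x * \<eta>' x v) = - (LINT x|lborel. F' x v * \<eta> x)"
proof -
  have cF: "continuous_on U F"
    using F by (meson continuous_at_imp_continuous_on has_derivative_continuous)
  have ceta: "continuous_on UNIV \<eta>"
    using eta(1) by (meson continuous_at_imp_continuous_on has_derivative_continuous)
  have z: "\<forall>\<^sub>F y in nhds x. \<eta> y = 0" if "x \<notin> S" for x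
    using eventually_nhds_in_open[OF open_Compl[OF compact_imp_closed[OF S(1)]], of x] that
    by (auto elim!: eventually_mono simp: eta(3))
  have eta'0: "\<eta>' x v = 0" if "x \<notin> S" for x
  proof -
    have "(\<eta> has_derivative (\<lambda>_. 0)) (at x)"
      using has_derivative_transform_eventually[OF has_derivative_const[of 0 "at x"], of \<eta>] z[OF that] eta(3)[OF that]
      by (auto simp: eventually_nhds_conv_at elim: eventually_mono)
    then show ?thesis using has_derivative_unique[OF eta(1)[of x]] by metis
  qed
  have eq: "(\<lambda>x. indicator S x *\<^sub>R (F x * \<eta>' x v)) = (\<lambda>x. F x * \<eta>' x v)"
    by (auto simp: fun_eq_iff indicator_def eta'0)
  show i1: "integrable lborel (\<lambda>x. F x * \<eta>' x v)"
    unfolding eq[symmetric]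
    by (intro borel_integrable_compact S(1) continuous_intros continuous_on_subset[OF cF S(2)] continuous_on_subset[OF eta(2)]) simp
  define g where "g x = F x * \<eta> x" for x
  define g' where "g' x = F x * \<eta>' x v + F' x v * \<eta> x" for x
  have dg: "\<exists>L. (g has_derivative L) (at x) \<and> L v = g' x" for x
  proof (cases "x \<in> U")
    case True
    from has_derivative_mult[OF F[OF this] eta(1)] show ?thesis
      unfolding g_def[symmetric] g'_def by (intro exI conjI) auto
  next
    case False
    then have "x \<notin> S" using S by auto
    have "(g has_derivative (\<lambda>_. 0)) (at x)"
    proof (rule has_derivative_transform_eventually[OF has_derivative_const[of 0]])
      show "\<forall>\<^sub>F y in at x. 0 = g y"
        using z[OF \<open>x \<notin> S\<close>] unfolding eventually_nhds_conv_at
        by (auto simp: g_def elim!: eventually_mono)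
    qed (use eta(3)[OF \<open>x \<notin> S\<close>] in \<open>simp_all add: g_def\<close>)
    moreover have "g' x = 0" using \<open>x \<notin> S\<close> eta(3) eta'0 by (simp add: g'_def)
    ultimately show ?thesis by (intro exI[of _ "\<lambda>_. 0"]) simp
  qed
  have cg: "continuous_on UNIV g"
    using dg by (meson continuous_at_imp_continuous_on has_derivative_continuous)
  have dg': "((\<lambda>h. g (x + h *\<^sub>R v)) has_vector_derivative g' x) (at 0)" for x
  proof -
    obtain L where L: "(g has_derivative L) (at x)" "L v = g' x" using dg by blast
    have "((\<lambda>h::real. x + h *\<^sub>R v) has_derivative (\<lambda>h. h *\<^sub>R v)) (at 0)" by (auto intro!: derivative_eq_intros)
    moreover have "(g has_derivative L) (at (x + 0 *\<^sub>R v))" using L by simp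
    ultimately have "((\<lambda>h. g (x + h *\<^sub>R v)) has_derivative (\<lambda>h. L (h *\<^sub>R v))) (at 0)"
      by (rule has_derivative_compose)
    then show ?thesis
      using L(2) linear_scale[OF has_derivative_linear[OF L(1)]] by (simp add: has_vector_derivative_def)
  qed
  obtain M1 where M1: "\<And>x. x \<in> S \<Longrightarrow> norm (F x * \<eta>' x v) \<le> M1"
  proof -
    have "compact ((\<lambda>x. F x * \<eta>' x v) ` S)"
      by (intro compact_continuous_image S(1) continuous_intros continuous_on_subset[OF cF S(2)] continuous_on_subset[OF eta(2)]) simp
    from compact_imp_bounded[OF this] show ?thesis using that by (auto simp: bounded_iff)
  qed
  obtain M2 where M2: "\<And>x. x \<in> S \<Longrightarrow> norm (\<eta> x) \<le> M2"
  proof -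
    have "compact (\<eta> ` S)"
      by (intro compact_continuous_image S(1) continuous_on_subset[OF ceta]) simp
    from compact_imp_bounded[OF this] show ?thesis using that by (auto simp: bounded_iff)
  qed
  have bg: "norm (g' x) \<le> \<bar>M1\<bar> + \<bar>B\<bar> * \<bar>M2\<bar>" for x
  proof (cases "x \<in> S")
    case True
    have "norm (g' x) \<le> norm (F x * \<eta>' x v) + norm (F' x v) * norm (\<eta> x)"
      unfolding g'_def by (rule order_trans[OF norm_triangle_ineq]) (simp add: norm_mult)
    also have "\<dots> \<le> \<bar>M1\<bar> + \<bar>B\<bar> * \<bar>M2\<bar>"
      by (intro add_mono mult_mono order_trans[OF M1[OF True]] order_trans[OF M2[OF True]] order_trans[OF bF[OF True]]) auto
    finally show ?thesis .
  next
    case False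
    then show ?thesis using eta(3) eta'0 by (simp add: g'_def)
  qed
  have gS: "g x = 0" if "x \<notin> S" for x using eta(3)[OF that] by (simp add: g_def)
  note * = integral_directional_derivative_zero[OF cg dg' bg S(1) gS]
  have "integrable lborel (\<lambda>x. g' x - F x * \<eta>' x v)" using *(1) i1 by (rule Bochner_Integration.integrable_diff)
  then show i2: "integrable lborel (\<lambda>x. F' x v * \<eta> x)" by (simp add: g'_def)
  have "(LINT x|lborel. g' x) = (LINT x|lborel. F x * \<eta>' x v) + (LINT x|lborel. F' x v * \<eta> x)"
    unfolding g'_def using i1 i2 by simp
  then show "(LINT x|lborel. F x * \<eta>' x v) = - (LINT x|lborel. F' x v * \<eta> x)"
    using *(2) by (simp add: eq_neg_iff_add_eq_0)
qed

text \<open>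
  The complex antilinear part of the real linear map \<open>D\<close>; for a derivative, the $\overline\partial$-derivative
  in the direction \<open>v\<close>.
\<close>

definition dbar_dir :: "(complex ^ 'n \<Rightarrow> complex) \<Rightarrow> complex ^ 'n \<Rightarrow> complex" where
  "dbar_dir D v = (D v + \<i> * D (\<i> *s v)) / 2"

lemma dbar_dir_eq_sum:
  fixes D :: "complex ^ 'n \<Rightarrow> complex"
  assumes "linear D"
  shows "dbar_dir D v = (\<Sum>k\<in>UNIV. dbar_dir D (axis k 1) * cnj (v $ k))"
proof -
  interpret linear D by fact
  have ax: "D (axis k c) = of_real (Re c) * D (axis k 1) + of_real (Im c) * D (axis k \<i>)" for k c
  proof -
    have "axis k c = Re c *\<^sub>R axis k 1 + Im c *\<^sub>R (axis k \<i> :: complex ^ 'n)"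
      by (simp add: vec_eq_iff axis_def complex_eq_iff)
    then show ?thesis by (simp only: add scale) (simp add: scaleR_conv_of_real)
  qed
  have v: "v = (\<Sum>k\<in>UNIV. axis k (v $ k))" for v :: "complex ^ 'n"
    by (simp add: vec_eq_iff axis_def)
  have D: "D v = (\<Sum>k\<in>UNIV. of_real (Re (v $ k)) * D (axis k 1) + of_real (Im (v $ k)) * D (axis k \<i>))" for v
  proof -
    have "D v = D (\<Sum>k\<in>UNIV. axis k (v $ k))" using v[of v] by simp
    also have "\<dots> = (\<Sum>k\<in>UNIV. D (axis k (v $ k)))" by (rule sum)
    also have "\<dots> = (\<Sum>k\<in>UNIV. of_real (Re (v $ k)) * D (axis k 1) + of_real (Im (v $ k)) * D (axis k \<i>))"
      by (rule sum.cong[OF refl ax])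
    finally show ?thesis .
  qed
  have i: "\<i> *s axis k 1 = (axis k \<i> :: complex ^ 'n)" for k
    by (simp add: vec_eq_iff axis_def)
  have t: "((of_real (Re z) * X + of_real (Im z) * Y) + \<i> * (of_real (Re (\<i> * z)) * X + of_real (Im (\<i> * z)) * Y)) / 2
      = (X + \<i> * Y) / 2 * cnj z" for X Y z :: complex
  proof -
    have cz: "cnj z = of_real (Re z) - \<i> * of_real (Im z)" by (simp add: complex_eq_iff)
    show ?thesis unfolding cz by (simp add: algebra_simps)
  qed
  have "dbar_dir D v = (\<Sum>k\<in>UNIV. ((of_real (Re (v $ k)) * D (axis k 1) + of_real (Im (v $ k)) * D (axis k \<i>))
      + \<i> * (of_real (Re (\<i> * v $ k)) * D (axis k 1) + of_real (Im (\<i> * v $ k)) * D (axis k \<i>))) / 2)"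
    unfolding dbar_dir_def D[of v] D[of "\<i> *s v"]
    by (simp only: sum_distrib_left sum.distrib[symmetric] sum_divide_distrib vector_smult_component)
  then show ?thesis unfolding t dbar_dir_def i .
qed

lemma dbar_partial_eq:
  fixes k :: "'n::finite"
  shows "dbar_partial k \<eta> z = dbar_dir (frechet_derivative \<eta> (at z)) (axis k 1)"
proof -
  have "\<i> *s axis k 1 = (axis k \<i> :: complex ^ 'n)" for k :: 'n
    by (simp add: vec_eq_iff axis_def)
  then show ?thesis by (simp add: dbar_partial_def dbar_dir_def)
qed

lemma dbar_dir_complex_linear:
  assumes "\<And>c v. D (c *s v) = c * D v"
  shows "dbar_dir D v = 0"
  by (simp add: dbar_dir_def assms mult.assoc[symmetric])

lemma dbar_integration_by_parts:
  fixes F \<eta> :: "complex ^ 'n \<Rightarrow> complex"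
  assumes U: "open U" and S: "compact S" "S \<subseteq> U"
    and F: "\<And>x. x \<in> U \<Longrightarrow> (F has_derivative F' x) (at x)"
    and bF: "\<And>v. \<exists>B. \<forall>x\<in>S. norm (F' x v) \<le> B"
    and eta: "\<And>x. (\<eta> has_derivative \<eta>' x) (at x)" "\<And>v. continuous_on UNIV (\<lambda>x. \<eta>' x v)"
       "\<And>x. x \<notin> S \<Longrightarrow> \<eta> x = 0"
  shows "integrable lborel (\<lambda>x. F x * dbar_dir (\<eta>' x) v)"
    and "integrable lborel (\<lambda>x. dbar_dir (F' x) v * \<eta> x)"
    and "(LINT x|lborel. F x * dbar_dir (\<eta>' x) v) = - (LINT x|lborel. dbar_dir (F' x) v * \<eta> x)"
proof -
  obtain B1 B2 where B: "\<And>x. x \<in> S \<Longrightarrow> norm (F' x v) \<le> B1" "\<And>x. x \<in> S \<Longrightarrow> norm (F' x (\<i> *s v)) \<le> B2"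
    using bF by meson
  note p1 = integration_by_parts_compact[OF U S F B(1) eta]
  note p2 = integration_by_parts_compact[OF U S F B(2) eta]
  have e1: "F x * dbar_dir (\<eta>' x) v = (F x * \<eta>' x v + \<i> * (F x * \<eta>' x (\<i> *s v))) / 2" for x
    by (simp add: dbar_dir_def algebra_simps)
  have e2: "dbar_dir (F' x) v * \<eta> x = (F' x v * \<eta> x + \<i> * (F' x (\<i> *s v) * \<eta> x)) / 2" for x
    by (simp add: dbar_dir_def algebra_simps)
  show "integrable lborel (\<lambda>x. F x * dbar_dir (\<eta>' x) v)"
    unfolding e1 using p1(1) p2(1) by simp
  show "integrable lborel (\<lambda>x. dbar_dir (F' x) v * \<eta> x)"
    unfolding e2 using p1(2) p2(2) by simp
  show "(LINT x|lborel. F x * dbar_dir (\<eta>' x) v) = - (LINT x|lborel. dbar_dir (F' x) v * \<eta> x)"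
  proof -
    have I1: "(LINT x|lborel. F x * dbar_dir (\<eta>' x) v)
       = ((LINT x|lborel. F x * \<eta>' x v) + \<i> * (LINT x|lborel. F x * \<eta>' x (\<i> *s v))) / 2"
      unfolding e1 using p1(1) p2(1) by (simp del: add_divide_eq_if_simps)
    have I2: "(LINT x|lborel. dbar_dir (F' x) v * \<eta> x)
       = ((LINT x|lborel. F' x v * \<eta> x) + \<i> * (LINT x|lborel. F' x (\<i> *s v) * \<eta> x)) / 2"
      unfolding e2 using p1(2) p2(2) by (simp del: add_divide_eq_if_simps)
    have "X = - Y" if "X = (p + \<i> * q) / 2" "Y = (a + \<i> * b) / 2" "p = - a" "q = - b" for X Y p q a b :: complex
    proof -
      have "X * 2 = - (Y * 2)" using that by simp
      then have "X * 2 = (- Y) * 2" by simp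
      then show ?thesis by (simp only: mult_cancel_right) simp
    qed
    from this[OF I1 I2 p1(3) p2(3)] show ?thesis .
  qed
qed

text \<open>
  Cauchy's inequality on discs in the direction \<open>v\<close>, whose radius is bounded below on a compact set.
\<close>

lemma holomorphic_bounded_derivative:
  fixes f :: "complex ^ 'n \<Rightarrow> complex"
  assumes U: "open U" and S: "compact S" "S \<subseteq> U"
    and f: "\<And>x. x \<in> U \<Longrightarrow> (f has_derivative f' x) (at x)"
    and lin: "\<And>x c v. x \<in> U \<Longrightarrow> f' x (c *s v) = c * f' x v"
    and bf: "bounded (f ` U)"
  shows "\<exists>B. \<forall>x\<in>S. norm (f' x v) \<le> B"
proof -
  have hol: "holomorphic_fun_on f U" using f lin unfolding holomorphic_fun_on_def by blast
  obtain B where B: "\<And>x. x \<in> U \<Longrightarrow> norm (f x) \<le> B" using bf unfolding bounded_iff by auto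
  obtain d where d: "d > 0" "\<And>x. x \<in> S \<Longrightarrow> ball x d \<subseteq> U"
    by (rule compact_subset_open_imp_ball_epsilon_subset[OF S(1) U S(2)]) auto
  define m where "m = norm v + 1"
  have m: "m > 0" "norm v \<le> m" using norm_ge_zero[of v] unfolding m_def by linarith+
  define r where "r = d / (2 * m)"
  have r: "r > 0" using d m by (simp add: r_def)
  have "r * norm v \<le> r * m" using r m by (intro mult_left_mono) auto
  also have "r * m = d / 2" using m by (simp add: r_def)
  finally have rv: "r * norm v < d" using d by simp
  have "norm (f' x v) \<le> fact 1 * B / r ^ 1" if x: "x \<in> S" for x
  proof -
    have sub: "x + \<zeta> *s v \<in> U" if "\<zeta> \<in> cball 0 r" for \<zeta>
    proof -
      have "norm (\<zeta> *s v) \<le> r * norm v" using that by (simp add: norm_vscale mult_right_mono)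
      then show ?thesis using d(2)[OF x] rv by (auto simp: dist_norm)
    qed
    have "norm ((deriv ^^ 1) (\<lambda>\<zeta>. f (x + \<zeta> *s v)) 0) \<le> fact 1 * B / r ^ 1"
    proof (rule Cauchy_inequality)
      show "(\<lambda>\<zeta>. f (x + \<zeta> *s v)) holomorphic_on ball 0 r"
        by (rule holomorphic_fun_on_line[OF hol]) (use sub in auto)
      show "continuous_on (cball 0 r) (\<lambda>\<zeta>. f (x + \<zeta> *s v))"
        by (intro holomorphic_on_imp_continuous_on holomorphic_fun_on_line[OF hol] sub)
      show "norm (f (x + \<zeta> *s v)) \<le> B" if "norm (0 - \<zeta>) = r" for \<zeta>
        using that by (intro B sub) simp
    qed (fact r)
    moreover have "((\<lambda>\<zeta>. f (x + \<zeta> *s v)) has_field_derivative f' x v) (at 0)"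
    proof -
      have xU: "x \<in> U" using x S by auto
      note has_derivative_line[of x v 0]
      moreover have "(f has_derivative f' x) (at (x + 0 *s v))" using f[OF xU] by simp
      ultimately have "((\<lambda>\<zeta>. f (x + \<zeta> *s v)) has_derivative (\<lambda>h. f' x (h *s v))) (at 0)"
        by (rule has_derivative_compose)
      moreover have "(\<lambda>h. f' x (h *s v)) = (*) (f' x v)" by (simp add: fun_eq_iff lin[OF xU])
      ultimately show ?thesis by (simp add: has_field_derivative_def)
    qed
    ultimately show ?thesis by (simp add: DERIV_imp_deriv)
  qed
  then show ?thesis by blast
qed

lemma integral_lebesgue_on_eq_lborel:
  fixes G :: "'a::euclidean_space \<Rightarrow> 'b::euclidean_space"
  assumes "open \<Omega>" "G \<in> borel_measurable borel" "\<And>z. z \<notin> \<Omega> \<Longrightarrow> G z = 0"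
  shows "(LINT z|lebesgue_on \<Omega>. G z) = (LINT z|lborel. G z)"
    and "integrable (lebesgue_on \<Omega>) G \<longleftrightarrow> integrable lborel G"
proof -
  have eq: "(\<lambda>z. if z \<in> \<Omega> then G z else 0) = G" using assms(3) by auto
  have O: "\<Omega> \<in> sets lebesgue" using assms(1) by auto
  show "(LINT z|lebesgue_on \<Omega>. G z) = (LINT z|lborel. G z)"
    using Lebesgue_Measure.integral_restrict_UNIV[OF O, of G] assms(2) unfolding eq by (simp add: integral_completion)
  show "integrable (lebesgue_on \<Omega>) G \<longleftrightarrow> integrable lborel G"
    using Lebesgue_Measure.integrable_restrict_UNIV[OF O, of G] assms(2) unfolding eq by (simp add: integrable_completion)
qed

section \<open>The Bergman projection\<close>

definition sqint :: "'a measure \<Rightarrow> ('a \<Rightarrow> complex) \<Rightarrow> bool" where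
  "sqint M f \<longleftrightarrow> f \<in> borel_measurable M \<and> integrable M (\<lambda>x. (cmod (f x))\<^sup>2)"

lemma sqint_measurable: "sqint M f \<Longrightarrow> f \<in> borel_measurable M"
  and sqint_integrable: "sqint M f \<Longrightarrow> integrable M (\<lambda>x. (cmod (f x))\<^sup>2)"
  by (auto simp: sqint_def)

lemma cmod_diff_sq_le: "(cmod (x - y))\<^sup>2 \<le> 2 * (cmod x)\<^sup>2 + 2 * (cmod y)\<^sup>2"
proof -
  have "(cmod (x - y))\<^sup>2 \<le> (cmod x + cmod y)\<^sup>2" by (intro power_mono norm_triangle_ineq4) simp
  also have "\<dots> \<le> 2 * (cmod x)\<^sup>2 + 2 * (cmod y)\<^sup>2"
    using sum_squares_ge_zero[of "cmod x - cmod y" 0] by (simp add: power2_eq_square algebra_simps)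
  finally show ?thesis .
qed

lemma sqint_diff:
  assumes f: "sqint M f" and g: "sqint M g"
  shows "sqint M (\<lambda>x. f x - g x)"
proof -
  note [measurable] = sqint_measurable[OF f] sqint_measurable[OF g]
  have "integrable M (\<lambda>x. 2 * (cmod (f x))\<^sup>2 + 2 * (cmod (g x))\<^sup>2)"
    using f g by (auto simp: sqint_def)
  then have "integrable M (\<lambda>x. (cmod (f x - g x))\<^sup>2)"
    by (rule Bochner_Integration.integrable_bound) (use cmod_diff_sq_le in \<open>auto intro!: AE_I2\<close>)
  then show ?thesis by (simp add: sqint_def)
qed

lemma sqint_cmult:
  assumes f: "sqint M f"
  shows "sqint M (\<lambda>x. c * f x)"
  using f by (auto simp: sqint_def norm_mult power_mult_distrib)

lemma sqint_zero: "sqint M (\<lambda>x. 0)" by (simp add: sqint_def)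

lemma sqint_mult_bounded:
  assumes f: "sqint M f" and [measurable]: "b \<in> borel_measurable M" and "\<And>x. x \<in> space M \<Longrightarrow> cmod (b x) \<le> B"
  shows "sqint M (\<lambda>x. b x * f x)"
proof -
  note [measurable] = sqint_measurable[OF f]
  have "integrable M (\<lambda>x. B\<^sup>2 * (cmod (f x))\<^sup>2)" using f by (auto simp: sqint_def)
  then have "integrable M (\<lambda>x. (cmod (b x * f x))\<^sup>2)"
    by (rule Bochner_Integration.integrable_bound)
       (auto intro!: AE_I2 mult_right_mono power_mono assms(3) simp: norm_mult power_mult_distrib)
  then show ?thesis by (simp add: sqint_def)
qed

lemma sqint_mult_integrable:
  assumes f: "sqint M f" and g: "sqint M g"
  shows "integrable M (\<lambda>x. f x * cnj (g x))"
proof -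
  have "integrable M (\<lambda>x. (cmod (f x))\<^sup>2 + (cmod (g x))\<^sup>2)"
    using f g by (auto simp: sqint_def)
  then show ?thesis
  proof (rule Bochner_Integration.integrable_bound)
    have "cmod (f x) * cmod (g x) \<le> (cmod (f x))\<^sup>2 + (cmod (g x))\<^sup>2" for x
      using sum_squares_bound[of "cmod (f x)" "cmod (g x)"] mult_nonneg_nonneg[OF norm_ge_zero[of "f x"] norm_ge_zero[of "g x"]] by linarith
    then show "AE x in M. norm (f x * cnj (g x)) \<le> norm ((cmod (f x))\<^sup>2 + (cmod (g x))\<^sup>2)"
      by (auto intro!: AE_I2 simp: norm_mult)
    show "(\<lambda>x. f x * cnj (g x)) \<in> borel_measurable M"
    proof -
      have "cnj \<in> borel_measurable borel" by (intro borel_measurable_continuous_onI continuous_intros)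
      from measurable_compose[OF sqint_measurable[OF g] this] show ?thesis
        by (rule borel_measurable_times[OF sqint_measurable[OF f]])
    qed
  qed
qed

lemma (in finite_measure) sqint_imp_integrable:
  assumes "sqint M f" shows "integrable M f"
  using sqint_mult_integrable[OF assms, of "\<lambda>_. 1"] by (simp add: sqint_def)

lemma (in finite_measure) integral_cmod_le:
  assumes f: "sqint M f" and d: "\<delta> > 0"
  shows "(LINT x|M. cmod (f x)) \<le> \<delta> * measure M (space M) + (LINT x|M. (cmod (f x))\<^sup>2) / \<delta>"
proof -
  have le: "t \<le> \<delta> + t\<^sup>2 / \<delta>" if "t \<ge> 0" for t :: real
  proof (cases "t \<le> \<delta>")
    case True
    then show ?thesis using d by (simp add: add_increasing2)
  next
    case False
    then have "t * \<delta> \<le> t * t" using that by (intro mult_left_mono) auto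
    then have "t \<le> t\<^sup>2 / \<delta>" using d by (simp add: pos_le_divide_eq power2_eq_square)
    then show ?thesis using d by simp
  qed
  have "(LINT x|M. cmod (f x)) \<le> (LINT x|M. \<delta> + (cmod (f x))\<^sup>2 / \<delta>)"
    using f sqint_imp_integrable[OF f] by (intro integral_mono) (auto simp: sqint_def le)
  also have "\<dots> = \<delta> * measure M (space M) + (LINT x|M. (cmod (f x))\<^sup>2) / \<delta>"
    using f by (subst Bochner_Integration.integral_add) (auto simp: sqint_def)
  finally show ?thesis .
qed

text \<open>
  The Riesz--Fischer theorem on a finite measure space: a Cauchy sequence in $L^2$ is one in $L^1$, so a
  subsequence converges almost everywhere, and Fatou's lemma turns this into convergence in $L^2$.
\<close>

lemma (in finite_measure) sqint_complete:
  assumes u: "\<And>n. sqint M (u n)"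
    and C: "\<And>e::real. e > 0 \<Longrightarrow> \<exists>N. \<forall>i\<ge>N. \<forall>j\<ge>N. (LINT x|M. (cmod (u i x - u j x))\<^sup>2) < e"
  shows "\<exists>g. sqint M g \<and> (\<lambda>n. LINT x|M. (cmod (u n x - g x))\<^sup>2) \<longlonglongrightarrow> 0"
proof -
  let ?m = "measure M (space M)"
  note [measurable] = sqint_measurable[OF u]
  have L1: "\<exists>N. \<forall>i\<ge>N. \<forall>j\<ge>N. (LINT x|M. norm (u i x - u j x)) < e" if e: "e > 0" for e :: real
  proof -
    define \<delta> where "\<delta> = e / (2 * (?m + 1))"
    have d: "\<delta> > 0" using e by (simp add: \<delta>_def add_nonneg_pos)
    have "\<delta> * ?m \<le> \<delta> * (?m + 1)" using d by simp
    also have "\<delta> * (?m + 1) = e / 2"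
    proof -
      have "?m + 1 \<noteq> 0" using measure_nonneg[of M "space M"] by linarith
      moreover have "c \<noteq> 0 \<Longrightarrow> e / (2 * c) * c = e / 2" for c by simp
      ultimately show ?thesis unfolding \<delta>_def by blast
    qed
    finally have dm: "\<delta> * ?m \<le> e / 2" .
    obtain N where N: "\<forall>i\<ge>N. \<forall>j\<ge>N. (LINT x|M. (cmod (u i x - u j x))\<^sup>2) < \<delta> * (e / 2)"
      using C[of "\<delta> * (e / 2)"] d e by auto
    have "(LINT x|M. norm (u i x - u j x)) < e" if "i \<ge> N" "j \<ge> N" for i j
    proof -
      have "(LINT x|M. (cmod (u i x - u j x))\<^sup>2) / \<delta> < e / 2"
        using N that d by (simp add: pos_divide_less_eq mult.commute)
      then show ?thesis using integral_cmod_le[OF sqint_diff[OF u u] d, of i j] dm by linarith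
    qed
    then show ?thesis by blast
  qed
  obtain r where r: "strict_mono r" "AE x in M. Cauchy (\<lambda>i. u (r i) x)"
    using cauchy_L1_AE_cauchy_subseq[OF sqint_imp_integrable[OF u] L1] by blast
  define g where "g x = lim (\<lambda>i. u (r i) x)" for x
  have [measurable]: "g \<in> borel_measurable M" unfolding g_def by measurable
  have lim: "AE x in M. (\<lambda>i. u (r i) x) \<longlonglongrightarrow> g x"
    using r(2) by eventually_elim (simp add: g_def Cauchy_convergent_iff convergent_LIMSEQ_iff)
  have fat: "(\<integral>\<^sup>+x. (cmod (u i x - g x))\<^sup>2 \<partial>M) \<le> ennreal e"
    if N: "\<forall>i\<ge>N. \<forall>j\<ge>N. (LINT x|M. (cmod (u i x - u j x))\<^sup>2) < e" and i: "i \<ge> N" for i e N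
  proof -
    have "(\<integral>\<^sup>+x. (cmod (u i x - g x))\<^sup>2 \<partial>M) = (\<integral>\<^sup>+x. liminf (\<lambda>k. ennreal ((cmod (u i x - u (r k) x))\<^sup>2)) \<partial>M)"
    proof (rule nn_integral_cong_AE, use lim in eventually_elim)
      case (elim x)
      then have "(\<lambda>k. ennreal ((cmod (u i x - u (r k) x))\<^sup>2)) \<longlonglongrightarrow> ennreal ((cmod (u i x - g x))\<^sup>2)"
        by (intro tendsto_intros)
      from lim_imp_Liminf[OF trivial_limit_sequentially this] show ?case by (rule sym)
    qed
    also have "\<dots> \<le> liminf (\<lambda>k. \<integral>\<^sup>+x. ennreal ((cmod (u i x - u (r k) x))\<^sup>2) \<partial>M)"
      by (rule nn_integral_liminf) measurable
    also have "\<dots> \<le> ennreal e"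
    proof (rule Liminf_le)
      show "\<forall>\<^sub>F k in sequentially. (\<integral>\<^sup>+x. ennreal ((cmod (u i x - u (r k) x))\<^sup>2) \<partial>M) \<le> ennreal e"
        using eventually_ge_at_top[of N]
      proof eventually_elim
        case (elim k)
        then have "r k \<ge> N" using seq_suble[OF r(1), of k] by simp
        then have "(LINT x|M. (cmod (u i x - u (r k) x))\<^sup>2) < e" using N i by blast
        moreover have "integrable M (\<lambda>x. (cmod (u i x - u (r k) x))\<^sup>2)"
          using sqint_diff[OF u u] by (simp add: sqint_def)
        ultimately show ?case by (subst nn_integral_eq_integral) (auto intro: ennreal_leI)
      qed
    qed simp
    finally show ?thesis .
  qed
  have int: "integrable M (\<lambda>x. (cmod (u i x - g x))\<^sup>2) \<and> (LINT x|M. (cmod (u i x - g x))\<^sup>2) \<le> e"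
    if "\<forall>i\<ge>N. \<forall>j\<ge>N. (LINT x|M. (cmod (u i x - u j x))\<^sup>2) < e" "i \<ge> N" "e > 0" for i e N
  proof -
    have "(\<integral>\<^sup>+x. norm ((cmod (u i x - g x))\<^sup>2) \<partial>M) < \<infinity>"
      using fat[OF that(1,2)] by (auto simp: ennreal_less_top top.not_eq_extremum intro: le_less_trans)
    then have I: "integrable M (\<lambda>x. (cmod (u i x - g x))\<^sup>2)" by (intro integrableI_bounded) measurable
    then have "ennreal (LINT x|M. (cmod (u i x - g x))\<^sup>2) \<le> ennreal e"
      using fat[OF that(1,2)] by (subst (asm) nn_integral_eq_integral) auto
    with I that(3) show ?thesis by simp
  qed
  obtain N where N: "\<forall>i\<ge>N. \<forall>j\<ge>N. (LINT x|M. (cmod (u i x - u j x))\<^sup>2) < (1::real)"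
    using C[of 1] by auto
  have "sqint M (\<lambda>x. u N x - g x)" using int[OF N] by (simp add: sqint_def)
  from sqint_diff[OF u[of N] this] have "sqint M g" by simp
  moreover have "(\<lambda>n. LINT x|M. (cmod (u n x - g x))\<^sup>2) \<longlonglongrightarrow> 0"
  proof (rule LIMSEQ_I)
    fix e :: real assume e: "e > 0"
    obtain N where N: "\<forall>i\<ge>N. \<forall>j\<ge>N. (LINT x|M. (cmod (u i x - u j x))\<^sup>2) < e / 2"
      using C[of "e / 2"] e by auto
    have "norm ((LINT x|M. (cmod (u n x - g x))\<^sup>2) - 0) < e" if "n \<ge> N" for n
      using int[OF N that] e by simp
    then show "\<exists>N. \<forall>n\<ge>N. norm ((LINT x|M. (cmod (u n x - g x))\<^sup>2) - 0) < e" by blast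
  qed
  ultimately show ?thesis by blast
qed

text \<open>
  The square of \<^const>\<open>L2_norm\<close>: squares avoid roots in the parallelogram law and in limits.
\<close>

definition L2_sq :: "nat \<Rightarrow> (complex ^ 'n) set \<Rightarrow> 'n::finite form \<Rightarrow> real" where
  "L2_sq p \<Omega> f = (\<Sum>J | card J = p. LINT z|lebesgue_on \<Omega>. (cmod (f J z))\<^sup>2)"

lemma L2_sq_nonneg: "0 \<le> L2_sq p \<Omega> f"
  unfolding L2_sq_def by (intro sum_nonneg integral_nonneg) auto

lemma L2_norm_eq: "L2_norm p \<Omega> f = sqrt (L2_sq p \<Omega> f)"
  by (simp add: L2_norm_def L2_sq_def)

lemma L2_forms_iff: "f \<in> L2_forms p \<Omega> \<longleftrightarrow> (\<forall>J. card J = p \<longrightarrow> sqint (lebesgue_on \<Omega>) (f J))"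
  by (auto simp: L2_forms_def sqint_def)

lemma L2_forms_diff: "f \<in> L2_forms p \<Omega> \<Longrightarrow> g \<in> L2_forms p \<Omega> \<Longrightarrow> (\<lambda>J z. f J z - g J z) \<in> L2_forms p \<Omega>"
  and L2_forms_cmult: "f \<in> L2_forms p \<Omega> \<Longrightarrow> (\<lambda>J z. c * f J z) \<in> L2_forms p \<Omega>"
  by (auto simp: L2_forms_iff sqint_diff sqint_cmult)

lemma L2_sq_diff_cmult:
  assumes f: "f \<in> L2_forms p \<Omega>" and h: "h \<in> L2_forms p \<Omega>"
  shows "L2_sq p \<Omega> (\<lambda>J z. f J z - c * h J z)
       = L2_sq p \<Omega> f - 2 * Re (cnj c * L2_inner p \<Omega> f h) + (cmod c)\<^sup>2 * L2_sq p \<Omega> h"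
proof -
  let ?M = "lebesgue_on \<Omega>"
  have pt: "(cmod (x - c * y))\<^sup>2 = (cmod x)\<^sup>2 - 2 * Re (cnj c * (x * cnj y)) + (cmod c)\<^sup>2 * (cmod y)\<^sup>2" for x y
  proof -
    have "complex_of_real ((cmod (x - c * y))\<^sup>2) = (x - c * y) * cnj (x - c * y)"
      by (rule complex_norm_square)
    also have "\<dots> = x * cnj x - (cnj c * (x * cnj y) + cnj (cnj c * (x * cnj y))) + (c * cnj c) * (y * cnj y)"
      by (simp add: algebra_simps)
    also have "\<dots> = complex_of_real ((cmod x)\<^sup>2 - 2 * Re (cnj c * (x * cnj y)) + (cmod c)\<^sup>2 * (cmod y)\<^sup>2)"
      by (simp only: complex_add_cnj complex_norm_square[symmetric] of_real_mult of_real_add of_real_diff)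
    finally show ?thesis by (simp only: of_real_eq_iff)
  qed
  have each: "(LINT z|?M. (cmod (f J z - c * h J z))\<^sup>2)
      = (LINT z|?M. (cmod (f J z))\<^sup>2) - 2 * Re (cnj c * (LINT z|?M. f J z * cnj (h J z))) + (cmod c)\<^sup>2 * (LINT z|?M. (cmod (h J z))\<^sup>2)"
    if "card J = p" for J
  proof -
    have s: "sqint ?M (f J)" "sqint ?M (h J)" using f h that by (auto simp: L2_forms_iff)
    have I: "integrable ?M (\<lambda>z. f J z * cnj (h J z))" by (rule sqint_mult_integrable[OF s])
    have I2: "integrable ?M (\<lambda>z. cnj c * (f J z * cnj (h J z)))" using I by (rule integrable_mult_right)
    have "(LINT z|?M. Re (cnj c * (f J z * cnj (h J z)))) = Re (LINT z|?M. cnj c * (f J z * cnj (h J z)))"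
      by (rule integral_Re[OF I2])
    also have "\<dots> = Re (cnj c * (LINT z|?M. f J z * cnj (h J z)))" by simp
    finally have R: "(LINT z|?M. Re (cnj c * (f J z * cnj (h J z)))) = Re (cnj c * (LINT z|?M. f J z * cnj (h J z)))" .
    note ii = sqint_integrable[OF s(1)] sqint_integrable[OF s(2)] integrable_Re[OF I2]
    have "(LINT z|?M. a z - 2 * r z + t * b z) = (LINT z|?M. a z) - 2 * (LINT z|?M. r z) + t * (LINT z|?M. b z)"
      if "integrable ?M a" "integrable ?M b" "integrable ?M r" for a b r :: "(complex, 'a) vec \<Rightarrow> real" and t
      using that by simp
    from this[OF ii] show ?thesis unfolding pt R .
  qed
  have "L2_sq p \<Omega> (\<lambda>J z. f J z - c * h J z) = (\<Sum>J | card J = p. (LINT z|?M. (cmod (f J z))\<^sup>2)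
     - 2 * Re (cnj c * (LINT z|?M. f J z * cnj (h J z))) + (cmod c)\<^sup>2 * (LINT z|?M. (cmod (h J z))\<^sup>2))"
    unfolding L2_sq_def by (intro sum.cong refl each) simp
  also have "\<dots> = L2_sq p \<Omega> f - 2 * Re (cnj c * L2_inner p \<Omega> f h) + (cmod c)\<^sup>2 * L2_sq p \<Omega> h"
    unfolding L2_sq_def L2_inner_def
    by (simp only: sum.distrib sum_subtractf sum_distrib_left[symmetric] Re_sum[symmetric])
  finally show ?thesis .
qed

lemma L2_sq_diff_le:
  assumes "f \<in> L2_forms p \<Omega>" "g \<in> L2_forms p \<Omega>"
  shows "L2_sq p \<Omega> (\<lambda>J z. f J z - g J z) \<le> 2 * L2_sq p \<Omega> f + 2 * L2_sq p \<Omega> g"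
proof -
  have "(LINT z|lebesgue_on \<Omega>. (cmod (f J z - g J z))\<^sup>2)
     \<le> 2 * (LINT z|lebesgue_on \<Omega>. (cmod (f J z))\<^sup>2) + 2 * (LINT z|lebesgue_on \<Omega>. (cmod (g J z))\<^sup>2)"
    if "card J = p" for J
  proof -
    have s: "sqint (lebesgue_on \<Omega>) (f J)" "sqint (lebesgue_on \<Omega>) (g J)"
      using assms that by (auto simp: L2_forms_iff)
    have "(LINT z|lebesgue_on \<Omega>. (cmod (f J z - g J z))\<^sup>2)
      \<le> (LINT z|lebesgue_on \<Omega>. 2 * (cmod (f J z))\<^sup>2 + 2 * (cmod (g J z))\<^sup>2)"
      using s sqint_diff[OF s] by (intro integral_mono cmod_diff_sq_le) (auto simp: sqint_def)
    then show ?thesis using s by (simp add: sqint_def)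
  qed
  then have "L2_sq p \<Omega> (\<lambda>J z. f J z - g J z) \<le> (\<Sum>J | card J = p. 2 * (LINT z|lebesgue_on \<Omega>. (cmod (f J z))\<^sup>2) + 2 * (LINT z|lebesgue_on \<Omega>. (cmod (g J z))\<^sup>2))"
    unfolding L2_sq_def by (intro sum_mono) auto
  then show ?thesis by (simp add: L2_sq_def sum.distrib sum_distrib_left)
qed

lemma finite_measure_lebesgue_on_bounded:
  fixes \<Omega> :: "'a::euclidean_space set"
  assumes "open \<Omega>" "bounded \<Omega>"
  shows "finite_measure (lebesgue_on \<Omega>)"
proof
  have "emeasure lebesgue \<Omega> < \<infinity>"
    using emeasure_bounded_finite[OF assms(2)] assms(1) by simp
  then show "emeasure (lebesgue_on \<Omega>) (space (lebesgue_on \<Omega>)) \<noteq> \<infinity>"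
    using assms by (simp add: emeasure_restrict_space)
qed

lemma L2_complete:
  fixes f :: "nat \<Rightarrow> 'n::finite form"
  assumes \<Omega>: "open \<Omega>" "bounded \<Omega>" and f: "\<And>n. f n \<in> L2_forms p \<Omega>"
    and C: "\<And>e::real. e > 0 \<Longrightarrow> \<exists>N. \<forall>i\<ge>N. \<forall>j\<ge>N. L2_sq p \<Omega> (\<lambda>J z. f i J z - f j J z) < e"
  shows "\<exists>g\<in>L2_forms p \<Omega>. (\<lambda>n. L2_sq p \<Omega> (\<lambda>J z. f n J z - g J z)) \<longlonglongrightarrow> 0"
proof -
  interpret finite_measure "lebesgue_on \<Omega>" by (rule finite_measure_lebesgue_on_bounded[OF \<Omega>])
  have "\<exists>g. sqint (lebesgue_on \<Omega>) g \<and> (\<lambda>n. LINT x|lebesgue_on \<Omega>. (cmod (f n J x - g x))\<^sup>2) \<longlonglongrightarrow> 0"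
    if J: "card J = p" for J
  proof (rule sqint_complete)
    show "sqint (lebesgue_on \<Omega>) (f n J)" for n using f J by (auto simp: L2_forms_iff)
    fix e :: real assume "e > 0"
    from C[OF this] obtain N where N: "\<forall>i\<ge>N. \<forall>j\<ge>N. L2_sq p \<Omega> (\<lambda>J z. f i J z - f j J z) < e" by blast
    have "(LINT x|lebesgue_on \<Omega>. (cmod (f i J x - f j J x))\<^sup>2) \<le> L2_sq p \<Omega> (\<lambda>J z. f i J z - f j J z)" for i j
      unfolding L2_sq_def using J by (intro member_le_sum[where i=J]) (auto intro!: integral_nonneg)
    then show "\<exists>N. \<forall>i\<ge>N. \<forall>j\<ge>N. (LINT x|lebesgue_on \<Omega>. (cmod (f i J x - f j J x))\<^sup>2) < e"
      using N by (meson le_less_trans)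
  qed
  then have "\<forall>J. \<exists>g. card J = p \<longrightarrow> sqint (lebesgue_on \<Omega>) g \<and> (\<lambda>n. LINT x|lebesgue_on \<Omega>. (cmod (f n J x - g x))\<^sup>2) \<longlonglongrightarrow> 0"
    by blast
  from choice[OF this] obtain g where g: "\<And>J. card J = p \<Longrightarrow> sqint (lebesgue_on \<Omega>) (g J)"
     "\<And>J. card J = p \<Longrightarrow> (\<lambda>n. LINT x|lebesgue_on \<Omega>. (cmod (f n J x - g J x))\<^sup>2) \<longlonglongrightarrow> 0"
    by blast
  have "(\<lambda>n. L2_sq p \<Omega> (\<lambda>J z. f n J z - g J z)) \<longlonglongrightarrow> (\<Sum>J\<in>{J::'n set. card J = p}. 0)"
    unfolding L2_sq_def by (intro tendsto_sum g) simp
  moreover have "g \<in> L2_forms p \<Omega>" using g(1) by (simp add: L2_forms_iff)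
  ultimately show ?thesis by (intro bexI[of _ g]) simp_all
qed

lemma dbar_partial_eq_0:
  assumes "compact S" "\<And>x. x \<notin> S \<Longrightarrow> \<eta> x = 0" "z \<notin> S"
  shows "dbar_partial k \<eta> z = 0"
proof -
  have "\<forall>\<^sub>F y in at z. 0 = \<eta> y"
    using eventually_nhds_in_open[OF open_Compl[OF compact_imp_closed[OF assms(1)]], of z] assms(3)
    unfolding eventually_nhds_conv_at by (auto elim!: eventually_mono simp: assms(2))
  then have "(\<eta> has_derivative (\<lambda>_. 0)) (at z)"
    by (rule has_derivative_transform_eventually[OF has_derivative_const[of 0]]) (use assms in auto)
  then have "frechet_derivative \<eta> (at z) = (\<lambda>_. 0)" by (metis frechet_derivative_at)
  then show ?thesis by (simp add: dbar_partial_def)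
qed

lemma test_function_dbar_partial:
  assumes "test_function \<Omega> \<eta>"
  shows "continuous_on UNIV (dbar_partial k \<eta>)" and "\<exists>B. \<forall>z. cmod (dbar_partial k \<eta> z) \<le> B"
proof -
  have C: "C_k 1 \<eta>" using assms by (simp add: test_function_def)
  then show c: "continuous_on UNIV (dbar_partial k \<eta>)"
    unfolding dbar_partial_def by (auto intro!: continuous_intros)
  obtain S where S: "compact S" "\<And>z. z \<notin> S \<Longrightarrow> \<eta> z = 0" using assms unfolding test_function_def by blast
  have z: "dbar_partial k \<eta> z = 0" if "z \<notin> S" for z
    using S(2) that by (intro dbar_partial_eq_0[OF S(1)])
  have "bounded (dbar_partial k \<eta> ` S)"
    by (intro compact_imp_bounded compact_continuous_image continuous_on_subset[OF c] S) simp
  then obtain B where B: "\<forall>z\<in>S. cmod (dbar_partial k \<eta> z) \<le> B" by (auto simp: bounded_iff)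
  have "cmod (dbar_partial k \<eta> z) \<le> \<bar>B\<bar>" for z
    using B z[of z] by (cases "z \<in> S") auto
  then show "\<exists>B. \<forall>z. cmod (dbar_partial k \<eta> z) \<le> B" by blast
qed

lemma integrable_mult_dbar_partial:
  assumes \<Omega>: "open \<Omega>" "bounded \<Omega>" and f: "sqint (lebesgue_on \<Omega>) f" and \<eta>: "test_function \<Omega> \<eta>"
  shows "integrable (lebesgue_on \<Omega>) (\<lambda>z. f z * dbar_partial k \<eta> z)"
proof -
  interpret finite_measure "lebesgue_on \<Omega>" by (rule finite_measure_lebesgue_on_bounded[OF \<Omega>])
  obtain B where B: "\<forall>z. cmod (dbar_partial k \<eta> z) \<le> B" using test_function_dbar_partial(2)[OF \<eta>] by blast
  have "dbar_partial k \<eta> \<in> borel_measurable borel"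
    by (rule borel_measurable_continuous_onI[OF test_function_dbar_partial(1)[OF \<eta>]])
  then have "dbar_partial k \<eta> \<in> borel_measurable (lebesgue_on \<Omega>)"
    by (intro measurable_restrict_space1 measurable_completion) simp
  from sqint_imp_integrable[OF sqint_mult_bounded[OF f this, of B]] B show ?thesis by (simp add: mult.commute)
qed

lemma dbar_closed_diff_cmult:
  assumes \<Omega>: "open \<Omega>" "bounded \<Omega>"
    and "f \<in> L2_forms p \<Omega>" "g \<in> L2_forms p \<Omega>" "dbar_closed p \<Omega> f" "dbar_closed p \<Omega> g"
  shows "dbar_closed p \<Omega> (\<lambda>J z. f J z - c * g J z)"
  unfolding dbar_closed_def
proof (intro allI impI)
  fix K :: "'a set" and \<eta> assume K: "card K = Suc p" and \<eta>: "test_function \<Omega> \<eta>"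
  have "(LINT z|lebesgue_on \<Omega>. (f (K - {k}) z - c * g (K - {k}) z) * dbar_partial k \<eta> z)
     = (LINT z|lebesgue_on \<Omega>. f (K - {k}) z * dbar_partial k \<eta> z) - c * (LINT z|lebesgue_on \<Omega>. g (K - {k}) z * dbar_partial k \<eta> z)"
    if "k \<in> K" for k
  proof -
    have "card (K - {k}) = p" using K that by simp
    then have s: "sqint (lebesgue_on \<Omega>) (f (K - {k}))" "sqint (lebesgue_on \<Omega>) (g (K - {k}))"
      using assms by (auto simp: L2_forms_iff)
    note i = integrable_mult_dbar_partial[OF \<Omega> s(1) \<eta>, of k] integrable_mult_dbar_partial[OF \<Omega> s(2) \<eta>, of k]
    have "(LINT z|lebesgue_on \<Omega>. f (K - {k}) z * dbar_partial k \<eta> z - c * (g (K - {k}) z * dbar_partial k \<eta> z))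
     = (LINT z|lebesgue_on \<Omega>. f (K - {k}) z * dbar_partial k \<eta> z) - c * (LINT z|lebesgue_on \<Omega>. g (K - {k}) z * dbar_partial k \<eta> z)"
      using i by simp
    then show ?thesis by (simp only: left_diff_distrib mult.assoc)
  qed
  then have "(\<Sum>k\<in>K. (-1) ^ card {j\<in>K. j < k} * (LINT z|lebesgue_on \<Omega>. (f (K - {k}) z - c * g (K - {k}) z) * dbar_partial k \<eta> z))
    = (\<Sum>k\<in>K. (-1) ^ card {j\<in>K. j < k} * (LINT z|lebesgue_on \<Omega>. f (K - {k}) z * dbar_partial k \<eta> z))
     - c * (\<Sum>k\<in>K. (-1) ^ card {j\<in>K. j < k} * (LINT z|lebesgue_on \<Omega>. g (K - {k}) z * dbar_partial k \<eta> z))"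
    by (simp add: sum_distrib_left sum_subtractf[symmetric] right_diff_distrib mult_ac)
  also have "\<dots> = 0" using assms(5,6) K \<eta> unfolding dbar_closed_def by simp
  finally show "(\<Sum>k\<in>K. (-1) ^ card {j\<in>K. j < k} * (LINT z|lebesgue_on \<Omega>. (f (K - {k}) z - c * g (K - {k}) z) * dbar_partial k \<eta> z)) = 0" .
qed

lemma K2_forms_diff_cmult:
  assumes \<Omega>: "open \<Omega>" "bounded \<Omega>" and "f \<in> K2_forms p \<Omega>" "g \<in> K2_forms p \<Omega>"
  shows "(\<lambda>J z. f J z - c * g J z) \<in> K2_forms p \<Omega>"
  using assms(3,4) dbar_closed_diff_cmult[OF \<Omega>] L2_forms_diff[OF _ L2_forms_cmult]
  unfolding K2_forms_def by blast

text \<open>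
  On a bounded domain $L^2$ convergence implies $L^1$ convergence, and derivatives of test functions are bounded.
\<close>

lemma dbar_closed_limit:
  fixes f :: "nat \<Rightarrow> 'n::{finite,linorder} form"
  assumes \<Omega>: "open \<Omega>" "bounded \<Omega>"
    and f: "\<And>n. f n \<in> L2_forms p \<Omega>" "\<And>n. dbar_closed p \<Omega> (f n)" and g: "g \<in> L2_forms p \<Omega>"
    and lim: "(\<lambda>n. L2_sq p \<Omega> (\<lambda>J z. f n J z - g J z)) \<longlonglongrightarrow> 0"
  shows "dbar_closed p \<Omega> g"
  unfolding dbar_closed_def
proof (intro allI impI)
  interpret finite_measure "lebesgue_on \<Omega>" by (rule finite_measure_lebesgue_on_bounded[OF \<Omega>])
  fix K :: "'n set" and \<eta> assume K: "card K = Suc p" and \<eta>: "test_function \<Omega> \<eta>"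
  let ?M = "lebesgue_on \<Omega>"
  have "(\<lambda>n. LINT z|?M. f n (K - {k}) z * dbar_partial k \<eta> z) \<longlonglongrightarrow> (LINT z|?M. g (K - {k}) z * dbar_partial k \<eta> z)"
    if k: "k \<in> K" for k
  proof -
    let ?J = "K - {k}" and ?m = "measure ?M (space ?M)"
    have J: "card ?J = p" using K k by simp
    have s: "sqint ?M (f n ?J)" "sqint ?M (g ?J)" for n using f g J by (auto simp: L2_forms_iff)
    obtain B where B: "\<And>z. cmod (dbar_partial k \<eta> z) \<le> B" using test_function_dbar_partial(2)[OF \<eta>] by blast
    have B0: "B \<ge> 0" using B[of undefined] norm_ge_zero order_trans by blast
    have bd: "norm ((LINT z|?M. f n ?J z * dbar_partial k \<eta> z) - (LINT z|?M. g ?J z * dbar_partial k \<eta> z))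
        \<le> B * (\<delta> * ?m + L2_sq p \<Omega> (\<lambda>J z. f n J z - g J z) / \<delta>)" if d: "\<delta> > 0" for n \<delta>
    proof -
      note i = integrable_mult_dbar_partial[OF \<Omega> s(1) \<eta>, of n k] integrable_mult_dbar_partial[OF \<Omega> s(2) \<eta>, of k]
      have "(LINT z|?M. f n ?J z * dbar_partial k \<eta> z) - (LINT z|?M. g ?J z * dbar_partial k \<eta> z)
         = (LINT z|?M. (f n ?J z - g ?J z) * dbar_partial k \<eta> z)"
        using i by (simp add: left_diff_distrib)
      also have "norm \<dots> \<le> (LINT z|?M. norm ((f n ?J z - g ?J z) * dbar_partial k \<eta> z))"
        by (rule integral_norm_bound)
      also have "\<dots> \<le> (LINT z|?M. B * cmod (f n ?J z - g ?J z))"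
      proof (rule integral_mono)
        show "integrable ?M (\<lambda>z. norm ((f n ?J z - g ?J z) * dbar_partial k \<eta> z))"
          by (rule integrable_norm[OF integrable_mult_dbar_partial[OF \<Omega> sqint_diff[OF s] \<eta>]])
        show "integrable ?M (\<lambda>z. B * cmod (f n ?J z - g ?J z))"
          by (rule integrable_mult_right[OF integrable_norm[OF sqint_imp_integrable[OF sqint_diff[OF s]]]])
        show "norm ((f n ?J z - g ?J z) * dbar_partial k \<eta> z) \<le> B * cmod (f n ?J z - g ?J z)" for z
          unfolding norm_mult mult.commute[of B] by (rule mult_left_mono[OF B norm_ge_zero])
      qed
      also have "\<dots> = B * (LINT z|?M. cmod (f n ?J z - g ?J z))" by simp
      also have "\<dots> \<le> B * (\<delta> * ?m + (LINT z|?M. (cmod (f n ?J z - g ?J z))\<^sup>2) / \<delta>)"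
        by (rule mult_left_mono[OF integral_cmod_le[OF sqint_diff[OF s] d] B0])
      also have "\<dots> \<le> B * (\<delta> * ?m + L2_sq p \<Omega> (\<lambda>J z. f n J z - g J z) / \<delta>)"
        unfolding L2_sq_def using d J B0
        by (intro mult_left_mono add_left_mono divide_right_mono member_le_sum[where i="?J"]) (auto intro!: integral_nonneg)
      finally show ?thesis .
    qed
    show ?thesis
    proof (rule LIMSEQ_I)
      fix e :: real assume e: "e > 0"
      define \<delta> where "\<delta> = e / (4 * (B + 1) * (?m + 1))"
      have m0: "?m \<ge> 0" by simp
      have d: "\<delta> > 0" using e B0 m0 by (simp add: \<delta>_def add_nonneg_pos)
      have "\<forall>\<^sub>F n in sequentially. L2_sq p \<Omega> (\<lambda>J z. f n J z - g J z) < \<delta> * \<delta>"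
        using order_tendstoD(2)[OF lim, of "\<delta> * \<delta>"] d by simp
      then obtain N where N: "\<And>n. n \<ge> N \<Longrightarrow> L2_sq p \<Omega> (\<lambda>J z. f n J z - g J z) < \<delta> * \<delta>"
        unfolding eventually_sequentially by blast
      have "norm ((LINT z|?M. f n ?J z * dbar_partial k \<eta> z) - (LINT z|?M. g ?J z * dbar_partial k \<eta> z)) < e" if "n \<ge> N" for n
      proof -
        have "L2_sq p \<Omega> (\<lambda>J z. f n J z - g J z) / \<delta> \<le> \<delta>" using N[OF that] d by (simp add: pos_divide_le_eq)
        then have "B * (\<delta> * ?m + L2_sq p \<Omega> (\<lambda>J z. f n J z - g J z) / \<delta>) \<le> (B + 1) * (\<delta> * ?m + \<delta>)"
          using B0 m0 d L2_sq_nonneg[of p \<Omega> "\<lambda>J z. f n J z - g J z"] by (intro mult_mono add_left_mono) auto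
        also have "\<dots> = \<delta> * ((B + 1) * (?m + 1))" by (simp add: algebra_simps)
        also have "\<dots> = e / 4"
        proof -
          have "(B + 1) * (?m + 1) \<noteq> 0" using B0 m0 by (simp add: add_nonneg_eq_0_iff)
          then show ?thesis unfolding \<delta>_def mult.assoc by simp
        qed
        finally show ?thesis using bd[OF d, of n] e by linarith
      qed
      then show "\<exists>N. \<forall>n\<ge>N. norm ((LINT z|?M. f n ?J z * dbar_partial k \<eta> z) - (LINT z|?M. g ?J z * dbar_partial k \<eta> z)) < e" by blast
    qed
  qed
  then have "(\<lambda>n. \<Sum>k\<in>K. (-1) ^ card {j\<in>K. j < k} * (LINT z|?M. f n (K - {k}) z * dbar_partial k \<eta> z))
     \<longlonglongrightarrow> (\<Sum>k\<in>K. (-1) ^ card {j\<in>K. j < k} * (LINT z|?M. g (K - {k}) z * dbar_partial k \<eta> z))"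
    by (intro tendsto_intros)
  moreover have "(\<Sum>k\<in>K. (-1) ^ card {j\<in>K. j < k} * (LINT z|?M. f n (K - {k}) z * dbar_partial k \<eta> z)) = 0" for n
    using f(2)[of n] K \<eta> unfolding dbar_closed_def by blast
  ultimately show "(\<Sum>k\<in>K. (-1) ^ card {j\<in>K. j < k} * (LINT z|?M. g (K - {k}) z * dbar_partial k \<eta> z)) = 0"
    by (simp add: LIMSEQ_const_iff)
qed


text \<open>
  A minimizing sequence for the distance from \<open>u\<close> is Cauchy by the parallelogram law, its limit is
  closed, and minimality of the limit gives orthogonality by the usual variation.
\<close>

lemma L2_projection_exists:
  fixes u :: "'n::{finite,linorder} form"
  assumes \<Omega>: "open \<Omega>" "bounded \<Omega>" and u: "u \<in> L2_forms p \<Omega>"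
  shows "\<exists>g. g \<in> K2_forms p \<Omega> \<and> (\<forall>h\<in>K2_forms p \<Omega>. L2_inner p \<Omega> (\<lambda>J z. u J z - g J z) h = 0)"
proof -
  let ?K = "K2_forms p \<Omega>" and ?N = "L2_sq p \<Omega>"
  have K_L: "g \<in> L2_forms p \<Omega>" if "g \<in> ?K" for g using that by (simp add: K2_forms_def)
  define D where "D = (\<lambda>g. ?N (\<lambda>J z. u J z - g J z)) ` ?K"
  define d where "d = Inf D"
  have "(\<lambda>J z. 0) \<in> ?K" by (simp add: K2_forms_def L2_forms_iff sqint_zero dbar_closed_def)
  then have Dne: "D \<noteq> {}" unfolding D_def by blast
  have Dbdd: "bdd_below D" unfolding D_def by (rule bdd_belowI[of _ 0]) (auto simp: L2_sq_nonneg)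
  have d_le: "d \<le> ?N (\<lambda>J z. u J z - g J z)" if "g \<in> ?K" for g
    unfolding d_def by (rule cInf_lower[OF _ Dbdd]) (use that in \<open>auto simp: D_def\<close>)
  have "\<exists>g\<in>?K. ?N (\<lambda>J z. u J z - g J z) < d + 1 / real (Suc m)" for m
  proof -
    have "Inf D < d + 1 / real (Suc m)" by (simp add: d_def)
    then obtain y where "y \<in> D" "y < d + 1 / real (Suc m)" using cInf_lessD[OF Dne] by blast
    then show ?thesis by (auto simp: D_def)
  qed
  then have "\<forall>m. \<exists>g. g \<in> ?K \<and> ?N (\<lambda>J z. u J z - g J z) < d + 1 / real (Suc m)" by blast
  from choice[OF this] obtain g where g: "\<And>m. g m \<in> ?K" "\<And>m. ?N (\<lambda>J z. u J z - g m J z) < d + 1 / real (Suc m)"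
    by blast
  have ug: "(\<lambda>J z. u J z - g m J z) \<in> L2_forms p \<Omega>" for m by (rule L2_forms_diff[OF u K_L[OF g(1)]])
  have par: "?N (\<lambda>J z. g i J z - g j J z) \<le> 2 / real (Suc i) + 2 / real (Suc j)" for i j
  proof -
    define a where "a = (\<lambda>J z. u J z - g j J z)"
    define b where "b = (\<lambda>J z. u J z - g i J z)"
    have ab: "a \<in> L2_forms p \<Omega>" "b \<in> L2_forms p \<Omega>" using ug by (auto simp: a_def b_def)
    have e1: "(\<lambda>J z. g i J z - g j J z) = (\<lambda>J z. a J z - 1 * b J z)" by (simp add: a_def b_def)
    define k where "k = (\<lambda>J z. (1/2) * (g i J z - (-1) * g j J z))"
    have "(\<lambda>J z. g i J z - (-1) * g j J z) \<in> ?K" by (rule K2_forms_diff_cmult[OF \<Omega> g(1) g(1)])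
    from K2_forms_diff_cmult[OF \<Omega> \<open>(\<lambda>J z. 0) \<in> ?K\<close> this, of "-(1/2)"]
    have k: "k \<in> ?K" by (simp add: k_def)
    have e2: "(\<lambda>J z. a J z - (-1) * b J z) = (\<lambda>J z. 0 - (-2) * (u J z - k J z))"
      by (simp add: a_def b_def k_def fun_eq_iff algebra_simps add_divide_distrib)
    have "?N (\<lambda>J z. a J z - (-1) * b J z) = 4 * ?N (\<lambda>J z. u J z - k J z)"
    proof -
      have pt: "(cmod (0 - (-2) * x))\<^sup>2 = 4 * (cmod x)\<^sup>2" for x
        by (simp add: norm_mult power_mult_distrib)
      show ?thesis unfolding e2 L2_sq_def pt by (simp add: sum_distrib_left)
    qed
    then have "?N (\<lambda>J z. a J z - (-1) * b J z) \<ge> 4 * d" using d_le[OF k] by simp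
    then have "?N (\<lambda>J z. a J z - 1 * b J z) \<le> 2 * ?N a + 2 * ?N b - 4 * d"
      unfolding L2_sq_diff_cmult[OF ab] by simp
    also have "\<dots> \<le> 2 / real (Suc i) + 2 / real (Suc j)"
      using g(2)[of i] g(2)[of j] unfolding a_def b_def by simp
    finally show ?thesis unfolding e1 .
  qed
  have "\<exists>N. \<forall>i\<ge>N. \<forall>j\<ge>N. ?N (\<lambda>J z. g i J z - g j J z) < e" if e: "e > 0" for e
  proof -
    obtain N where N: "1 / real (Suc N) < e / 4" using nat_approx_posE[of "e / 4"] e by auto
    have "?N (\<lambda>J z. g i J z - g j J z) < e" if "i \<ge> N" "j \<ge> N" for i j
    proof -
      have "1 / real (Suc i) \<le> 1 / real (Suc N)" "1 / real (Suc j) \<le> 1 / real (Suc N)"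
        using that by (auto intro!: divide_left_mono)
      then show ?thesis using par[of i j] N by simp
    qed
    then show ?thesis by blast
  qed
  from L2_complete[OF \<Omega> K_L[OF g(1)] this] obtain G
    where G: "G \<in> L2_forms p \<Omega>" "(\<lambda>n. ?N (\<lambda>J z. g n J z - G J z)) \<longlonglongrightarrow> 0" by blast
  have "dbar_closed p \<Omega> G"
    by (rule dbar_closed_limit[OF \<Omega> K_L[OF g(1)] _ G]) (use g(1) in \<open>simp add: K2_forms_def\<close>)
  then have GK: "G \<in> ?K" using G by (simp add: K2_forms_def)
  have "L2_inner p \<Omega> (\<lambda>J z. u J z - G J z) h = 0" if h: "h \<in> ?K" for h
  proof (rule ccontr)
    define I where "I = L2_inner p \<Omega> (\<lambda>J z. u J z - G J z) h"
    assume "L2_inner p \<Omega> (\<lambda>J z. u J z - G J z) h \<noteq> 0"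
    then have I: "cmod I > 0" by (simp add: I_def)
    have uG: "(\<lambda>J z. u J z - G J z) \<in> L2_forms p \<Omega>" by (rule L2_forms_diff[OF u G(1)])
    have bound: "?N (\<lambda>J z. u J z - G J z) \<le> d"
    proof -
      have "?N (\<lambda>J z. u J z - G J z) \<le> d + e" if e: "e > 0" for e
      proof -
        define c where "c = (\<lambda>m. L2_inner p \<Omega> (\<lambda>J z. u J z - G J z) (\<lambda>J z. g m J z - G J z))"
        have gG: "(\<lambda>J z. g m J z - G J z) \<in> L2_forms p \<Omega>" for m by (rule L2_forms_diff[OF K_L[OF g(1)] G(1)])
        define N where "N = ?N (\<lambda>J z. u J z - G J z)"
        \<comment> \<open>the norm of \<open>(u - g\<^sub>m) - c (g\<^sub>m - G)\<close> expanded at \<open>c = -1\<close>, where it is that of \<open>u - G\<close>, and at \<open>c = 1 / s\<close>, where only nonnegativity is used\<close>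
        have key: "N \<le> (1 + s) * (d + 1 / real (Suc m)) + (1 + 1 / s) * ?N (\<lambda>J z. g m J z - G J z)" if s: "s > 0" for s m
        proof -
          define a where "a = (\<lambda>J z. u J z - g m J z)"
          define b where "b = (\<lambda>J z. g m J z - G J z)"
          have ab: "a \<in> L2_forms p \<Omega>" "b \<in> L2_forms p \<Omega>" using ug gG by (auto simp: a_def b_def)
          have e: "(\<lambda>J z. u J z - G J z) = (\<lambda>J z. a J z - (-1) * b J z)" by (simp add: a_def b_def)
          have N: "N = ?N a + 2 * Re (L2_inner p \<Omega> a b) + ?N b"
            unfolding N_def e L2_sq_diff_cmult[OF ab] by simp
          have "0 \<le> ?N (\<lambda>J z. a J z - complex_of_real (1 / s) * b J z)" by (rule L2_sq_nonneg)
          then have "0 \<le> s * (?N a - 2 * (1 / s) * Re (L2_inner p \<Omega> a b) + (1 / s)\<^sup>2 * ?N b)"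
            unfolding L2_sq_diff_cmult[OF ab] using s by (intro mult_nonneg_nonneg) (auto simp: mult.assoc norm_divide power_divide)
          also have "\<dots> = s * ?N a - 2 * Re (L2_inner p \<Omega> a b) + (1 / s) * ?N b"
            using s by (simp add: power2_eq_square algebra_simps)
          finally have "N \<le> (1 + s) * ?N a + (1 + 1 / s) * ?N b" unfolding N by (simp add: algebra_simps)
          moreover have "(1 + s) * ?N a \<le> (1 + s) * (d + 1 / real (Suc m))"
            using g(2)[of m] s by (intro mult_left_mono) (auto simp: a_def)
          ultimately show ?thesis by (simp add: b_def)
        qed
        have "N \<le> (1 + s) * d" if s: "s > 0" for s
        proof (rule LIMSEQ_le_const)
          show "(\<lambda>m. (1 + s) * (d + 1 / real (Suc m)) + (1 + 1 / s) * ?N (\<lambda>J z. g m J z - G J z)) \<longlonglongrightarrow> (1 + s) * d"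
          proof -
            have "(\<lambda>m. (1 + s) * (d + 1 / real (Suc m)) + (1 + 1 / s) * ?N (\<lambda>J z. g m J z - G J z)) \<longlonglongrightarrow> (1 + s) * (d + 0) + (1 + 1 / s) * 0"
              by (intro tendsto_intros G(2) LIMSEQ_Suc[OF lim_1_over_n])
            then show ?thesis by simp
          qed
          show "\<exists>N'. \<forall>m\<ge>N'. N \<le> (1 + s) * (d + 1 / real (Suc m)) + (1 + 1 / s) * ?N (\<lambda>J z. g m J z - G J z)"
            using key[OF s] by blast
        qed
        moreover have "d \<ge> 0" unfolding d_def using Dne by (intro cInf_greatest) (auto simp: D_def L2_sq_nonneg)
        ultimately have "N \<le> (1 + e / (d + 1)) * d" using e by simp
        also have "\<dots> = d + e * (d / (d + 1))" by (simp add: algebra_simps)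
        also have "\<dots> \<le> d + e * 1" using \<open>d \<ge> 0\<close> e by (intro add_left_mono mult_left_mono) auto
        finally show ?thesis by (simp add: N_def)
      qed
      then show ?thesis by (rule field_le_epsilon)
    qed
    define n where "n = ?N h"
    have n: "n \<ge> 0" by (simp add: n_def L2_sq_nonneg)
    \<comment> \<open>a step so short that the term quadratic in \<open>t\<close> stays below the linear one\<close>
    define t where "t = 1 / (n + 1)"
    have t: "t > 0" "t * n < 1" using n by (auto simp: t_def)
    have "(\<lambda>J z. G J z - (- (of_real t * I)) * h J z) \<in> ?K" by (rule K2_forms_diff_cmult[OF \<Omega> GK h])
    from d_le[OF this] have "d \<le> ?N (\<lambda>J z. (u J z - G J z) - (of_real t * I) * h J z)"
      by (simp add: algebra_simps)
    also have "\<dots> = ?N (\<lambda>J z. u J z - G J z) - 2 * t * (cmod I)\<^sup>2 + t\<^sup>2 * (cmod I)\<^sup>2 * n"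
    proof -
      have "Re (cnj (of_real t * I) * I) = t * (cmod I)\<^sup>2"
        unfolding cmod_power2 by (simp add: power2_eq_square algebra_simps)
      moreover have "(cmod (of_real t * I))\<^sup>2 = t\<^sup>2 * (cmod I)\<^sup>2" by (simp add: norm_mult power_mult_distrib)
      ultimately show ?thesis
        unfolding L2_sq_diff_cmult[OF uG K_L[OF h]] I_def[symmetric] n_def by simp
    qed
    finally have "2 * t * (cmod I)\<^sup>2 \<le> t\<^sup>2 * (cmod I)\<^sup>2 * n" using bound by simp
    also have "\<dots> = t * (cmod I)\<^sup>2 * (t * n)" by (simp add: power2_eq_square)
    also have "\<dots> \<le> t * (cmod I)\<^sup>2 * 1" using t I by (intro mult_left_mono) auto
    finally show False using t I by simp
  qed
  then show ?thesis using GK by blast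
qed

lemma bergman_projection_in_K2:
  fixes u :: "'n::{finite,linorder} form"
  assumes "open \<Omega>" "bounded \<Omega>" "u \<in> L2_forms p \<Omega>"
  shows "bergman_projection p \<Omega> u \<in> K2_forms p \<Omega>"
  unfolding bergman_projection_def
  using someI_ex[OF L2_projection_exists[OF assms]] by blast

section \<open>Averages over ellipsoids\<close>

text \<open>
  The map \<open>A\<close> fixes the shape of the bump: it lives on the translate to \<open>z\<close> of the ellipsoid on which
  \<open>A\<close> has norm at most 1, and its derivative in the direction \<open>v\<close> is controlled by \<open>norm (A v)\<close>. Complex
  linearity of \<open>A\<close> makes it circular.
\<close>

definition bump :: "(complex ^ 'n \<Rightarrow> complex ^ 'n) \<Rightarrow> complex ^ 'n \<Rightarrow> complex ^ 'n \<Rightarrow> complex" where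
  "bump A z x = complex_of_real (exp_flat 1 (1 - (norm (A (x - z)))\<^sup>2))"

definition ellipsoid :: "(complex ^ 'n \<Rightarrow> complex ^ 'n) \<Rightarrow> (complex ^ 'n) set" where
  "ellipsoid A = {w. norm (A w) \<le> 1}"

definition complex_iso :: "(complex ^ 'n \<Rightarrow> complex ^ 'n) \<Rightarrow> bool" where
  "complex_iso A \<longleftrightarrow> linear A \<and> inj A \<and> (\<forall>c w. A (c *s w) = c *s A w)"

lemma exp_flat_1: "exp_flat 1 t = (if t > 0 then exp (- (1 / t)) else 0)"
  by (simp add: exp_flat_def)

lemma exp_flat_1_bounds: "0 \<le> exp_flat 1 t" "exp_flat 1 t \<le> 1"
  by (auto simp: exp_flat_1)

lemma compact_ellipsoid: 
  assumes "complex_iso A" shows "compact (ellipsoid A)"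
proof -
  have A: "linear A" "inj A" using assms by (auto simp: complex_iso_def)
  obtain B where B: "B > 0" "\<And>x. B * norm x \<le> norm (A x)" using linear_inj_bounded_below_pos[OF A] by blast
  have "continuous_on UNIV A" using A(1) by (simp add: linear_continuous_on linear_conv_bounded_linear)
  then have "closed (ellipsoid A)" unfolding ellipsoid_def by (intro closed_Collect_le continuous_intros)
  moreover have "bounded (ellipsoid A)"
  proof (rule boundedI)
    fix x assume "x \<in> ellipsoid A"
    then have "B * norm x \<le> 1" using B(2)[of x] by (simp add: ellipsoid_def)
    then show "norm x \<le> 1 / B" using B(1) by (simp add: field_simps)
  qed
  ultimately show ?thesis by (simp add: compact_eq_bounded_closed)
qed

lemma ellipsoid_balanced:
  assumes "complex_iso A" "w \<in> ellipsoid A" "cmod c \<le> 1"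
  shows "c *s w \<in> ellipsoid A"
proof -
  have "norm (A (c *s w)) = cmod c * norm (A w)" using assms(1) by (simp add: complex_iso_def norm_vscale)
  also have "\<dots> \<le> 1 * 1" using assms(2,3) by (intro mult_mono) (auto simp: ellipsoid_def)
  finally show ?thesis by (simp add: ellipsoid_def)
qed

lemma bump_eq_0: "x - z \<notin> ellipsoid A \<Longrightarrow> bump A z x = 0"
proof -
  assume "x - z \<notin> ellipsoid A"
  then have "1\<^sup>2 < (norm (A (x - z)))\<^sup>2" by (intro power_strict_mono) (auto simp: ellipsoid_def)
  then show ?thesis by (simp add: bump_def exp_flat_1)
qed

lemma norm_bump_le: "cmod (bump A z x) \<le> indicator (ellipsoid A) (x - z)"
  using exp_flat_1_bounds by (cases "x - z \<in> ellipsoid A") (auto simp: bump_eq_0, auto simp: bump_def)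

lemma continuous_on_bump:
  assumes "complex_iso A" shows "continuous_on UNIV (bump A z)"
proof -
  have "linear A" using assms by (simp add: complex_iso_def)
  from has_derivative_continuous[OF exp_flat_quadratic_has_derivative[OF this]]
  show ?thesis unfolding bump_def[abs_def] by (intro continuous_at_imp_continuous_on ballI)
qed

lemma test_function_bump:
  assumes A: "complex_iso A" and sub: "\<And>w. w \<in> ellipsoid A \<Longrightarrow> z + w \<in> \<Omega>"
  shows "test_function \<Omega> (bump A z)"
  unfolding test_function_def
proof (intro conjI allI)
  show "C_k m (bump A z)" for m
    using C_k_exp_flat_quadratic[of A m 1 z] A by (simp add: bump_def[abs_def] complex_iso_def)
  show "\<exists>S. compact S \<and> S \<subseteq> \<Omega> \<and> (\<forall>x. x \<notin> S \<longrightarrow> bump A z x = 0)"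
  proof (intro exI[of _ "(+) z ` ellipsoid A"] conjI allI impI)
    show "compact ((+) z ` ellipsoid A)" by (rule compact_translation[OF compact_ellipsoid[OF A]])
    show "(+) z ` ellipsoid A \<subseteq> \<Omega>" using sub by auto
    fix x assume x: "x \<notin> (+) z ` ellipsoid A"
    have "x - z \<notin> ellipsoid A"
    proof
      assume "x - z \<in> ellipsoid A"
      then have "z + (x - z) \<in> (+) z ` ellipsoid A" by blast
      then show False using x by simp
    qed
    then show "bump A z x = 0" by (rule bump_eq_0)
  qed
qed

lemma bump_mean_value:
  assumes A: "complex_iso A" and sub: "\<And>w. w \<in> ellipsoid A \<Longrightarrow> z + w \<in> U" and f: "holomorphic_fun_on f U"
  shows "(LINT x|lborel. f x * bump A z x) = f z * (LINT w|lborel. bump A 0 w)"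
    and "integrable lborel (\<lambda>x. f x * bump A z x)"
proof -
  have b: "bump A z (z + w) = bump A 0 w" for w by (simp add: bump_def)
  have eq: "(\<lambda>x. indicator ((+) z ` ellipsoid A) x *\<^sub>R (f x * bump A z x)) = (\<lambda>x. f x * bump A z x)"
  proof
    fix x
    show "indicator ((+) z ` ellipsoid A) x *\<^sub>R (f x * bump A z x) = f x * bump A z x"
    proof (cases "x - z \<in> ellipsoid A")
      case True
      then have "z + (x - z) \<in> (+) z ` ellipsoid A" by blast
      then show ?thesis by simp
    qed (simp add: bump_eq_0)
  qed
  have "integrable lborel (\<lambda>x. indicator ((+) z ` ellipsoid A) x *\<^sub>R (f x * bump A z x))"
    using sub
    by (intro borel_integrable_compact compact_translation compact_ellipsoid[OF A] continuous_intros
          continuous_on_subset[OF holomorphic_fun_on_imp_continuous_on[OF f]] continuous_on_subset[OF continuous_on_bump[OF A]]) auto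
  then show i: "integrable lborel (\<lambda>x. f x * bump A z x)" unfolding eq .
  then have m: "(\<lambda>x. f x * bump A z x) \<in> borel_measurable borel" by simp
  have "(LINT x|lborel. f x * bump A z x) = (LINT w|lborel. f (z + w) * bump A z (z + w))"
    by (rule integral_lborel_translate[OF m, symmetric])
  also have "\<dots> = (LINT w|lborel. f (z + w) * bump A 0 w)" by (simp add: b)
  also have "\<dots> = f z * (LINT w|lborel. bump A 0 w)"
  proof (rule holomorphic_circular_mean_value[OF f compact_ellipsoid[OF A] sub ellipsoid_balanced[OF A]])
    show "continuous_on UNIV (bump A 0)" by (rule continuous_on_bump[OF A])
    show "bump A 0 w = 0" if "w \<notin> ellipsoid A" for w using bump_eq_0[of w 0 A] that by simp
    show "bump A 0 (c *s w) = bump A 0 w" if "cmod c = 1" for c w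
      using A that by (simp add: bump_def complex_iso_def norm_vscale)
  qed auto
  finally show "(LINT x|lborel. f x * bump A z x) = f z * (LINT w|lborel. bump A 0 w)" .
qed

lemma integral_lborel_affine:
  fixes H :: "'a::euclidean_space \<Rightarrow> real"
  assumes "c \<noteq> 0" and [measurable]: "H \<in> borel_measurable borel"
  shows "(LINT x|lborel. H x) = \<bar>c\<bar> ^ DIM('a) * (LINT x|lborel. H (t + c *\<^sub>R x))"
proof -
  have "(LINT x|lborel. H x) = (LINT x|density (distr lborel borel (\<lambda>x. t + c *\<^sub>R x)) (\<lambda>_. ennreal (\<bar>c\<bar> ^ DIM('a))). H x)"
    using lborel_affine[OF assms(1), of t] by simp
  also have "\<dots> = (LINT x|distr lborel borel (\<lambda>x. t + c *\<^sub>R x). \<bar>c\<bar> ^ DIM('a) *\<^sub>R H x)"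
    by (subst integral_density) auto
  also have "\<dots> = (LINT x|lborel. \<bar>c\<bar> ^ DIM('a) *\<^sub>R H (t + c *\<^sub>R x))"
    by (subst integral_distr) auto
  finally show ?thesis by simp
qed

lemma measure_ellipsoid_pos:
  assumes "complex_iso A" shows "0 < measure lborel (ellipsoid A)"
proof -
  have A: "linear A" using assms by (auto simp: complex_iso_def)
  define V where "V = {w. norm (A w) < 1}"
  have c: "continuous_on UNIV A" using A by (simp add: linear_continuous_on linear_conv_bounded_linear)
  have o: "open V" unfolding V_def by (intro open_Collect_less continuous_intros c)
  have "0 \<in> V" using linear_0[OF A] by (simp add: V_def)
  then have "\<not> negligible V" using open_not_negligible[OF o] by blast
  then have "emeasure lborel V \<noteq> 0" using o by (auto simp: negligible_iff_null_sets null_sets_def)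
  moreover have "emeasure lborel V \<le> emeasure lborel (ellipsoid A)"
    using compact_ellipsoid[OF assms] by (intro emeasure_mono) (auto simp: V_def ellipsoid_def intro!: borel_compact)
  moreover have "emeasure lborel (ellipsoid A) < \<infinity>" by (rule emeasure_compact_finite[OF compact_ellipsoid[OF assms]])
  ultimately show ?thesis by (auto simp: measure_def enn2real_positive_iff less_top zero_less_iff_neq_zero)
qed

text \<open>
  On the ellipsoid shrunk by the factor 2 the argument of \<open>exp_flat 1\<close> is at least $3/4$. The bound relative to
  the volume of the ellipsoid is what makes the later estimates uniform in its shape.
\<close>

lemma bump_integral_lower_bound:
  assumes A: "complex_iso A"
  obtains c where "(LINT w|lborel. bump A 0 w) = complex_of_real c"
    "exp (- 4 / 3) / 2 ^ DIM(complex ^ 'n) * measure lborel (ellipsoid (A :: complex ^ 'n \<Rightarrow> complex ^ 'n)) \<le> c"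
proof -
  let ?b = "\<lambda>w. exp_flat 1 (1 - (norm (A w))\<^sup>2)" and ?d = "DIM(complex ^ 'n)"
  have lin: "linear A" using A by (simp add: complex_iso_def)
  have sE: "ellipsoid A \<in> sets borel" by (rule borel_compact[OF compact_ellipsoid[OF A]])
  have fin: "emeasure lborel (ellipsoid A) < \<infinity>" by (rule emeasure_compact_finite[OF compact_ellipsoid[OF A]])
  have eq: "(LINT w|lborel. bump A 0 w) = complex_of_real (LINT w|lborel. ?b w)"
    unfolding bump_def by simp
  have c: "continuous_on UNIV A" using lin by (simp add: linear_continuous_on linear_conv_bounded_linear)
  have cb: "continuous_on UNIV ?b" 
    by (intro continuous_on_compose2[OF continuous_on_exp_flat] continuous_intros c) auto
  have "integrable lborel (\<lambda>w. indicator (ellipsoid A) w *\<^sub>R ?b w)"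
    by (rule borel_integrable_compact[OF compact_ellipsoid[OF A] continuous_on_subset[OF cb]]) simp
  moreover have "(\<lambda>w. indicator (ellipsoid A) w *\<^sub>R ?b w) = ?b"
    using bump_eq_0[of _ 0 A] by (auto simp: fun_eq_iff indicator_def bump_def)
  ultimately have ib: "integrable lborel ?b" by simp
  define H where "H w = indicat_real (ellipsoid A) (2 *\<^sub>R w)" for w
  have mH: "H \<in> borel_measurable borel" unfolding H_def using sE by measurable
  have H: "(LINT w|lborel. H w) = (1/2) ^ ?d * measure lborel (ellipsoid A)"
  proof -
    have "(LINT w|lborel. H w) = \<bar>1/2\<bar> ^ ?d * (LINT w|lborel. H (0 + (1/2) *\<^sub>R w))"
      by (rule integral_lborel_affine[OF _ mH]) simp
    then show ?thesis using sE fin by (simp add: H_def)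
  qed
  have iH: "integrable lborel H"
  proof (rule ccontr)
    assume "\<not> integrable lborel H"
    then have "(LINT w|lborel. H w) = 0" by (rule not_integrable_integral_eq)
    then show False using H measure_ellipsoid_pos[OF A] by simp
  qed
  have "(LINT w|lborel. exp (- 4 / 3) * H w) \<le> (LINT w|lborel. ?b w)"
  proof (rule integral_mono)
    show "exp (- 4 / 3) * H w \<le> ?b w" for w
    proof (cases "2 *\<^sub>R w \<in> ellipsoid A")
      case True
      then have "norm (A w) \<le> 1 / 2" by (simp add: ellipsoid_def linear_scale[OF lin])
      then have "(norm (A w))\<^sup>2 \<le> (1 / 2)\<^sup>2" by (intro power_mono) auto
      then have s: "1 - (norm (A w))\<^sup>2 \<ge> 3 / 4" by (simp add: power2_eq_square)
      then have "1 / (1 - (norm (A w))\<^sup>2) \<le> 1 / (3 / 4)" by (intro divide_left_mono) auto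
      then show ?thesis using True s by (simp add: H_def exp_flat_1)
    qed (simp add: H_def exp_flat_1_bounds)
  qed (use iH ib in auto)
  moreover have "(LINT w|lborel. exp (- 4 / 3) * H w) = exp (- 4 / 3) * ((1/2) ^ ?d * measure lborel (ellipsoid A))"
    unfolding H[symmetric] by (rule integral_mult_right_zero)
  moreover have "e * ((1/2) ^ d * m) = e / 2 ^ d * m" for e m :: real and d
    by (metis mult.assoc power_one_over times_divide_eq_right mult_1_right)
  ultimately have "exp (- 4 / 3) / 2 ^ ?d * measure lborel (ellipsoid A) \<le> (LINT w|lborel. ?b w)"
    by (simp only:)
  with eq show ?thesis by (rule that)
qed

lemma bump_dbar_bound:
  "\<exists>B>0. \<forall>(A :: complex ^ 'n \<Rightarrow> complex ^ 'n) z x v. complex_iso A \<longrightarrow>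
     cmod (dbar_dir (frechet_derivative (bump A z) (at x)) v) \<le> B * norm (A v) * indicator (ellipsoid A) (x - z)"
proof -
  let ?g = "exp_flat (exp_flat_deriv 1)"
  have "bounded (?g ` {0..1})"
    by (intro compact_imp_bounded compact_continuous_image continuous_on_subset[OF continuous_on_exp_flat]) auto
  then obtain M where "\<forall>t\<in>{0..1}. \<bar>?g t\<bar> \<le> M" by (auto simp: bounded_iff)
  then have M: "\<And>t. t \<in> {0..1} \<Longrightarrow> \<bar>?g t\<bar> \<le> M" by blast
  define B where "B = 2 * \<bar>M\<bar> + 1"
  have "cmod (dbar_dir (frechet_derivative (bump A z) (at x)) v) \<le> B * norm (A v) * indicator (ellipsoid A) (x - z)"
    if A: "complex_iso A" for A z x and v :: "complex ^ 'n"
  proof -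
    have lin: "linear A" using A by (simp add: complex_iso_def)
    define P where "P = 1 - (norm (A (x - z)))\<^sup>2"
    have fd: "frechet_derivative (bump A z) (at x) = (\<lambda>v. complex_of_real (?g P) * complex_of_real (- 2 * (A (x - z) \<bullet> A v)))"
      using frechet_derivative_at[OF exp_flat_quadratic_has_derivative[OF lin, of 1 z x]] by (simp add: bump_def[abs_def] P_def)
    show ?thesis
    proof (cases "x - z \<in> ellipsoid A")
      case False
      then have "1\<^sup>2 < (norm (A (x - z)))\<^sup>2" by (intro power_strict_mono) (auto simp: ellipsoid_def)
      then have "?g P = 0" by (simp add: P_def exp_flat_def)
      then show ?thesis using False by (simp add: fd dbar_dir_def)
    next
      case True
      then have n1: "norm (A (x - z)) \<le> 1" by (simp add: ellipsoid_def)
      then have "(norm (A (x - z)))\<^sup>2 \<le> 1\<^sup>2" by (intro power_mono) auto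
      then have "P \<in> {0..1}" by (simp add: P_def)
      from M[OF this] have g: "\<bar>?g P\<bar> \<le> \<bar>M\<bar>" by linarith
      have b: "cmod (frechet_derivative (bump A z) (at x) v) \<le> 2 * \<bar>M\<bar> * norm (A v)" for v
      proof -
        have "\<bar>A (x - z) \<bullet> A v\<bar> \<le> norm (A (x - z)) * norm (A v)" by (rule Cauchy_Schwarz_ineq2)
        also have "\<dots> \<le> 1 * norm (A v)" using n1 by (intro mult_right_mono) auto
        finally have "\<bar>?g P\<bar> * (2 * \<bar>A (x - z) \<bullet> A v\<bar>) \<le> \<bar>M\<bar> * (2 * norm (A v))"
          using g by (intro mult_mono) auto
        then show ?thesis by (simp add: fd norm_mult abs_mult)
      qed
      have ni: "norm (A (\<i> *s v)) = norm (A v)" using A by (simp add: complex_iso_def norm_vscale)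
      have "cmod (dbar_dir (frechet_derivative (bump A z) (at x)) v)
         \<le> (cmod (frechet_derivative (bump A z) (at x) v) + cmod (frechet_derivative (bump A z) (at x) (\<i> *s v))) / 2"
        unfolding dbar_dir_def by (simp add: norm_divide) (rule order_trans[OF norm_triangle_ineq], simp add: norm_mult)
      also have "\<dots> \<le> 2 * \<bar>M\<bar> * norm (A v)" using b[of v] b[of "\<i> *s v"] unfolding ni by simp
      also have "\<dots> \<le> B * norm (A v)" by (intro mult_right_mono) (auto simp: B_def)
      finally show ?thesis using True by simp
    qed
  qed
  moreover have "B > 0" by (simp add: B_def)
  ultimately show ?thesis by blast
qed

text \<open>
  The Cauchy--Schwarz inequality on \<open>E\<close>, then Tonelli's theorem and translation invariance. As \<open>h\<close> is only Lebesgue measurable, a Borel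
  measurable representative is used, for which \<open>H (z + w)\<close> is jointly measurable.
\<close>

lemma averaging_estimate:
  fixes h :: "'a::euclidean_space \<Rightarrow> real" and f :: "'a \<Rightarrow> complex"
  assumes \<Omega>: "open \<Omega>" and E: "compact E" and G: "open G"
    and sub: "\<And>z w. z \<in> G \<Longrightarrow> w \<in> E \<Longrightarrow> z + w \<in> \<Omega>"
    and h: "integrable (lebesgue_on \<Omega>) h" "integrable (lebesgue_on \<Omega>) (\<lambda>x. (h x)\<^sup>2)" and h0: "\<And>x. x \<in> \<Omega> \<Longrightarrow> h x \<ge> 0"
    and f: "f \<in> borel_measurable (lebesgue_on G)" and k: "k \<ge> 0"
    and bound: "\<And>z. z \<in> G \<Longrightarrow> k * cmod (f z) \<le> (LINT x|lebesgue_on \<Omega>. indicator E (x - z) * h x)"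
  shows "integrable (lebesgue_on G) (\<lambda>z. (k * cmod (f z))\<^sup>2)"
    and "(LINT z|lebesgue_on G. (k * cmod (f z))\<^sup>2) \<le> (measure lborel E)\<^sup>2 * (LINT x|lebesgue_on \<Omega>. (h x)\<^sup>2)"
proof -
  have Os: "\<Omega> \<in> sets lebesgue" and Gs: "G \<in> sets lebesgue" using \<Omega> G by auto
  define h1 where "h1 x = (if x \<in> \<Omega> then h x else 0)" for x
  have h1m: "h1 \<in> borel_measurable lebesgue"
    unfolding h1_def using h(1) borel_measurable_if_I[OF _ Os] by blast
  obtain h2 where h2[measurable]: "h2 \<in> borel_measurable lborel" and h12: "AE x in lborel. h1 x = h2 x"
    using completion_ex_borel_measurable_real[OF h1m] by blast
  define H where "H x = ennreal (h2 x)" for x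
  have H[measurable]: "H \<in> borel_measurable borel" unfolding H_def using h2 by measurable
  have Em[measurable]: "E \<in> sets borel" by (rule borel_compact[OF E])
  have Gm[measurable]: "G \<in> sets borel" using G by simp
  have mE: "emeasure lborel E = ennreal (measure lborel E)"
    using emeasure_compact_finite[OF E] by (intro emeasure_eq_ennreal_measure) auto
  have AEl: "AE x in lebesgue. ennreal (h1 x) = H x"
    using AE_completion[OF h12] by eventually_elim (simp add: H_def)
  have int2: "(\<integral>\<^sup>+x. (H x)\<^sup>2 \<partial>lborel) = ennreal (LINT x|lebesgue_on \<Omega>. (h x)\<^sup>2)"
  proof -
    have "(\<integral>\<^sup>+x. (H x)\<^sup>2 \<partial>lborel) = (\<integral>\<^sup>+x. (H x)\<^sup>2 \<partial>lebesgue)"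
      by (rule nn_integral_completion[symmetric])
    also have "\<dots> = (\<integral>\<^sup>+x. (ennreal (h1 x))\<^sup>2 \<partial>lebesgue)"
      by (rule nn_integral_cong_AE) (use AEl in eventually_elim, simp)
    also have "\<dots> = (\<integral>\<^sup>+x. ennreal (if x \<in> \<Omega> then (h x)\<^sup>2 else 0) \<partial>lebesgue)"
      by (intro nn_integral_cong) (auto simp: h1_def ennreal_power h0)
    also have "\<dots> = ennreal (LINT x|lebesgue. (if x \<in> \<Omega> then (h x)\<^sup>2 else 0))"
      using h(2) by (intro nn_integral_eq_integral) (auto simp: Lebesgue_Measure.integrable_restrict_UNIV[OF Os])
    also have "(LINT x|lebesgue. (if x \<in> \<Omega> then (h x)\<^sup>2 else 0)) = (LINT x|lebesgue_on \<Omega>. (h x)\<^sup>2)"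
      by (rule Lebesgue_Measure.integral_restrict_UNIV[OF Os])
    finally show ?thesis .
  qed
  have bd: "ennreal (k * cmod (f z)) \<le> (\<integral>\<^sup>+w. indicator E w * H (z + w) \<partial>lborel)" if z: "z \<in> G" for z
  proof -
    have Ez: "(\<lambda>x. indicat_real E (x - z)) \<in> borel_measurable borel" by measurable
    have i: "integrable (lebesgue_on \<Omega>) (\<lambda>x. indicator E (x - z) * h x)"
    proof (rule Bochner_Integration.integrable_bound[OF h(1)])
      have "(\<lambda>x. indicat_real E (x - z)) \<in> borel_measurable (lebesgue_on \<Omega>)"
        using Ez by (intro measurable_restrict_space1 measurable_completion) simp
      then show "(\<lambda>x. indicator E (x - z) * h x) \<in> borel_measurable (lebesgue_on \<Omega>)"
        using h(1) by (intro borel_measurable_times) auto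
    qed (auto simp: indicator_def)
    have "ennreal (k * cmod (f z)) \<le> ennreal (LINT x|lebesgue_on \<Omega>. indicator E (x - z) * h x)"
      by (rule ennreal_leI[OF bound[OF z]])
    also have "(LINT x|lebesgue_on \<Omega>. indicator E (x - z) * h x) = (LINT x|lebesgue. (if x \<in> \<Omega> then indicator E (x - z) * h x else 0))"
      by (rule Lebesgue_Measure.integral_restrict_UNIV[OF Os, symmetric])
    also have "ennreal \<dots> = (\<integral>\<^sup>+x. ennreal (if x \<in> \<Omega> then indicator E (x - z) * h x else 0) \<partial>lebesgue)"
      using i h0 by (intro nn_integral_eq_integral[symmetric]) (auto simp: Lebesgue_Measure.integrable_restrict_UNIV[OF Os])
    also have "\<dots> = (\<integral>\<^sup>+x. indicator E (x - z) * ennreal (h1 x) \<partial>lebesgue)"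
      by (intro nn_integral_cong) (auto simp: h1_def indicator_def)
    also have "\<dots> = (\<integral>\<^sup>+x. indicator E (x - z) * H x \<partial>lebesgue)"
      by (rule nn_integral_cong_AE) (use AEl in eventually_elim, simp)
    also have "\<dots> = (\<integral>\<^sup>+x. indicator E (x - z) * H x \<partial>lborel)"
      by (rule nn_integral_completion)
    also have "\<dots> = (\<integral>\<^sup>+w. indicator E ((z + w) - z) * H (z + w) \<partial>lborel)"
      by (rule nn_integral_lborel_translate[symmetric]) measurable
    finally show ?thesis by simp
  qed
  have "(\<integral>\<^sup>+z. \<integral>\<^sup>+w. indicator G z * (indicator E w * (H (z + w))\<^sup>2) \<partial>lborel \<partial>lborel)
     = (\<integral>\<^sup>+w. \<integral>\<^sup>+z. indicator G z * (indicator E w * (H (z + w))\<^sup>2) \<partial>lborel \<partial>lborel)"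
    by (rule lborel_pair.Fubini') measurable
  also have "\<dots> \<le> (\<integral>\<^sup>+w. indicator E w * (\<integral>\<^sup>+x. (H x)\<^sup>2 \<partial>lborel) \<partial>lborel)"
  proof (rule nn_integral_mono)
    fix w
    have "(\<integral>\<^sup>+z. indicator G z * (indicator E w * (H (z + w))\<^sup>2) \<partial>lborel) \<le> (\<integral>\<^sup>+z. indicator E w * (H (w + z))\<^sup>2 \<partial>lborel)"
      by (intro nn_integral_mono) (auto simp: indicator_def add.commute)
    also have "\<dots> = indicator E w * (\<integral>\<^sup>+z. (H (w + z))\<^sup>2 \<partial>lborel)" by (rule nn_integral_cmult) measurable
    also have "(\<integral>\<^sup>+z. (H (w + z))\<^sup>2 \<partial>lborel) = (\<integral>\<^sup>+z. (H z)\<^sup>2 \<partial>lborel)"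
      by (rule nn_integral_lborel_translate) measurable
    finally show "(\<integral>\<^sup>+z. indicator G z * (indicator E w * (H (z + w))\<^sup>2) \<partial>lborel) \<le> indicator E w * (\<integral>\<^sup>+x. (H x)\<^sup>2 \<partial>lborel)" .
  qed
  also have "\<dots> = emeasure lborel E * (\<integral>\<^sup>+x. (H x)\<^sup>2 \<partial>lborel)"
    by (subst nn_integral_multc) auto
  finally have inner: "(\<integral>\<^sup>+z. \<integral>\<^sup>+w. indicator G z * (indicator E w * (H (z + w))\<^sup>2) \<partial>lborel \<partial>lborel)
     \<le> emeasure lborel E * (\<integral>\<^sup>+x. (H x)\<^sup>2 \<partial>lborel)" .
  have "(\<integral>\<^sup>+z. ennreal (if z \<in> G then (k * cmod (f z))\<^sup>2 else 0) \<partial>lebesgue)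
     \<le> (\<integral>\<^sup>+z. emeasure lborel E * (\<integral>\<^sup>+w. indicator G z * (indicator E w * (H (z + w))\<^sup>2) \<partial>lborel) \<partial>lborel)"
  proof -
    have "(\<integral>\<^sup>+z. ennreal (if z \<in> G then (k * cmod (f z))\<^sup>2 else 0) \<partial>lebesgue)
      \<le> (\<integral>\<^sup>+z. emeasure lborel E * (\<integral>\<^sup>+w. indicator G z * (indicator E w * (H (z + w))\<^sup>2) \<partial>lborel) \<partial>lebesgue)"
    proof (rule nn_integral_mono)
      fix z
      show "ennreal (if z \<in> G then (k * cmod (f z))\<^sup>2 else 0)
        \<le> emeasure lborel E * (\<integral>\<^sup>+w. indicator G z * (indicator E w * (H (z + w))\<^sup>2) \<partial>lborel)"
      proof (cases "z \<in> G")
        case True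
        have "ennreal ((k * cmod (f z))\<^sup>2) = (ennreal (k * cmod (f z)))\<^sup>2" using k by (simp add: ennreal_power)
        also have "\<dots> \<le> (\<integral>\<^sup>+w. indicator E w * H (z + w) \<partial>lborel)\<^sup>2"
          by (rule power_mono[OF bd[OF True]]) simp
        also have "(\<integral>\<^sup>+w. indicator E w * H (z + w) \<partial>lborel) = (\<integral>\<^sup>+w. indicator E w * (indicator E w * H (z + w)) \<partial>lborel)"
          by (intro nn_integral_cong) (auto simp: indicator_def)
        also have "\<dots>\<^sup>2 \<le> (\<integral>\<^sup>+w. (indicator E w)\<^sup>2 \<partial>lborel) * (\<integral>\<^sup>+w. (indicator E w * H (z + w))\<^sup>2 \<partial>lborel)"
          by (rule Cauchy_Schwarz_nn_integral) measurable
        also have "(\<integral>\<^sup>+w. (indicator E w)\<^sup>2 \<partial>lborel) = emeasure lborel E"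
        proof -
          have "(\<integral>\<^sup>+w. (indicator E w)\<^sup>2 \<partial>lborel) = (\<integral>\<^sup>+w. indicator E w \<partial>lborel)"
            by (intro nn_integral_cong) (auto simp: indicator_def)
          then show ?thesis by simp
        qed
        also have "(\<integral>\<^sup>+w. (indicator E w * H (z + w))\<^sup>2 \<partial>lborel) = (\<integral>\<^sup>+w. indicator G z * (indicator E w * (H (z + w))\<^sup>2) \<partial>lborel)"
          using True by (intro nn_integral_cong) (auto simp: indicator_def)
        finally show ?thesis using True by simp
      qed simp
    qed
    also have "\<dots> = (\<integral>\<^sup>+z. emeasure lborel E * (\<integral>\<^sup>+w. indicator G z * (indicator E w * (H (z + w))\<^sup>2) \<partial>lborel) \<partial>lborel)"
      by (rule nn_integral_completion)
    finally show ?thesis .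
  qed
  also have "\<dots> = emeasure lborel E * (\<integral>\<^sup>+z. \<integral>\<^sup>+w. indicator G z * (indicator E w * (H (z + w))\<^sup>2) \<partial>lborel \<partial>lborel)"
    by (rule nn_integral_cmult) measurable
  also have "\<dots> \<le> emeasure lborel E * (emeasure lborel E * (\<integral>\<^sup>+x. (H x)\<^sup>2 \<partial>lborel))"
    by (rule mult_left_mono[OF inner]) simp
  also have "emeasure lborel E * (emeasure lborel E * (\<integral>\<^sup>+x. (H x)\<^sup>2 \<partial>lborel)) = ennreal ((measure lborel E)\<^sup>2 * (LINT x|lebesgue_on \<Omega>. (h x)\<^sup>2))"
    unfolding int2 mE by (simp add: ennreal_mult'[symmetric] power2_eq_square mult.assoc)
  finally have main: "(\<integral>\<^sup>+z. ennreal (if z \<in> G then (k * cmod (f z))\<^sup>2 else 0) \<partial>lebesgue)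
     \<le> ennreal ((measure lborel E)\<^sup>2 * (LINT x|lebesgue_on \<Omega>. (h x)\<^sup>2))"
    .
  have "(\<lambda>z. cmod (f z)) \<in> borel_measurable (lebesgue_on G)"
    by (rule measurable_compose[OF f]) simp
  then have "(\<lambda>z. (k * cmod (f z))\<^sup>2) \<in> borel_measurable (lebesgue_on G)"
    by (intro borel_measurable_power borel_measurable_times borel_measurable_const)
  then have fm: "(\<lambda>z. if z \<in> G then (k * cmod (f z))\<^sup>2 else 0) \<in> borel_measurable lebesgue"
    by (rule borel_measurable_if_I[OF _ Gs])
  have fi: "integrable lebesgue (\<lambda>z. if z \<in> G then (k * cmod (f z))\<^sup>2 else 0)"
  proof (rule integrableI_bounded[OF fm])
    have "(\<integral>\<^sup>+z. ennreal (norm (if z \<in> G then (k * cmod (f z))\<^sup>2 else 0)) \<partial>lebesgue)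
      = (\<integral>\<^sup>+z. ennreal (if z \<in> G then (k * cmod (f z))\<^sup>2 else 0) \<partial>lebesgue)"
      by (intro nn_integral_cong) auto
    then show "(\<integral>\<^sup>+z. ennreal (norm (if z \<in> G then (k * cmod (f z))\<^sup>2 else 0)) \<partial>lebesgue) < \<infinity>"
      using main by (simp add: le_less_trans)
  qed
  then show "integrable (lebesgue_on G) (\<lambda>z. (k * cmod (f z))\<^sup>2)"
    by (simp add: Lebesgue_Measure.integrable_restrict_UNIV[OF Gs])
  have "ennreal (LINT z|lebesgue. (if z \<in> G then (k * cmod (f z))\<^sup>2 else 0)) \<le> ennreal ((measure lborel E)\<^sup>2 * (LINT x|lebesgue_on \<Omega>. (h x)\<^sup>2))"
    using main by (subst (asm) nn_integral_eq_integral[OF fi]) auto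
  then have "(LINT z|lebesgue. (if z \<in> G then (k * cmod (f z))\<^sup>2 else 0)) \<le> (measure lborel E)\<^sup>2 * (LINT x|lebesgue_on \<Omega>. (h x)\<^sup>2)"
    by (subst (asm) ennreal_le_iff) (auto intro!: mult_nonneg_nonneg integral_nonneg)
  then show "(LINT z|lebesgue_on G. (k * cmod (f z))\<^sup>2) \<le> (measure lborel E)\<^sup>2 * (LINT x|lebesgue_on \<Omega>. (h x)\<^sup>2)"
    by (simp add: Lebesgue_Measure.integral_restrict_UNIV[OF Gs])
qed

section \<open>Discs in the boundary of a convex domain\<close>

text \<open>
  The number \<open>h 0 + h' / 2\<close> is the average of \<open>h\<close> over the unit circle with the weight $1 + \cos t \ge 0$: the Fourier
  coefficients of \<open>h\<close> of orders 0, 1 and $-1$ are \<open>h 0\<close>, \<open>h'\<close> and 0.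
\<close>

lemma positive_real_part_derivative:
  assumes h: "h holomorphic_on cball 0 1" and d: "(h has_field_derivative h') (at 0)"
    and pos: "\<And>\<zeta>. \<zeta> \<in> cball 0 1 \<Longrightarrow> 0 \<le> Re (h \<zeta>)"
  shows "0 \<le> Re (h 0 + h' / 2)"
proof -
  let ?e = "\<lambda>t::real. exp (2 * of_real pi * \<i> * of_real t) :: complex"
  define c :: complex where "c = 2 * of_real pi * \<i>"
  have c0: "c \<noteq> 0" by (simp add: c_def)
  have I0: "((\<lambda>t. h (?e t)) has_integral h 0) {0..1}" by (rule circle_mean_value[OF h])
  have "(\<lambda>\<zeta>. \<zeta> * h \<zeta>) holomorphic_on cball 0 1" using h by (intro holomorphic_intros)
  from circle_mean_value[OF this] have I1: "((\<lambda>t. ?e t * h (?e t)) has_integral 0) {0..1}" by simp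
  note cd = Cauchy_derivative_integral_circlepath[OF holomorphic_on_imp_continuous_on[OF h] holomorphic_on_subset[OF h ball_subset_cball], of 0]
  have "(1 / c * contour_integral (circlepath 0 1) (\<lambda>u. h u / u\<^sup>2)) = h'"
    using DERIV_unique[OF cd(2) d] by (simp add: c_def)
  then have "contour_integral (circlepath 0 1) (\<lambda>u. h u / u\<^sup>2) = c * h'" using c0 by (simp add: field_simps)
  then have "((\<lambda>u. h u / u\<^sup>2) has_contour_integral (c * h')) (circlepath 0 1)"
    using has_contour_integral_integral[OF cd(1)] by simp
  then have I: "((\<lambda>t. h (circlepath 0 1 t) / (circlepath 0 1 t)\<^sup>2 * vector_derivative (circlepath 0 1) (at t within {0..1}))
      has_integral (c * h')) {0..1}"
    by (simp add: has_contour_integral_def)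
  have eq: "h (circlepath 0 1 t) / (circlepath 0 1 t)\<^sup>2 * vector_derivative (circlepath 0 1) (at t within {0..1}) = c * (h (?e t) * inverse (?e t))"
    if "t \<in> {0..1}" for t
    using that by (subst vector_derivative_circlepath01) (auto simp: circlepath c_def power2_eq_square divide_inverse)
  have "((\<lambda>t. c * (h (?e t) * inverse (?e t))) has_integral (c * h')) {0..1}"
    by (rule has_integral_eq[OF eq I])
  then have "((\<lambda>t. inverse c * (c * (h (?e t) * inverse (?e t)))) has_integral (inverse c * (c * h'))) {0..1}"
    by (rule has_integral_mult_right)
  then have I2: "((\<lambda>t. h (?e t) * inverse (?e t)) has_integral h') {0..1}"
    using c0 by (simp add: mult.assoc[symmetric])
  have "((\<lambda>t. h (?e t) + (1/2) * (?e t * h (?e t) + h (?e t) * inverse (?e t))) has_integral (h 0 + (1/2) * (0 + h'))) {0..1}"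
    by (intro has_integral_add has_integral_mult_right I0 I1 I2)
  from has_integral_linear[OF this bounded_linear_Re]
  have "((\<lambda>t. Re (h (?e t) + (1/2) * (?e t * h (?e t) + h (?e t) * inverse (?e t)))) has_integral Re (h 0 + h' / 2)) {0..1}"
    by (simp add: o_def)
  then show ?thesis
  proof (rule has_integral_nonneg)
    fix t :: real
    have n1: "cmod (?e t) = 1" by (simp add: norm_exp)
    have "?e t * cnj (?e t) = of_real ((cmod (?e t))\<^sup>2)" by (rule complex_norm_square[symmetric])
    then have "?e t * cnj (?e t) = 1" unfolding n1 by simp
    then have "inverse (?e t) = cnj (?e t)" by (rule inverse_unique)
    then have "h (?e t) + (1/2) * (?e t * h (?e t) + h (?e t) * inverse (?e t)) = h (?e t) * (1 + of_real (Re (?e t)))"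
    proof -
      have "h z + (1/2) * (z * h z + h z * cnj z) = h z * (1 + of_real (Re z))" for z
      proof -
        have "h z + (1/2) * (z * h z + h z * cnj z) = h z * (1 + (z + cnj z) / 2)" by (simp add: algebra_simps)
        then show ?thesis by (simp add: complex_add_cnj)
      qed
      then show ?thesis using \<open>inverse (?e t) = cnj (?e t)\<close> by simp
    qed
    then have "Re (h (?e t) + (1/2) * (?e t * h (?e t) + h (?e t) * inverse (?e t))) = Re (h (?e t)) * (1 + Re (?e t))"
      by (simp add: algebra_simps)
    moreover have "Re (?e t) \<ge> -1" using abs_Re_le_cmod[of "?e t"] n1 by linarith
    moreover have "Re (h (?e t)) \<ge> 0" using pos n1 by simp
    ultimately show "0 \<le> Re (h (?e t) + (1/2) * (?e t * h (?e t) + h (?e t) * inverse (?e t)))" by simp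
  qed
qed

text \<open>
  The complex linear functional whose real part is the inner product with \<open>a\<close>.
\<close>

definition herm_pair :: "complex ^ 'n \<Rightarrow> complex ^ 'n \<Rightarrow> complex" where
  "herm_pair a x = (\<Sum>i\<in>UNIV. cnj (a $ i) * x $ i)"

lemma Re_herm_pair: "Re (herm_pair a x) = a \<bullet> x"
  by (simp add: herm_pair_def inner_vec_def inner_complex_def)

lemma herm_pair_scale: "herm_pair a (c *s x) = c * herm_pair a x"
  by (simp add: herm_pair_def sum_distrib_left mult_ac)

lemma herm_pair_linear: "linear (herm_pair a)"
  by (rule linearI) (simp_all add: herm_pair_def distrib_left sum.distrib scaleR_sum_right)

lemma herm_pair_bounded_linear: "bounded_linear (herm_pair a)"
  using herm_pair_linear by (simp add: linear_conv_bounded_linear)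

lemma open_polydisc: "open (polydisc :: (complex ^ 'q) set)"
proof -
  have e: "polydisc = (\<Inter>i\<in>UNIV. {z::complex ^ 'q. cmod (z $ i) < 1})" by (auto simp: polydisc_def)
  have o: "open {z::complex ^ 'q. cmod (z $ i) < 1}" for i
    by (intro open_Collect_less continuous_intros)
  show ?thesis unfolding e by (rule open_INT) (use o in auto)
qed

lemma holomorphic_map_on_derivative:
  assumes "holomorphic_map_on F U" "z \<in> U"
  obtains L where "(F has_derivative L) (at z)" "\<And>c v. L (c *s v) = c *s L v"
proof -
  have "\<forall>i. \<exists>L. ((\<lambda>z. F z $ i) has_derivative L) (at z) \<and> (\<forall>c v. L (c *s v) = c * L v)"
    using assms unfolding holomorphic_map_on_def holomorphic_fun_on_def by blast
  from choice[OF this] obtain L where L: "\<And>i. ((\<lambda>z. F z $ i) has_derivative L i) (at z)"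
    "\<And>i c v. L i (c *s v) = c * L i v" by blast
  have "(F has_derivative (\<lambda>v. \<chi> i. L i v)) (at z)"
  proof -
    have "((\<lambda>x. F x \<bullet> b) has_derivative (\<lambda>v. (\<chi> i. L i v) \<bullet> b)) (at z)" if b: "b \<in> Basis" for b
    proof -
      obtain i u where u: "b = axis i u" using b by (auto simp: Basis_vec_def)
      show ?thesis unfolding u inner_axis by (simp add: has_derivative_inner_left[OF L(1)])
    qed
    then show ?thesis by (subst has_derivative_componentwise_within) blast
  qed
  then show ?thesis by (rule that) (simp add: L(2) vec_eq_iff)
qed

text \<open>
  If \<open>\<psi> z0 + L w / 2\<close> were outside, the complex form of a separating functional, composed with \<open>\<psi>\<close> on the disc
  \<open>z0 + \<zeta> *s w\<close> and normalized, would have positive real part and contradict \<open>positive_real_part_derivative\<close>.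
\<close>

lemma tangent_disc_in_closure:
  fixes \<psi> :: "complex ^ 'q \<Rightarrow> complex ^ 'n"
  assumes conv: "convex \<Omega>" and hol: "holomorphic_map_on \<psi> polydisc" and im: "\<psi> ` polydisc \<subseteq> closure \<Omega>"
    and z0: "z0 \<in> polydisc" and L: "(\<psi> has_derivative L) (at z0)" and Ls: "\<And>c v. L (c *s v) = c *s L v"
  shows "\<exists>\<rho>>0. \<forall>w. norm w \<le> \<rho> \<longrightarrow> \<psi> z0 + L w \<in> closure \<Omega>"
proof -
  obtain r where r: "r > 0" "cball z0 r \<subseteq> polydisc"
    using open_polydisc z0 open_contains_cball by blast
  have lL: "linear L" using L by (rule has_derivative_linear)
  have main: "\<psi> z0 + (1/2) *\<^sub>R L w \<in> closure \<Omega>" if w: "norm w \<le> r" for w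
  proof (rule ccontr)
    assume n: "\<psi> z0 + (1/2) *\<^sub>R L w \<notin> closure \<Omega>"
    obtain a b where a: "a \<bullet> (\<psi> z0 + (1/2) *\<^sub>R L w) < b" "\<forall>x\<in>closure \<Omega>. b < a \<bullet> x"
      using separating_hyperplane_closed_point[OF convex_closure[OF conv] closed_closure n] by blast
    define h where "h \<zeta> = herm_pair a (\<psi> (z0 + \<zeta> *s w)) - of_real b" for \<zeta>
    have inP: "z0 + \<zeta> *s w \<in> polydisc" if "\<zeta> \<in> cball 0 1" for \<zeta>
    proof -
      have "norm (\<zeta> *s w) \<le> 1 * r" unfolding norm_vscale using that w by (intro mult_mono) auto
      then show ?thesis using r(2) by (auto simp: dist_norm)
    qed
    have hol_h: "h holomorphic_on cball 0 1"
      unfolding h_def herm_pair_def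
      by (intro holomorphic_intros holomorphic_fun_on_line[where f="\<lambda>z. \<psi> z $ _" and U=polydisc] inP)
         (use hol in \<open>auto simp: holomorphic_map_on_def\<close>)
    have dh: "(h has_field_derivative herm_pair a (L w)) (at 0)"
    proof -
      note has_derivative_line[of z0 w 0]
      moreover have "(\<psi> has_derivative L) (at (z0 + 0 *s w))" using L by simp
      ultimately have "((\<lambda>\<zeta>. \<psi> (z0 + \<zeta> *s w)) has_derivative (\<lambda>h. L (h *s w))) (at 0)"
        by (rule has_derivative_compose)
      from bounded_linear.has_derivative[OF herm_pair_bounded_linear this]
      have "((\<lambda>\<zeta>. herm_pair a (\<psi> (z0 + \<zeta> *s w))) has_derivative (\<lambda>h. herm_pair a (L (h *s w)))) (at 0)" .
      then have "(h has_derivative (\<lambda>h. herm_pair a (L (h *s w)))) (at 0)"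
        unfolding h_def by (auto intro!: derivative_eq_intros)
      moreover have "(\<lambda>h. herm_pair a (L (h *s w))) = (*) (herm_pair a (L w))"
        by (simp add: fun_eq_iff Ls herm_pair_scale)
      ultimately show ?thesis by (simp add: has_field_derivative_def)
    qed
    have "0 \<le> Re (h 0 + herm_pair a (L w) / 2)"
    proof (rule positive_real_part_derivative[OF hol_h dh])
      fix \<zeta> :: complex assume "\<zeta> \<in> cball 0 1"
      then have "\<psi> (z0 + \<zeta> *s w) \<in> closure \<Omega>" using inP im by blast
      then have "b < a \<bullet> \<psi> (z0 + \<zeta> *s w)" using a(2) by blast
      then show "0 \<le> Re (h \<zeta>)" by (simp add: h_def Re_herm_pair)
    qed
    then show False using a(1) by (simp add: h_def Re_herm_pair inner_add_right)
  qed
  have "\<psi> z0 + L w \<in> closure \<Omega>" if "norm w \<le> r / 2" for w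
    using main[of "2 *\<^sub>R w"] that by (simp add: linear_scale[OF lL])
  then show ?thesis using r(1) by (intro exI[of _ "r/2"]) auto
qed

lemma supporting_functional:
  fixes \<Omega> :: "(complex ^ 'n) set"
  assumes "open \<Omega>" "convex \<Omega>" "p \<in> frontier \<Omega>"
  obtains a where "\<And>x. x \<in> \<Omega> \<Longrightarrow> 0 < Re (herm_pair a (x - p))"
proof -
  have ri: "rel_interior \<Omega> = \<Omega>" using assms(1) by (rule rel_interior_open)
  have "p \<in> closure \<Omega>" "p \<notin> rel_interior \<Omega>"
    using assms unfolding ri frontier_def by (auto simp: interior_open)
  from supporting_hyperplane_relative_frontier[OF assms(2) this] obtain a where
    "\<And>y. y \<in> rel_interior \<Omega> \<Longrightarrow> a \<bullet> p < a \<bullet> y" by metis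
  then show ?thesis using that[of a] unfolding ri by (simp add: Re_herm_pair inner_diff_right)
qed

section \<open>Evaluation norms\<close>

definition bounded_holomorphic :: "(complex ^ 'n) set \<Rightarrow> (complex ^ 'n \<Rightarrow> complex) set" where
  "bounded_holomorphic \<Omega> = {f. holomorphic_fun_on f \<Omega> \<and> bounded (f ` \<Omega>)}"

definition sq_mass :: "(complex ^ 'n) set \<Rightarrow> (complex ^ 'n \<Rightarrow> complex) \<Rightarrow> real" where
  "sq_mass \<Omega> f = (LINT z|lebesgue_on \<Omega>. (cmod (f z))\<^sup>2)"

lemma sq_mass_nonneg: "0 \<le> sq_mass \<Omega> f"
  unfolding sq_mass_def by (rule Bochner_Integration.integral_nonneg) auto

lemma sqint_bounded_continuous:
  fixes f :: "complex ^ 'n \<Rightarrow> complex"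
  assumes \<Omega>: "open \<Omega>" "bounded \<Omega>" and f: "continuous_on \<Omega> f" "bounded (f ` \<Omega>)"
  shows "sqint (lebesgue_on \<Omega>) f"
proof -
  interpret finite_measure "lebesgue_on \<Omega>" by (rule finite_measure_lebesgue_on_bounded[OF \<Omega>])
  have m: "f \<in> borel_measurable (lebesgue_on \<Omega>)"
    using \<Omega> f by (intro continuous_imp_measurable_on_sets_lebesgue) auto
  obtain B where B: "\<And>x. x \<in> \<Omega> \<Longrightarrow> cmod (f x) \<le> B" using f(2) by (auto simp: bounded_iff)
  have "(\<lambda>z. (cmod (f z))\<^sup>2) \<in> borel_measurable (lebesgue_on \<Omega>)"
    by (rule measurable_compose[OF m]) simp
  then have "integrable (lebesgue_on \<Omega>) (\<lambda>z. (cmod (f z))\<^sup>2)"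
    by (rule integrable_const_bound[of _ "B\<^sup>2", rotated]) (auto intro!: AE_I2 power_mono B)
  with m show ?thesis by (simp add: sqint_def)
qed

lemma bounded_holomorphic_sqint:
  assumes "open \<Omega>" "bounded \<Omega>" "f \<in> bounded_holomorphic \<Omega>"
  shows "sqint (lebesgue_on \<Omega>) f"
  using assms by (intro sqint_bounded_continuous) (auto simp: bounded_holomorphic_def holomorphic_fun_on_imp_continuous_on)

lemma holomorphic_fun_on_diff:
  "holomorphic_fun_on f U \<Longrightarrow> holomorphic_fun_on g U \<Longrightarrow> holomorphic_fun_on (\<lambda>z. f z - g z) U"
  unfolding holomorphic_fun_on_def
proof
  fix z assume "\<forall>z\<in>U. \<exists>L. (f has_derivative L) (at z) \<and> (\<forall>c v. L (c *s v) = c * L v)"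
    "\<forall>z\<in>U. \<exists>L. (g has_derivative L) (at z) \<and> (\<forall>c v. L (c *s v) = c * L v)" "z \<in> U"
  then obtain L M where L: "(f has_derivative L) (at z)" "\<forall>c v. L (c *s v) = c * L v"
    and M: "(g has_derivative M) (at z)" "\<forall>c v. M (c *s v) = c * M v" by blast
  then show "\<exists>L. ((\<lambda>z. f z - g z) has_derivative L) (at z) \<and> (\<forall>c v. L (c *s v) = c * L v)"
    by (intro exI[of _ "\<lambda>v. L v - M v"]) (auto intro: has_derivative_diff simp: right_diff_distrib)
qed

lemma bounded_holomorphic_diff:
  assumes "f \<in> bounded_holomorphic \<Omega>" "g \<in> bounded_holomorphic \<Omega>"
  shows "(\<lambda>z. f z - g z) \<in> bounded_holomorphic \<Omega>"
proof -
  obtain B C where B: "\<And>x. x \<in> \<Omega> \<Longrightarrow> cmod (f x) \<le> B" and C: "\<And>x. x \<in> \<Omega> \<Longrightarrow> cmod (g x) \<le> C"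
    using assms by (auto simp: bounded_holomorphic_def bounded_iff)
  have "cmod (f x - g x) \<le> B + C" if "x \<in> \<Omega>" for x
    using norm_triangle_ineq4[of "f x" "g x"] B[OF that] C[OF that] by linarith
  then have "bounded ((\<lambda>z. f z - g z) ` \<Omega>)" by (auto simp: bounded_iff)
  then show ?thesis using assms holomorphic_fun_on_diff by (auto simp: bounded_holomorphic_def)
qed

lemma holomorphic_fun_on_cmult:
  assumes "holomorphic_fun_on f U" shows "holomorphic_fun_on (\<lambda>z. k * f z) U"
  unfolding holomorphic_fun_on_def
proof
  fix z assume "z \<in> U"
  then obtain L where L: "(f has_derivative L) (at z)" "\<forall>c v. L (c *s v) = c * L v"
    using assms unfolding holomorphic_fun_on_def by blast
  then show "\<exists>L. ((\<lambda>z. k * f z) has_derivative L) (at z) \<and> (\<forall>c v. L (c *s v) = c * L v)"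
    by (intro exI[of _ "\<lambda>v. k * L v"]) (auto intro: has_derivative_mult_right)
qed

lemma bounded_holomorphic_cmult:
  assumes "f \<in> bounded_holomorphic \<Omega>" shows "(\<lambda>z. k * f z) \<in> bounded_holomorphic \<Omega>"
proof -
  obtain B where B: "\<And>x. x \<in> \<Omega> \<Longrightarrow> cmod (f x) \<le> B"
    using assms by (auto simp: bounded_holomorphic_def bounded_iff)
  have "cmod (k * f x) \<le> cmod k * B" if "x \<in> \<Omega>" for x
    unfolding norm_mult by (rule mult_left_mono[OF B[OF that]]) simp
  then have "bounded ((\<lambda>z. k * f z) ` \<Omega>)" by (auto simp: bounded_iff)
  then show ?thesis using assms holomorphic_fun_on_cmult by (auto simp: bounded_holomorphic_def)
qed

lemma bounded_holomorphic_affine: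
  assumes f: "f \<in> bounded_holomorphic \<Omega>" and sub: "\<And>w. w \<in> \<Omega> \<Longrightarrow> a + c *\<^sub>R w \<in> \<Omega>"
  shows "(\<lambda>w. f (a + c *\<^sub>R w)) \<in> bounded_holomorphic \<Omega>"
proof -
  have "holomorphic_fun_on (\<lambda>w. f (a + c *\<^sub>R w)) \<Omega>"
    unfolding holomorphic_fun_on_def
  proof
    fix z assume "z \<in> \<Omega>"
    then obtain L where L: "(f has_derivative L) (at (a + c *\<^sub>R z))" "\<forall>k v. L (k *s v) = k * L v"
      using f sub unfolding bounded_holomorphic_def holomorphic_fun_on_def by blast
    have "((\<lambda>w. a + c *\<^sub>R w) has_derivative (\<lambda>v. c *\<^sub>R v)) (at z)" by (auto intro!: derivative_eq_intros)
    from has_derivative_compose[OF this L(1)]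
    have "((\<lambda>w. f (a + c *\<^sub>R w)) has_derivative (\<lambda>v. L (c *\<^sub>R v))) (at z)" .
    moreover have "L (c *\<^sub>R (k *s v)) = k * L (c *\<^sub>R v)" for k v
    proof -
      have "c *\<^sub>R (k *s v) = k *s (c *\<^sub>R v)" by (simp add: vec_eq_iff)
      then show ?thesis using L(2) by simp
    qed
    ultimately show "\<exists>L. ((\<lambda>w. f (a + c *\<^sub>R w)) has_derivative L) (at z) \<and> (\<forall>k v. L (k *s v) = k * L v)" by blast
  qed
  moreover have "bounded ((\<lambda>w. f (a + c *\<^sub>R w)) ` \<Omega>)"
  proof (rule bounded_subset)
    show "bounded (f ` \<Omega>)" using f by (simp add: bounded_holomorphic_def)
  qed (use sub in auto)
  ultimately show ?thesis by (simp add: bounded_holomorphic_def)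
qed

lemma sq_mass_eq_lborel:
  assumes \<Omega>: "open \<Omega>" and f: "continuous_on \<Omega> f"
  shows "(\<lambda>z. indicator \<Omega> z * (cmod (f z))\<^sup>2) \<in> borel_measurable borel"
    and "sq_mass \<Omega> f = (LINT z|lborel. indicator \<Omega> z * (cmod (f z))\<^sup>2)"
proof -
  have "continuous_on \<Omega> (\<lambda>z. (cmod (f z))\<^sup>2)" by (intro continuous_intros f)
  then have "(\<lambda>z. indicator \<Omega> z *\<^sub>R (cmod (f z))\<^sup>2) \<in> borel_measurable borel"
    using \<Omega> by (intro borel_measurable_continuous_on_indicator) auto
  then show m: "(\<lambda>z. indicator \<Omega> z * (cmod (f z))\<^sup>2) \<in> borel_measurable borel" by simp
  have "sq_mass \<Omega> f = (LINT z|lebesgue_on \<Omega>. indicator \<Omega> z * (cmod (f z))\<^sup>2)"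
    unfolding sq_mass_def by (rule Bochner_Integration.integral_cong) auto
  also have "\<dots> = (LINT z|lborel. indicator \<Omega> z * (cmod (f z))\<^sup>2)"
    by (rule integral_lebesgue_on_eq_lborel(1)[OF \<Omega> m]) simp
  finally show "sq_mass \<Omega> f = (LINT z|lborel. indicator \<Omega> z * (cmod (f z))\<^sup>2)" .
qed

text \<open>
  Transfers mass on a homothetic copy to a function on the domain itself, to which the evaluation norm applies.
\<close>

lemma sq_mass_homothety:
  fixes f :: "complex ^ 'n \<Rightarrow> complex"
  assumes \<Omega>: "open \<Omega>" and c: "c > 0" and f: "continuous_on ((\<lambda>w. a + c *\<^sub>R w) ` \<Omega>) f"
  shows "sq_mass ((\<lambda>w. a + c *\<^sub>R w) ` \<Omega>) f = c ^ DIM(complex ^ 'n) * sq_mass \<Omega> (\<lambda>w. f (a + c *\<^sub>R w))"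
proof -
  let ?T = "\<lambda>w. a + c *\<^sub>R w"
  have TO: "open (?T ` \<Omega>)" using open_affinity[OF \<Omega>, of c a] c by simp
  have f': "continuous_on \<Omega> (\<lambda>w. f (?T w))"
    by (rule continuous_on_compose2[OF f]) (auto intro!: continuous_intros)
  have i: "indicat_real (?T ` \<Omega>) (?T w) = indicator \<Omega> w" for w
    using c by (auto simp: indicator_def image_iff)
  have "sq_mass (?T ` \<Omega>) f = \<bar>c\<bar> ^ DIM(complex ^ 'n) * (LINT w|lborel. indicator (?T ` \<Omega>) (?T w) * (cmod (f (?T w)))\<^sup>2)"
    unfolding sq_mass_eq_lborel(2)[OF TO f]
    by (rule integral_lborel_affine) (use c sq_mass_eq_lborel(1)[OF TO f] in auto)
  also have "\<dots> = c ^ DIM(complex ^ 'n) * sq_mass \<Omega> (\<lambda>w. f (?T w))"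
    using c unfolding sq_mass_eq_lborel(2)[OF \<Omega> f'] i by simp
  finally show ?thesis .
qed

text \<open>
  The value at \<open>a\<close> is an average with a bump supported in a ball, hence bounded by the $L^1$ norm, and the
  domain has finite volume.
\<close>

lemma bounded_point_evaluation:
  fixes \<Omega> :: "(complex ^ 'n) set"
  assumes \<Omega>: "open \<Omega>" "bounded \<Omega>" and a: "a \<in> \<Omega>"
  shows "\<exists>C\<ge>0. \<forall>f\<in>bounded_holomorphic \<Omega>. cmod (f a) \<le> C * sqrt (sq_mass \<Omega> f)"
proof -
  interpret finite_measure "lebesgue_on \<Omega>" by (rule finite_measure_lebesgue_on_bounded[OF \<Omega>])
  obtain r where r: "r > 0" "cball a r \<subseteq> \<Omega>" using \<Omega>(1) a open_contains_cball by blast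
  define A :: "complex ^ 'n \<Rightarrow> complex ^ 'n" where "A w = (1 / r) *\<^sub>R w" for w
  have A: "complex_iso A"
    unfolding complex_iso_def A_def using r by (auto intro!: linearI inj_onI simp: algebra_simps vec_eq_iff)
  have sub: "a + w \<in> \<Omega>" if "w \<in> ellipsoid A" for w
  proof -
    have "norm w \<le> r" using that r by (simp add: ellipsoid_def A_def)
    then show ?thesis using r(2) by (auto simp: dist_norm)
  qed
  obtain c where c: "(LINT w|lborel. bump A 0 w) = complex_of_real c"
    "exp (- 4 / 3) / 2 ^ DIM(complex ^ 'n) * measure lborel (ellipsoid A) \<le> c"
    using bump_integral_lower_bound[OF A] by blast
  have "0 < exp (- 4 / 3) / 2 ^ DIM(complex ^ 'n) * measure lborel (ellipsoid A)"
    using measure_ellipsoid_pos[OF A] by simp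
  then have c0: "c > 0" using c(2) by linarith
  let ?m = "measure (lebesgue_on \<Omega>) (space (lebesgue_on \<Omega>))"
  have main: "cmod (f a) * c \<le> \<delta> * ?m + sq_mass \<Omega> f / \<delta>" if f: "f \<in> bounded_holomorphic \<Omega>" and d: "\<delta> > 0" for f \<delta>
  proof -
    have hf: "holomorphic_fun_on f \<Omega>" using f by (simp add: bounded_holomorphic_def)
    have s: "sqint (lebesgue_on \<Omega>) f" by (rule bounded_holomorphic_sqint[OF \<Omega> f])
    note mv = bump_mean_value[OF A sub hf]
    have z: "f x * bump A a x = 0" if "x \<notin> \<Omega>" for x
      using bump_eq_0[of x a A] sub[of "x - a"] that by auto
    have mb: "(\<lambda>x. f x * bump A a x) \<in> borel_measurable borel" using mv(2) by simp
    have "(LINT x|lebesgue_on \<Omega>. f x * bump A a x) = (LINT x|lborel. f x * bump A a x)"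
      by (rule integral_lebesgue_on_eq_lborel(1)[OF \<Omega>(1) mb z])
    also have "\<dots> = f a * complex_of_real c" using mv(1) c(1) by simp
    finally have "cmod (f a) * c = cmod (LINT x|lebesgue_on \<Omega>. f x * bump A a x)"
      using c0 by (simp add: norm_mult)
    also have "\<dots> \<le> (LINT x|lebesgue_on \<Omega>. cmod (f x * bump A a x))" by (rule integral_norm_bound)
    also have "\<dots> \<le> (LINT x|lebesgue_on \<Omega>. cmod (f x))"
    proof (rule integral_mono)
      show "integrable (lebesgue_on \<Omega>) (\<lambda>x. cmod (f x * bump A a x))"
        using integral_lebesgue_on_eq_lborel(2)[OF \<Omega>(1) mb z] mv(2) by (intro integrable_norm) simp
      show "integrable (lebesgue_on \<Omega>) (\<lambda>x. cmod (f x))" by (intro integrable_norm sqint_imp_integrable s)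
      fix x
      have "cmod (bump A a x) \<le> 1" by (rule order_trans[OF norm_bump_le]) (simp add: indicator_def)
      then show "cmod (f x * bump A a x) \<le> cmod (f x)" unfolding norm_mult by (rule mult_left_le[OF _ norm_ge_zero])
    qed
    also have "\<dots> \<le> \<delta> * ?m + sq_mass \<Omega> f / \<delta>" unfolding sq_mass_def by (rule integral_cmod_le[OF s d])
    finally show ?thesis .
  qed
  have "cmod (f a) \<le> ((?m + 1) / c) * sqrt (sq_mass \<Omega> f)" if f: "f \<in> bounded_holomorphic \<Omega>" for f
  proof -
    \<comment> \<open>\<open>\<delta> = sqrt (sq_mass \<Omega> f)\<close> balances the two terms of \<open>main\<close>; if it vanishes, \<open>\<delta>\<close> may tend to 0\<close>
    have "cmod (f a) * c \<le> (?m + 1) * sqrt (sq_mass \<Omega> f)"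
    proof (cases "sq_mass \<Omega> f = 0")
      case False
      then have p: "sq_mass \<Omega> f > 0" using sq_mass_nonneg[of \<Omega> f] by simp
      then have "sqrt (sq_mass \<Omega> f) > 0" by simp
      from main[OF f this] show ?thesis using p by (simp add: real_div_sqrt algebra_simps)
    next
      case True
      have "cmod (f a) * c \<le> 0 + e" if e: "e > 0" for e
      proof -
        have m0: "?m \<ge> 0" by simp
        have "cmod (f a) * c \<le> e / (?m + 1) * ?m" using main[OF f, of "e / (?m + 1)"] e m0 True by (simp add: add_nonneg_pos)
        moreover have "e / (?m + 1) * ?m = e * (?m / (?m + 1))" by simp
        moreover have "?m / (?m + 1) \<le> 1" using m0 by (subst divide_le_eq_1) linarith
        then have "e * (?m / (?m + 1)) \<le> e * 1" using e by (intro mult_left_mono) auto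
        ultimately show ?thesis by linarith
      qed
      then have "cmod (f a) * c \<le> 0" by (rule field_le_epsilon)
      then show ?thesis using True by simp
    qed
    then show ?thesis using c0 by (simp add: pos_le_divide_eq)
  qed
  moreover have "(?m + 1) / c \<ge> 0" using c0 by simp
  ultimately show ?thesis by blast
qed

text \<open>
  \<open>K\<close> is the supremum of \<open>cmod (f a)\<close> over the unit ball; the factor 2 leaves room for a supremum that is not attained.
\<close>

lemma evaluation_norm_exists:
  fixes \<Omega> :: "(complex ^ 'n) set"
  assumes \<Omega>: "open \<Omega>" "bounded \<Omega>" and a: "a \<in> \<Omega>"
  shows "\<exists>K>0. (\<forall>f\<in>bounded_holomorphic \<Omega>. cmod (f a) \<le> K * sqrt (sq_mass \<Omega> f))
     \<and> (\<exists>g\<in>bounded_holomorphic \<Omega>. sq_mass \<Omega> g \<le> 1 \<and> K / 2 \<le> cmod (g a))"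
proof -
  let ?B = "bounded_holomorphic \<Omega>"
  define S where "S = (\<lambda>f. cmod (f a)) ` {f\<in>?B. sq_mass \<Omega> f \<le> 1}"
  obtain C where C: "C \<ge> 0" "\<And>f. f \<in> ?B \<Longrightarrow> cmod (f a) \<le> C * sqrt (sq_mass \<Omega> f)"
    using bounded_point_evaluation[OF assms] by blast
  have bdd: "bdd_above S"
  proof (rule bdd_aboveI)
    fix x assume "x \<in> S"
    then obtain f where f: "f \<in> ?B" "sq_mass \<Omega> f \<le> 1" "x = cmod (f a)" by (auto simp: S_def)
    have "C * sqrt (sq_mass \<Omega> f) \<le> C * 1" using C(1) f(2) by (intro mult_left_mono) auto
    then show "x \<le> C" using C(2)[OF f(1)] f(3) by simp
  qed
  define K where "K = Sup S"
  have inS: "cmod (f a) \<le> K" if "f \<in> ?B" "sq_mass \<Omega> f \<le> 1" for f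
    unfolding K_def by (rule cSup_upper[OF _ bdd]) (use that in \<open>auto simp: S_def\<close>)
  have scale: "sq_mass \<Omega> (\<lambda>z. k * f z) = (cmod k)\<^sup>2 * sq_mass \<Omega> f" for k f
    by (simp add: sq_mass_def norm_mult power_mult_distrib)
  have one: "(\<lambda>z. 1) \<in> ?B"
    by (auto simp: bounded_holomorphic_def holomorphic_fun_on_def bounded_iff intro!: exI[of _ "\<lambda>_. 0"])
  have bound: "cmod (f a) \<le> K * sqrt (sq_mass \<Omega> f)" if f: "f \<in> ?B" for f
  proof (cases "sq_mass \<Omega> f = 0")
    case True
    then show ?thesis using C(2)[OF f] by simp
  next
    case False
    then have p: "sq_mass \<Omega> f > 0" using sq_mass_nonneg[of \<Omega> f] by simp
    define k where "k = complex_of_real (1 / sqrt (sq_mass \<Omega> f))"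
    have "cmod k = 1 / sqrt (sq_mass \<Omega> f)" using p by (simp add: k_def norm_divide)
    moreover then have "sq_mass \<Omega> (\<lambda>z. k * f z) \<le> 1" using p unfolding scale by (simp add: power_divide)
    ultimately have "1 / sqrt (sq_mass \<Omega> f) * cmod (f a) \<le> K"
      using inS[OF bounded_holomorphic_cmult[OF f]] by (metis norm_mult)
    then show ?thesis using p by (simp add: divide_le_eq)
  qed
  have Kpos: "K > 0"
  proof (rule ccontr)
    assume "\<not> K > 0"
    then have "K * sqrt (sq_mass \<Omega> (\<lambda>z. 1)) \<le> 0" by (intro mult_nonpos_nonneg) (auto simp: sq_mass_nonneg)
    then show False using bound[OF one] by simp
  qed
  have "K / 2 < Sup S" using Kpos by (simp add: K_def)
  moreover have "S \<noteq> {}"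
  proof -
    have "(\<lambda>z. 0 * (1::complex)) \<in> ?B" using bounded_holomorphic_cmult[OF one, of 0] .
    then have "cmod ((\<lambda>z. 0 * (1::complex)) a) \<in> S" unfolding S_def by (intro imageI) (simp add: sq_mass_def)
    then show ?thesis by blast
  qed
  ultimately obtain x where x: "x \<in> S" "K / 2 < x" using less_cSupD[of S] by blast
  then obtain g where "g \<in> ?B" "sq_mass \<Omega> g \<le> 1" "K / 2 \<le> cmod (g a)" by (auto simp: S_def)
  then show ?thesis using Kpos bound by blast
qed

text \<open>
  With the linear functional \<open>l = herm_pair b\<close> the functions \<open>t / (t + l (x - p))\<close> are bounded by 1 on the domain and tend to 0 pointwise as
  \<open>t\<close> tends to 0, so their mass tends to 0, while the value at \<open>p + t (a0 - p)\<close> does not depend on \<open>t\<close>.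
\<close>

lemma evaluation_norm_blowup:
  fixes \<Omega> :: "(complex ^ 'n) set"
  assumes \<Omega>: "open \<Omega>" "bounded \<Omega>" and b: "\<And>x. x \<in> \<Omega> \<Longrightarrow> 0 < Re (herm_pair b (x - p))"
    and a0: "a0 \<in> \<Omega>" and t: "\<And>k. t k > 0" "t \<longlonglongrightarrow> 0" and a: "\<And>k. p + t k *\<^sub>R (a0 - p) \<in> \<Omega>"
    and K: "\<And>k f. f \<in> bounded_holomorphic \<Omega> \<Longrightarrow> cmod (f (p + t k *\<^sub>R (a0 - p))) \<le> K k * sqrt (sq_mass \<Omega> f)"
  shows "\<forall>B. \<forall>\<^sub>F k in sequentially. B < K (k::nat)"
proof -
  interpret finite_measure "lebesgue_on \<Omega>" by (rule finite_measure_lebesgue_on_bounded[OF \<Omega>])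
  define f where "f k x = complex_of_real (t k) / (complex_of_real (t k) + herm_pair b (x - p))" for k x
  have den: "cmod (complex_of_real (t k) + herm_pair b (x - p)) > t k" if "x \<in> \<Omega>" for k x
    using complex_Re_le_cmod[of "complex_of_real (t k) + herm_pair b (x - p)"] b[OF that] by simp
  have den0: "complex_of_real (t k) + herm_pair b (x - p) \<noteq> 0" if "x \<in> \<Omega>" for k x
    using den[OF that, of k] t(1)[of k] by auto
  have le1: "cmod (f k x) \<le> 1" if "x \<in> \<Omega>" for k x
    using den[OF that, of k] t(1)[of k] by (simp add: f_def norm_divide divide_le_eq)
  have fB: "f k \<in> bounded_holomorphic \<Omega>" for k
  proof -
    have "\<exists>L. (f k has_derivative L) (at x) \<and> (\<forall>c v. L (c *s v) = c * L v)" if x: "x \<in> \<Omega>" for x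
    proof -
      have "((\<lambda>x. x - p) has_derivative (\<lambda>v. v)) (at x)" by (auto intro!: derivative_eq_intros)
      from bounded_linear.has_derivative[OF herm_pair_bounded_linear this]
      have "((\<lambda>x. complex_of_real (t k) + herm_pair b (x - p)) has_derivative (\<lambda>v. herm_pair b v)) (at x)"
        by (auto intro!: derivative_eq_intros)
      from has_derivative_divide[OF has_derivative_const[of "complex_of_real (t k)"] this] den0[OF x]
      have "(f k has_derivative (\<lambda>v. - complex_of_real (t k) * (inverse (complex_of_real (t k) + herm_pair b (x - p)) * herm_pair b v * inverse (complex_of_real (t k) + herm_pair b (x - p))) + 0 / (complex_of_real (t k) + herm_pair b (x - p)))) (at x)"
        unfolding f_def[abs_def] by simp
      then show ?thesis by (intro exI conjI) (auto simp: herm_pair_scale)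
    qed
    moreover have "bounded (f k ` \<Omega>)" by (rule boundedI[of _ 1]) (use le1 in auto)
    ultimately show ?thesis by (auto simp: bounded_holomorphic_def holomorphic_fun_on_def)
  qed
  have "(\<lambda>k. LINT x|lebesgue_on \<Omega>. (cmod (f k x))\<^sup>2) \<longlonglongrightarrow> (LINT x|lebesgue_on \<Omega>. 0)"
  proof (rule integral_dominated_convergence[where w="\<lambda>_. 1"])
    show "AE x in lebesgue_on \<Omega>. (\<lambda>k. (cmod (f k x))\<^sup>2) \<longlonglongrightarrow> 0"
    proof (rule AE_I2)
      fix x assume "x \<in> space (lebesgue_on \<Omega>)"
      then have x: "x \<in> \<Omega>" by simp
      have "herm_pair b (x - p) \<noteq> 0" using b[OF x] by auto
      then have "(\<lambda>k. (cmod (f k x))\<^sup>2) \<longlonglongrightarrow> (cmod (complex_of_real 0 / (complex_of_real 0 + herm_pair b (x - p))))\<^sup>2"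
        unfolding f_def by (intro tendsto_intros t(2)) auto
      then show "(\<lambda>k. (cmod (f k x))\<^sup>2) \<longlonglongrightarrow> 0" by simp
    qed
    show "AE x in lebesgue_on \<Omega>. norm ((cmod (f k x))\<^sup>2) \<le> 1" for k
      by (intro AE_I2) (use le1[of _ k] in \<open>auto simp: power_le_one\<close>)
    show "(\<lambda>x. (cmod (f k x))\<^sup>2) \<in> borel_measurable (lebesgue_on \<Omega>)" for k
      using sqint_integrable[OF bounded_holomorphic_sqint[OF \<Omega> fB]] by (rule borel_measurable_integrable)
  qed auto
  then have lim: "(\<lambda>k. sq_mass \<Omega> (f k)) \<longlonglongrightarrow> 0" by (simp add: sq_mass_def)
  define \<mu> where "\<mu> = herm_pair b (a0 - p)"
  have mu: "Re \<mu> > 0" using b[OF a0] by (simp add: \<mu>_def)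
  define d where "d = cmod (1 / (1 + \<mu>))"
  have "Re (1 + \<mu>) \<noteq> 0" using mu by simp
  then have "1 + \<mu> \<noteq> 0" by (metis zero_complex.sel(1))
  then have d: "d > 0" by (simp add: d_def)
  have val: "cmod (f k (p + t k *\<^sub>R (a0 - p))) = d" for k
  proof -
    have "herm_pair b ((p + t k *\<^sub>R (a0 - p)) - p) = of_real (t k) * \<mu>"
      using linear_scale[OF herm_pair_linear, of b "t k" "a0 - p"] by (simp add: \<mu>_def scaleR_conv_of_real)
    then have "f k (p + t k *\<^sub>R (a0 - p)) = of_real (t k) / (of_real (t k) * (1 + \<mu>))"
      unfolding f_def by (simp add: algebra_simps)
    also have "\<dots> = 1 / (1 + \<mu>)" using t(1)[of k] by simp
    finally show ?thesis by (simp add: d_def)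
  qed
  show ?thesis
  proof
    fix B :: real
    define B' where "B' = \<bar>B\<bar> + 1"
    have B': "B' > 0" "B < B'" by (auto simp: B'_def)
    have "\<forall>\<^sub>F k in sequentially. sq_mass \<Omega> (f k) < (d / B')\<^sup>2"
      using order_tendstoD(2)[OF lim, of "(d / B')\<^sup>2"] d B' by simp
    then show "\<forall>\<^sub>F k in sequentially. B < K k"
    proof eventually_elim
      case (elim k)
      have "sqrt (sq_mass \<Omega> (f k)) < d / B'"
        using real_sqrt_less_mono[OF elim] d B' by simp
      have dK: "d \<le> K k * sqrt (sq_mass \<Omega> (f k))" using K[OF fB, of k k] val by simp
      have "K k > 0"
      proof (rule ccontr)
        assume "\<not> K k > 0"
        then have "K k * sqrt (sq_mass \<Omega> (f k)) \<le> 0" by (intro mult_nonpos_nonneg) (auto simp: sq_mass_nonneg)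
        then show False using dK d by simp
      qed
      then have "K k * sqrt (sq_mass \<Omega> (f k)) < K k * (d / B')" 
        using \<open>sqrt (sq_mass \<Omega> (f k)) < d / B'\<close> by (intro mult_strict_left_mono)
      then have "d < K k * (d / B')" using dK by linarith
      then have "d * B' < d * K k" using B' by (simp add: field_simps)
      then have "B' < K k" using d by simp
      then show ?case using B' by linarith
    qed
  qed
qed

section \<open>Testing the Hankel operator with bumps\<close>

text \<open>
  Evaluation on a frame is a linear combination of coefficients, and each coefficient of
  $\overline\partial\eta\wedge\kappa$ has integral 0 by the weak equation.
\<close>

lemma K2_pairing_zero:
  fixes \<kappa> :: "'n::{finite,linorder} form"
  assumes \<Omega>: "open \<Omega>" "bounded \<Omega>" and \<kappa>: "\<kappa> \<in> K2_forms p \<Omega>" and \<eta>: "test_function \<Omega> \<eta>"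
    and len: "length us = Suc p"
  shows "integrable (lebesgue_on \<Omega>) (\<lambda>z. contract_list us (wedge1 (\<lambda>k. dbar_partial k \<eta> z) (\<lambda>J. \<kappa> J z)) {})"
    and "(LINT z|lebesgue_on \<Omega>. contract_list us (wedge1 (\<lambda>k. dbar_partial k \<eta> z) (\<lambda>J. \<kappa> J z)) {}) = 0"
proof -
  obtain c where c: "\<And>F. contract_list us F {} = (\<Sum>K | card K = card ({}::'n set) + length us. c K * F K)"
    using contract_list_expand[of us "{}"] by blast
  let ?t = "\<lambda>K k z. \<kappa> (K - {k}) z * dbar_partial k \<eta> z"
  have e: "contract_list us (wedge1 (\<lambda>k. dbar_partial k \<eta> z) (\<lambda>J. \<kappa> J z)) {}
     = (\<Sum>K | card K = Suc p. c K * (\<Sum>k\<in>K. koszul_sign k K * ?t K k z))" for z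
    unfolding c wedge1_def by (simp add: len mult.commute[of "dbar_partial _ _ _"])
  have i: "integrable (lebesgue_on \<Omega>) (?t K k)" if "card K = Suc p" "k \<in> K" for K k
  proof (rule integrable_mult_dbar_partial[OF \<Omega> _ \<eta>])
    have "card (K - {k}) = p" using that by simp
    then show "sqint (lebesgue_on \<Omega>) (\<kappa> (K - {k}))" using \<kappa> by (auto simp: K2_forms_def L2_forms_iff)
  qed
  show "integrable (lebesgue_on \<Omega>) (\<lambda>z. contract_list us (wedge1 (\<lambda>k. dbar_partial k \<eta> z) (\<lambda>J. \<kappa> J z)) {})"
    unfolding e by (intro Bochner_Integration.integrable_sum integrable_mult_right i) auto
  have "(LINT z|lebesgue_on \<Omega>. contract_list us (wedge1 (\<lambda>k. dbar_partial k \<eta> z) (\<lambda>J. \<kappa> J z)) {})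
     = (\<Sum>K | card K = Suc p. c K * (\<Sum>k\<in>K. koszul_sign k K * (LINT z|lebesgue_on \<Omega>. ?t K k z)))"
  proof -
    have "(LINT z|lebesgue_on \<Omega>. (\<Sum>k\<in>K. koszul_sign k K * ?t K k z)) = (\<Sum>k\<in>K. koszul_sign k K * (LINT z|lebesgue_on \<Omega>. ?t K k z))"
      if K: "card K = Suc p" for K
    proof -
      have "(LINT z|lebesgue_on \<Omega>. (\<Sum>k\<in>K. koszul_sign k K * ?t K k z)) = (\<Sum>k\<in>K. LINT z|lebesgue_on \<Omega>. koszul_sign k K * ?t K k z)"
        by (rule Bochner_Integration.integral_sum) (intro integrable_mult_right i K)
      then show ?thesis by (simp only: integral_mult_right_zero)
    qed
    moreover have "(LINT z|lebesgue_on \<Omega>. (\<Sum>K | card K = Suc p. c K * (\<Sum>k\<in>K. koszul_sign k K * ?t K k z)))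
      = (\<Sum>K | card K = Suc p. LINT z|lebesgue_on \<Omega>. c K * (\<Sum>k\<in>K. koszul_sign k K * ?t K k z))"
      by (rule Bochner_Integration.integral_sum) (intro integrable_mult_right Bochner_Integration.integrable_sum i; simp)
    moreover have "(\<Sum>K | card K = Suc p. LINT z|lebesgue_on \<Omega>. c K * (\<Sum>k\<in>K. koszul_sign k K * ?t K k z))
      = (\<Sum>K | card K = Suc p. c K * (\<Sum>k\<in>K. koszul_sign k K * (LINT z|lebesgue_on \<Omega>. ?t K k z)))"
      using calculation(1) by (intro sum.cong refl) simp
    ultimately show ?thesis unfolding e by simp
  qed
  also have "\<dots> = (\<Sum>K\<in>{K::'n set. card K = Suc p}. 0)"
  proof (rule sum.cong[OF refl])
    fix K :: "'n set" assume "K \<in> {K. card K = Suc p}"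
    then have "(\<Sum>k\<in>K. (-1) ^ card {j\<in>K. j < k} * (LINT z|lebesgue_on \<Omega>. ?t K k z)) = 0"
      using \<kappa> \<eta> unfolding K2_forms_def dbar_closed_def by blast
    then show "c K * (\<Sum>k\<in>K. koszul_sign k K * (LINT z|lebesgue_on \<Omega>. ?t K k z)) = 0"
      by (simp add: koszul_sign_def)
  qed
  finally show "(LINT z|lebesgue_on \<Omega>. contract_list us (wedge1 (\<lambda>k. dbar_partial k \<eta> z) (\<lambda>J. \<kappa> J z)) {}) = 0"
    by simp
qed

lemma holomorphic_form_in_A2:
  fixes \<Omega> :: "(complex, 'n::{finite,linorder}) vec set"
  assumes \<Omega>: "open \<Omega>" "bounded \<Omega>" and f: "f \<in> bounded_holomorphic \<Omega>"
  shows "(\<lambda>J z. f z * \<theta> J) \<in> A2_forms p \<Omega>"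
proof -
  have fJ: "(\<lambda>z. f z * k) \<in> bounded_holomorphic \<Omega>" for k
    using bounded_holomorphic_cmult[OF f, of k] by (simp add: mult.commute)
  have L: "(\<lambda>J z. f z * \<theta> J) \<in> L2_forms p \<Omega>"
    using bounded_holomorphic_sqint[OF \<Omega> fJ] by (simp add: L2_forms_iff)
  have z: "(LINT z|lebesgue_on \<Omega>. (f z * c) * dbar_partial k \<eta> z) = 0" if \<eta>: "test_function \<Omega> \<eta>" for c k \<eta>
  proof -
    have hf: "holomorphic_fun_on f \<Omega>" using f by (simp add: bounded_holomorphic_def)
    then obtain f' where f': "\<And>x. x \<in> \<Omega> \<Longrightarrow> (f has_derivative f' x) (at x)"
      "\<And>x c v. x \<in> \<Omega> \<Longrightarrow> f' x (c *s v) = c * f' x v" using holomorphic_fun_onE by blast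
    obtain S where S: "compact S" "S \<subseteq> \<Omega>" "\<And>z. z \<notin> S \<Longrightarrow> \<eta> z = 0"
      "\<And>x. (\<eta> has_derivative frechet_derivative \<eta> (at x)) (at x)"
      "\<And>v. continuous_on UNIV (\<lambda>x. frechet_derivative \<eta> (at x) v)" using test_functionE[OF \<eta>] by blast
    have bf: "\<exists>B. \<forall>x\<in>S. norm (f' x v) \<le> B" for v
      by (rule holomorphic_bounded_derivative[OF \<Omega>(1) S(1,2) f']) (use f in \<open>auto simp: bounded_holomorphic_def\<close>)
    note ibp = dbar_integration_by_parts[OF \<Omega>(1) S(1,2) f'(1) bf S(4) S(5) S(3), of "axis k 1", folded dbar_partial_eq]
    have z0: "dbar_dir (f' x) (axis k 1) * \<eta> x = 0" for x
      using S(2) S(3)[of x] dbar_dir_complex_linear[of "f' x"] f'(2)[of x] by (cases "x \<in> S") auto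
    then have 0: "(LINT x|lborel. f x * dbar_partial k \<eta> x) = 0" using ibp(3) unfolding z0 by simp
    have out: "f x * dbar_partial k \<eta> x = 0" if "x \<notin> \<Omega>" for x
    proof -
      have "x \<notin> S" using that S(2) by blast
      then have "dbar_partial k \<eta> x = 0" using S(3) by (intro dbar_partial_eq_0[OF S(1)])
      then show ?thesis by simp
    qed
    have "(\<lambda>x. f x * dbar_partial k \<eta> x) \<in> borel_measurable borel" using ibp(1) by simp
    from integral_lebesgue_on_eq_lborel(1)[OF \<Omega>(1) this out]
    have "(LINT z|lebesgue_on \<Omega>. f z * dbar_partial k \<eta> z) = 0" using 0 by simp
    then have "c * (LINT z|lebesgue_on \<Omega>. f z * dbar_partial k \<eta> z) = 0" by simp
    then have "(LINT z|lebesgue_on \<Omega>. c * (f z * dbar_partial k \<eta> z)) = 0" by (simp only: integral_mult_right_zero)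
    then show ?thesis by (simp add: mult_ac)
  qed
  have "dbar_closed p \<Omega> (\<lambda>J z. f z * \<theta> J)"
    unfolding dbar_closed_def by (intro allI impI sum.neutral ballI) (simp add: z)
  then show ?thesis using L fJ by (simp add: A2_forms_def K2_forms_def bounded_holomorphic_def)
qed

text \<open>
  Pairing $\overline\partial(\varphi f\theta - \kappa)$ with a bump over the frame \<open>v1 # vs\<close>: the closed
  form drops out, duality leaves only the derivative of the bump along \<open>v1\<close> in front of \<open>\<phi> f\<close>, and
  integration by parts moves it to \<open>\<phi>\<close>, since \<open>f\<close> is holomorphic.
\<close>

lemma frame_pairing:
  fixes \<kappa> :: "'n::{finite,linorder} form"
  assumes \<Omega>: "open \<Omega>" "bounded \<Omega>"
    and \<phi>: "\<And>z. z \<in> \<Omega> \<Longrightarrow> (\<phi> has_derivative D z) (at z)" and bD: "\<And>v. \<exists>B. \<forall>z\<in>\<Omega>. cmod (D z v) \<le> B"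
    and b\<phi>: "bounded (\<phi> ` \<Omega>)"
    and dual: "\<And>w. w \<in> set ws \<Longrightarrow> conj_pair w v1 = 0" "contract_list vs (wedge_list ws) {} = 1" and len: "length vs = p"
    and f: "f \<in> bounded_holomorphic \<Omega>" and \<kappa>: "\<kappa> \<in> K2_forms p \<Omega>" and \<eta>: "test_function \<Omega> \<eta>"
  defines "u \<equiv> \<lambda>J z. \<phi> z * (f z * wedge_list ws J) - \<kappa> J z"
  shows "integrable (lebesgue_on \<Omega>) (\<lambda>z. contract_list (v1 # vs) (wedge1 (\<lambda>k. dbar_partial k \<eta> z) (\<lambda>J. u J z)) {})"
    and "(LINT z|lborel. dbar_dir (D z) v1 * f z * \<eta> z)
      = - (LINT z|lebesgue_on \<Omega>. contract_list (v1 # vs) (wedge1 (\<lambda>k. dbar_partial k \<eta> z) (\<lambda>J. u J z)) {})"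
    and "integrable lborel (\<lambda>z. dbar_dir (D z) v1 * f z * \<eta> z)"
proof -
  have hf: "holomorphic_fun_on f \<Omega>" using f by (simp add: bounded_holomorphic_def)
  then obtain f' where f': "\<And>x. x \<in> \<Omega> \<Longrightarrow> (f has_derivative f' x) (at x)"
    "\<And>x c v. x \<in> \<Omega> \<Longrightarrow> f' x (c *s v) = c * f' x v" using holomorphic_fun_onE by blast
  obtain S where S: "compact S" "S \<subseteq> \<Omega>" "\<And>z. z \<notin> S \<Longrightarrow> \<eta> z = 0"
    "\<And>x. (\<eta> has_derivative frechet_derivative \<eta> (at x)) (at x)"
    "\<And>v. continuous_on UNIV (\<lambda>x. frechet_derivative \<eta> (at x) v)" using test_functionE[OF \<eta>] by blast
  obtain Bf where Bf: "\<And>x. x \<in> \<Omega> \<Longrightarrow> cmod (f x) \<le> Bf" using f by (auto simp: bounded_holomorphic_def bounded_iff)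
  obtain Bp where Bp: "\<And>x. x \<in> \<Omega> \<Longrightarrow> cmod (\<phi> x) \<le> Bp" using b\<phi> by (auto simp: bounded_iff)
  define F' where "F' z v = \<phi> z * f' z v + D z v * f z" for z v
  have F: "((\<lambda>z. \<phi> z * f z) has_derivative F' z) (at z)" if "z \<in> \<Omega>" for z
    unfolding F'_def using has_derivative_mult[OF \<phi>[OF that] f'(1)[OF that]] .
  have bF: "\<exists>B. \<forall>x\<in>S. norm (F' x v) \<le> B" for v
  proof -
    obtain B1 where B1: "\<forall>x\<in>S. norm (f' x v) \<le> B1"
      using holomorphic_bounded_derivative[OF \<Omega>(1) S(1,2) f'] f by (auto simp: bounded_holomorphic_def)
    obtain B2 where B2: "\<forall>z\<in>\<Omega>. cmod (D z v) \<le> B2" using bD by blast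
    have "norm (F' x v) \<le> \<bar>Bp\<bar> * \<bar>B1\<bar> + \<bar>B2\<bar> * \<bar>Bf\<bar>" if "x \<in> S" for x
    proof -
      have x: "x \<in> \<Omega>" using that S by auto
      have "norm (F' x v) \<le> cmod (\<phi> x) * cmod (f' x v) + cmod (D x v) * cmod (f x)"
        unfolding F'_def by (rule order_trans[OF norm_triangle_ineq]) (simp add: norm_mult)
      also have "\<dots> \<le> \<bar>Bp\<bar> * \<bar>B1\<bar> + \<bar>B2\<bar> * \<bar>Bf\<bar>"
        using Bp[OF x] Bf[OF x] B1 B2 that x by (intro add_mono mult_mono) (auto intro: order_trans[OF _ abs_ge_self])
      finally show ?thesis .
    qed
    then show ?thesis by blast
  qed
  note ibp = dbar_integration_by_parts[OF \<Omega>(1) S(1,2) F bF S(4) S(5) S(3), of v1]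
  have dF: "dbar_dir (F' z) v1 * \<eta> z = dbar_dir (D z) v1 * f z * \<eta> z" for z
  proof (cases "z \<in> S")
    case True
    then have "dbar_dir (f' z) v1 = 0" using f'(2) S(2) by (intro dbar_dir_complex_linear) auto
    then have "f' z v1 + \<i> * f' z (\<i> *s v1) = 0" by (simp add: dbar_dir_def)
    then have "\<phi> z * (f' z v1 + \<i> * f' z (\<i> *s v1)) = 0" by simp
    moreover have "dbar_dir (F' z) v1 = \<phi> z * (f' z v1 + \<i> * f' z (\<i> *s v1)) / 2 + dbar_dir (D z) v1 * f z"
      by (simp add: dbar_dir_def F'_def algebra_simps add_divide_distrib)
    ultimately show ?thesis by simp
  qed (simp add: S(3))
  let ?a = "\<lambda>z k. dbar_partial k \<eta> z"
  have cp: "conj_pair (?a z) v = dbar_dir (frechet_derivative \<eta> (at z)) v" for z v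
    unfolding conj_pair_def dbar_partial_eq
    using dbar_dir_eq_sum[OF has_derivative_linear[OF S(4)[of z]], of v] by simp
  have out: "dbar_partial k \<eta> x = 0" if "x \<notin> \<Omega>" for x k
  proof -
    have "x \<notin> S" using that S(2) by blast
    then show ?thesis using S(3) by (intro dbar_partial_eq_0[OF S(1)])
  qed
  have out': "\<phi> x * f x * dbar_dir (frechet_derivative \<eta> (at x)) v1 = 0" if "x \<notin> \<Omega>" for x
    unfolding cp[symmetric] conj_pair_def by (simp add: out[OF that])
  have mb: "(\<lambda>x. \<phi> x * f x * dbar_dir (frechet_derivative \<eta> (at x)) v1) \<in> borel_measurable borel" using ibp(1) by simp
  have con: "contract_list (v1 # vs) (wedge1 (?a z) (\<lambda>J. u J z)) {}
     = \<phi> z * f z * dbar_dir (frechet_derivative \<eta> (at z)) v1 - contract_list (v1 # vs) (wedge1 (?a z) (\<lambda>J. \<kappa> J z)) {}" for z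
  proof -
    have "contract_list (v1 # vs) (wedge1 (?a z) (\<lambda>J. u J z)) {}
       = contract_list (v1 # vs) (wedge1 (?a z) (\<lambda>J. (\<phi> z * f z) * wedge_list ws J)) {} - contract_list (v1 # vs) (wedge1 (?a z) (\<lambda>J. \<kappa> J z)) {}"
      unfolding u_def wedge1_diff contract_list_diff mult.assoc by (rule refl)
    moreover have "contract_list (v1 # vs) (wedge1 (?a z) (\<lambda>J. (\<phi> z * f z) * wedge_list ws J)) {} = (\<phi> z * f z) * conj_pair (?a z) v1"
      by (rule contract_wedge1_wedge_list) (use dual in auto)
    ultimately show ?thesis by (simp only: cp)
  qed
  note pz = K2_pairing_zero[OF \<Omega> \<kappa> \<eta>, of "v1 # vs"]
  have i1: "integrable (lebesgue_on \<Omega>) (\<lambda>z. \<phi> z * f z * dbar_dir (frechet_derivative \<eta> (at z)) v1)"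
    using integral_lebesgue_on_eq_lborel(2)[OF \<Omega>(1) mb out'] ibp(1) by simp
  have i2: "integrable (lebesgue_on \<Omega>) (\<lambda>z. contract_list (v1 # vs) (wedge1 (?a z) (\<lambda>J. \<kappa> J z)) {})"
    by (rule pz(1)) (simp add: len)
  show "integrable (lebesgue_on \<Omega>) (\<lambda>z. contract_list (v1 # vs) (wedge1 (?a z) (\<lambda>J. u J z)) {})"
    unfolding con by (rule Bochner_Integration.integrable_diff[OF i1 i2])
  have "(LINT z|lebesgue_on \<Omega>. contract_list (v1 # vs) (wedge1 (?a z) (\<lambda>J. u J z)) {})
     = (LINT z|lebesgue_on \<Omega>. \<phi> z * f z * dbar_dir (frechet_derivative \<eta> (at z)) v1) - 0"
    unfolding con Bochner_Integration.integral_diff[OF i1 i2] using pz(2) len by simp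
  also have "\<dots> = (LINT z|lborel. \<phi> z * f z * dbar_dir (frechet_derivative \<eta> (at z)) v1)"
    using integral_lebesgue_on_eq_lborel(1)[OF \<Omega>(1) mb out'] by simp
  finally show "(LINT z|lborel. dbar_dir (D z) v1 * f z * \<eta> z)
      = - (LINT z|lebesgue_on \<Omega>. contract_list (v1 # vs) (wedge1 (?a z) (\<lambda>J. u J z)) {})"
    using ibp(3) unfolding dF by simp
  show "integrable lborel (\<lambda>z. dbar_dir (D z) v1 * f z * \<eta> z)" using ibp(2) unfolding dF .
qed

lemma sum_square_le_card:
  fixes a :: "'i \<Rightarrow> real"
  shows "(\<Sum>i\<in>I. a i)\<^sup>2 \<le> real (card I) * (\<Sum>i\<in>I. (a i)\<^sup>2)"
  using Cauchy_Schwarz_ineq_sum[of a "\<lambda>_. 1" I] by (simp add: mult.commute)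

text \<open>
  Here \<open>\<rho>\<close> bounds the inverse length of the ellipsoid along the frame, \<open>\<omega>\<close> the oscillation on it of the
  $\overline\partial$-derivative of the symbol along \<open>v1\<close>, and the constant depends on neither, nor on the
  other directions of the ellipsoid. Freezing that derivative at \<open>z\<close> in \<open>frame_pairing\<close> and using the mean value
  property for \<open>f\<close> bounds \<open>c0 * cmod (f z)\<close> by the average over the ellipsoid of \<open>\<omega> * cmod (f x)\<close> and \<open>\<rho>\<close> times the form;
  \<open>averaging_estimate\<close> turns this into an $L^2$ estimate.
\<close>

lemma key_estimate:
  fixes \<Omega> :: "(complex, 'n::{finite,linorder}) vec set" and D :: "(complex, 'n) vec \<Rightarrow> (complex, 'n) vec \<Rightarrow> complex"
  assumes \<Omega>: "open \<Omega>" "bounded \<Omega>"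
    and \<phi>: "\<And>z. z \<in> \<Omega> \<Longrightarrow> (\<phi> has_derivative D z) (at z)" and bD: "\<And>v. \<exists>B. \<forall>z\<in>\<Omega>. cmod (D z v) \<le> B"
    and b\<phi>: "bounded (\<phi> ` \<Omega>)"
    and dual: "\<And>w. w \<in> set ws \<Longrightarrow> conj_pair w v1 = 0" "contract_list vs (wedge_list ws) {} = 1" and len: "length vs = p"
  shows "\<exists>C\<ge>0. \<forall>A \<rho> \<omega> c0 G f \<kappa>. complex_iso A \<longrightarrow> open G \<longrightarrow> (\<forall>z\<in>G. \<forall>w\<in>ellipsoid A. z + w \<in> \<Omega>) \<longrightarrow>
      0 \<le> \<rho> \<longrightarrow> (\<forall>v\<in>set (v1 # vs). norm (A v) \<le> \<rho>) \<longrightarrow>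
      0 \<le> \<omega> \<longrightarrow> (\<forall>z\<in>G. \<forall>w\<in>ellipsoid A. cmod (dbar_dir (D (z + w)) v1 - dbar_dir (D z) v1) \<le> \<omega>) \<longrightarrow>
      0 \<le> c0 \<longrightarrow> (\<forall>z\<in>G. c0 \<le> cmod (dbar_dir (D z) v1)) \<longrightarrow>
      f \<in> bounded_holomorphic \<Omega> \<longrightarrow> \<kappa> \<in> K2_forms p \<Omega> \<longrightarrow>
      c0\<^sup>2 * sq_mass G f \<le> C * (\<omega>\<^sup>2 * sq_mass \<Omega> f + \<rho>\<^sup>2 * L2_sq p \<Omega> (\<lambda>J z. \<phi> z * (f z * wedge_list ws J) - \<kappa> J z))"
proof -
  interpret finite_measure "lebesgue_on \<Omega>" by (rule finite_measure_lebesgue_on_bounded[OF \<Omega>])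
  let ?M = "lebesgue_on \<Omega>"
  obtain Cc where Cc: "Cc \<ge> 0" "\<And>a F. cmod (contract_list (v1 # vs) (wedge1 a F) {})
      \<le> Cc * (\<Sum>v\<leftarrow>v1 # vs. cmod (conj_pair a v)) * (\<Sum>J | Suc (card J) = length (v1 # vs). cmod (F J))"
    using contract_wedge1_bound[of "v1 # vs"] by blast
  obtain B where B: "B > 0" "\<And>(A :: (complex, 'n) vec \<Rightarrow> (complex, 'n) vec) z x v. complex_iso A \<Longrightarrow>
     cmod (dbar_dir (frechet_derivative (bump A z) (at x)) v) \<le> B * norm (A v) * indicator (ellipsoid A) (x - z)"
    using bump_dbar_bound by blast
  define C' where "C' = Cc * (real (Suc p) * B)"
  have C'0: "C' \<ge> 0" using Cc B by (simp add: C'_def)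
  define c1 :: real where "c1 = exp (- 4 / 3) / 2 ^ DIM((complex, 'n) vec)"
  have c1: "c1 > 0" unfolding c1_def by (intro divide_pos_pos exp_gt_zero) simp
  define N where "N = real (card {J::'n set. card J = p})"
  define C where "C = (2 + 2 * C'\<^sup>2 * N) / c1\<^sup>2"
  have N0: "N \<ge> 0" by (simp add: N_def)
  have C0: "C \<ge> 0" using N0 by (simp add: C_def)
  have main: "c0\<^sup>2 * sq_mass G f \<le> C * (\<omega>\<^sup>2 * sq_mass \<Omega> f + \<rho>\<^sup>2 * L2_sq p \<Omega> (\<lambda>J z. \<phi> z * (f z * wedge_list ws J) - \<kappa> J z))"
    if A: "complex_iso A" and G: "open G" and sub: "\<And>z w. z \<in> G \<Longrightarrow> w \<in> ellipsoid A \<Longrightarrow> z + w \<in> \<Omega>"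
      and \<rho>: "0 \<le> \<rho>" "\<And>v. v \<in> set (v1 # vs) \<Longrightarrow> norm (A v) \<le> \<rho>"
      and \<omega>: "0 \<le> \<omega>" "\<And>z w. z \<in> G \<Longrightarrow> w \<in> ellipsoid A \<Longrightarrow> cmod (dbar_dir (D (z + w)) v1 - dbar_dir (D z) v1) \<le> \<omega>"
      and c0: "0 \<le> c0" "\<And>z. z \<in> G \<Longrightarrow> c0 \<le> cmod (dbar_dir (D z) v1)"
      and f: "f \<in> bounded_holomorphic \<Omega>" and \<kappa>: "\<kappa> \<in> K2_forms p \<Omega>"
    for A \<rho> \<omega> c0 G f \<kappa>
  proof -
    let ?E = "ellipsoid A" and ?mE = "measure lborel (ellipsoid A)"
    define u where "u J z = \<phi> z * (f z * wedge_list ws J) - \<kappa> J z" for J z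
    have hf: "holomorphic_fun_on f \<Omega>" using f by (simp add: bounded_holomorphic_def)
    have sf: "sqint ?M f" by (rule bounded_holomorphic_sqint[OF \<Omega> f])
    have c\<phi>: "continuous_on \<Omega> \<phi>" using \<phi> by (meson continuous_at_imp_continuous_on has_derivative_continuous)
    have su: "sqint ?M (u J)" if "card J = p" for J
    proof -
      have m\<phi>: "\<phi> \<in> borel_measurable ?M"
        using \<Omega> c\<phi> by (intro continuous_imp_measurable_on_sets_lebesgue) auto
      obtain Bp where "\<And>x. x \<in> \<Omega> \<Longrightarrow> cmod (\<phi> x) \<le> Bp" using b\<phi> by (auto simp: bounded_iff)
      then have "sqint ?M (\<lambda>z. \<phi> z * (wedge_list ws J * f z))"
        by (intro sqint_mult_bounded[OF sqint_cmult[OF sf] m\<phi>, of Bp]) simp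
      moreover have "sqint ?M (\<kappa> J)" using \<kappa> that by (simp add: K2_forms_def L2_forms_iff)
      ultimately have "sqint ?M (\<lambda>z. \<phi> z * (wedge_list ws J * f z) - \<kappa> J z)" by (rule sqint_diff)
      then show ?thesis by (simp add: u_def[abs_def] mult.commute[of "f _"])
    qed
    define U where "U x = (\<Sum>J | card J = p. cmod (u J x))" for x
    have U0: "U x \<ge> 0" for x by (simp add: U_def sum_nonneg)
    have iU: "integrable ?M U" unfolding U_def
      by (intro Bochner_Integration.integrable_sum integrable_norm sqint_imp_integrable su) simp
    have if': "integrable ?M (\<lambda>x. cmod (f x))" by (intro integrable_norm sqint_imp_integrable sf)
    \<comment> \<open>the quantity whose averages over the ellipsoids bound \<open>f\<close> on \<open>G\<close>\<close>
    define h where "h x = \<omega> * cmod (f x) + (C' * \<rho>) * U x" for x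
    have h0: "h x \<ge> 0" for x using \<omega>(1) C'0 \<rho>(1) U0 by (simp add: h_def)
    have ih: "integrable ?M h" unfolding h_def using if' iU by simp
    define R where "R x = (\<Sum>J | card J = p. (cmod (u J x))\<^sup>2)" for x
    have iR: "integrable ?M R" unfolding R_def
      by (intro Bochner_Integration.integrable_sum sqint_integrable su) simp
    have UR: "(U x)\<^sup>2 \<le> N * R x" for x unfolding U_def N_def R_def by (rule sum_square_le_card)
    have hR: "(h x)\<^sup>2 \<le> 2 * \<omega>\<^sup>2 * (cmod (f x))\<^sup>2 + 2 * (C' * \<rho>)\<^sup>2 * N * R x" for x
    proof -
      have "(a + b)\<^sup>2 \<le> 2 * a\<^sup>2 + 2 * b\<^sup>2" for a b :: real
        using zero_le_power2[of "a - b"] by (simp add: power2_eq_square algebra_simps)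
      then have "(h x)\<^sup>2 \<le> 2 * (\<omega> * cmod (f x))\<^sup>2 + 2 * ((C' * \<rho>) * U x)\<^sup>2" unfolding h_def .
      also have "2 * (\<omega> * cmod (f x))\<^sup>2 + 2 * ((C' * \<rho>) * U x)\<^sup>2 = 2 * \<omega>\<^sup>2 * (cmod (f x))\<^sup>2 + 2 * (C' * \<rho>)\<^sup>2 * (U x)\<^sup>2"
        by (simp add: power_mult_distrib)
      also have "\<dots> \<le> 2 * \<omega>\<^sup>2 * (cmod (f x))\<^sup>2 + 2 * (C' * \<rho>)\<^sup>2 * (N * R x)"
        by (intro add_left_mono mult_left_mono UR) simp
      finally show ?thesis by (simp only: mult.assoc)
    qed
    have ibnd: "integrable ?M (\<lambda>x. 2 * \<omega>\<^sup>2 * (cmod (f x))\<^sup>2 + 2 * (C' * \<rho>)\<^sup>2 * N * R x)"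
      by (intro Bochner_Integration.integrable_add integrable_mult_right sqint_integrable[OF sf] iR)
    have ih2: "integrable ?M (\<lambda>x. (h x)\<^sup>2)"
    proof (rule Bochner_Integration.integrable_bound[OF ibnd])
      show "(\<lambda>x. (h x)\<^sup>2) \<in> borel_measurable ?M"
        using ih by (intro borel_measurable_power borel_measurable_integrable)
      show "AE x in ?M. norm ((h x)\<^sup>2) \<le> norm (2 * \<omega>\<^sup>2 * (cmod (f x))\<^sup>2 + 2 * (C' * \<rho>)\<^sup>2 * N * R x)"
        by (intro AE_I2) (use hR in \<open>smt (verit) real_norm_def zero_le_power2\<close>)
    qed
    have GO: "G \<subseteq> \<Omega>"
    proof
      fix z assume "z \<in> G"
      moreover have "0 \<in> ?E" using A by (simp add: ellipsoid_def complex_iso_def linear_0)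
      ultimately show "z \<in> \<Omega>" using sub[of z 0] by simp
    qed
    have cf: "continuous_on \<Omega> f" by (rule holomorphic_fun_on_imp_continuous_on[OF hf])
    have mfG: "f \<in> borel_measurable (lebesgue_on G)"
      using G continuous_on_subset[OF cf GO] by (intro continuous_imp_measurable_on_sets_lebesgue) auto
    obtain c where c: "(LINT w|lborel. bump A 0 w) = complex_of_real c" "c1 * ?mE \<le> c"
      using bump_integral_lower_bound[OF A] unfolding c1_def by blast
    have mE: "?mE > 0" by (rule measure_ellipsoid_pos[OF A])
    have c_pos: "c > 0" using c(2) mult_pos_pos[OF c1 mE] by linarith
    have Em: "?E \<in> sets borel" by (rule borel_compact[OF compact_ellipsoid[OF A]])
    define k where "k = c0 * (c1 * ?mE)"
    have k0: "k \<ge> 0" using c0 c1 mE by (simp add: k_def)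
    have bound: "k * cmod (f z) \<le> (LINT x|?M. indicator ?E (x - z) * h x)" if z: "z \<in> G" for z
    proof -
      let ?\<eta> = "bump A z" and ?ind = "\<lambda>x. indicat_real ?E (x - z)"
      have subz: "\<And>w. w \<in> ?E \<Longrightarrow> z + w \<in> \<Omega>" using sub z by blast
      have tf: "test_function \<Omega> ?\<eta>" by (rule test_function_bump[OF A subz])
      note fp = frame_pairing[OF \<Omega> \<phi> bD b\<phi> dual len f \<kappa> tf, folded u_def]
      let ?con = "\<lambda>x. contract_list (v1 # vs) (wedge1 (\<lambda>k. dbar_partial k ?\<eta> x) (\<lambda>J. u J x)) {}"
      let ?d = "dbar_dir (D z) v1"
      have icon: "integrable ?M ?con" using fp(1) by simp
      have lcon: "(LINT x|lborel. dbar_dir (D x) v1 * f x * ?\<eta> x) = - (LINT x|?M. ?con x)" using fp(2) by simp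
      have iI: "integrable lborel (\<lambda>x. dbar_dir (D x) v1 * f x * ?\<eta> x)" using fp(3) by simp
      note mv = bump_mean_value[OF A subz hf]
      have iz: "integrable lborel (\<lambda>x. ?d * (f x * ?\<eta> x))" by (intro integrable_mult_right) (use mv(2) in simp)
      have meas_ind: "?ind \<in> borel_measurable ?M"
      proof -
        have "?ind \<in> borel_measurable borel" using Em by measurable
        then show ?thesis by (intro measurable_restrict_space1 measurable_completion) simp
      qed
      have iind: "integrable ?M (\<lambda>x. ?ind x * g x)" if "integrable ?M g" for g :: "_ \<Rightarrow> real"
        by (rule Bochner_Integration.integrable_bound[OF that])
           (use that meas_ind in \<open>auto intro!: borel_measurable_times simp: indicator_def\<close>)
      have out: "x \<notin> \<Omega> \<Longrightarrow> ?\<eta> x = 0" for x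
        using bump_eq_0[of x z A] subz[of "x - z"] by auto
      have con_le: "cmod (?con x) \<le> ?ind x * ((C' * \<rho>) * U x)" for x
      proof -
        have lin: "linear (frechet_derivative ?\<eta> (at x))"
        proof -
          have "(?\<eta> has_derivative frechet_derivative ?\<eta> (at x)) (at x)" using test_functionE[OF tf] by metis
          then show ?thesis by (rule has_derivative_linear)
        qed
        have cp: "cmod (conj_pair (\<lambda>k. dbar_partial k ?\<eta> x) v) \<le> B * \<rho> * ?ind x" if v: "v \<in> set (v1 # vs)" for v
        proof -
          have "conj_pair (\<lambda>k. dbar_partial k ?\<eta> x) v = dbar_dir (frechet_derivative ?\<eta> (at x)) v"
            unfolding conj_pair_def dbar_partial_eq using dbar_dir_eq_sum[OF lin, of v] by simp
          also have "cmod \<dots> \<le> B * norm (A v) * ?ind x" by (rule B(2)[OF A])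
          also have "\<dots> \<le> B * \<rho> * ?ind x" using B(1) \<rho>(2)[OF v] by (intro mult_right_mono mult_left_mono) auto
          finally show ?thesis .
        qed
        have "(\<Sum>v\<leftarrow>v1 # vs. cmod (conj_pair (\<lambda>k. dbar_partial k ?\<eta> x) v)) \<le> (\<Sum>v\<leftarrow>v1 # vs. B * \<rho> * ?ind x)"
          by (rule sum_list_mono) (rule cp)
        also have "\<dots> = real (Suc p) * (B * \<rho> * ?ind x)" using len by (simp add: sum_list_triv algebra_simps)
        finally have s: "(\<Sum>v\<leftarrow>v1 # vs. cmod (conj_pair (\<lambda>k. dbar_partial k ?\<eta> x) v)) \<le> real (Suc p) * (B * \<rho> * ?ind x)" .
        have "cmod (?con x) \<le> Cc * (\<Sum>v\<leftarrow>v1 # vs. cmod (conj_pair (\<lambda>k. dbar_partial k ?\<eta> x) v)) * (\<Sum>J | Suc (card J) = length (v1 # vs). cmod (u J x))"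
          by (rule Cc(2))
        also have "(\<Sum>J | Suc (card J) = length (v1 # vs). cmod (u J x)) = U x" by (simp add: U_def len)
        also have "Cc * (\<Sum>v\<leftarrow>v1 # vs. cmod (conj_pair (\<lambda>k. dbar_partial k ?\<eta> x) v)) * U x \<le> Cc * (real (Suc p) * (B * \<rho> * ?ind x)) * U x"
          by (intro mult_right_mono mult_left_mono s Cc(1) U0)
        also have "\<dots> = ?ind x * ((C' * \<rho>) * U x)" by (simp only: C'_def mult_ac)
        finally show ?thesis .
      qed
      have zero: "dbar_dir (D x) v1 * f x * ?\<eta> x - ?d * (f x * ?\<eta> x) = 0" if "x \<notin> \<Omega>" for x
        using out[OF that] by simp
      have idiff: "integrable lborel (\<lambda>x. dbar_dir (D x) v1 * f x * ?\<eta> x - ?d * (f x * ?\<eta> x))"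
        by (rule Bochner_Integration.integrable_diff[OF iI iz])
      then have mdiff: "(\<lambda>x. dbar_dir (D x) v1 * f x * ?\<eta> x - ?d * (f x * ?\<eta> x)) \<in> borel_measurable borel" by simp
      have diff_le: "cmod (dbar_dir (D x) v1 * f x * ?\<eta> x - ?d * (f x * ?\<eta> x)) \<le> ?ind x * (\<omega> * cmod (f x))" for x
      proof (cases "x - z \<in> ?E")
        case True
        have "dbar_dir (D x) v1 * f x * ?\<eta> x - ?d * (f x * ?\<eta> x) = (dbar_dir (D x) v1 - ?d) * (f x * ?\<eta> x)"
          by (simp add: algebra_simps)
        also have "cmod \<dots> \<le> \<omega> * (cmod (f x) * 1)"
          unfolding norm_mult
        proof (intro mult_mono)
          show "cmod (dbar_dir (D x) v1 - ?d) \<le> \<omega>" using \<omega>(2)[OF z True] by simp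
          show "cmod (?\<eta> x) \<le> 1" by (rule order_trans[OF norm_bump_le]) (simp add: indicator_def)
        qed (use \<omega>(1) in auto)
        finally show ?thesis using True by simp
      qed (simp add: bump_eq_0)
      have lz: "(LINT x|lborel. ?d * (f x * ?\<eta> x)) = ?d * (f z * complex_of_real c)"
        using mv(1) c(1) by simp
      have eq: "?d * (f z * complex_of_real c) = - (LINT x|?M. ?con x) - (LINT x|lborel. dbar_dir (D x) v1 * f x * ?\<eta> x - ?d * (f x * ?\<eta> x))"
        unfolding Bochner_Integration.integral_diff[OF iI iz] lcon lz by simp
      have b1: "cmod (LINT x|?M. ?con x) \<le> (LINT x|?M. ?ind x * ((C' * \<rho>) * U x))"
        by (rule order_trans[OF integral_norm_bound])
           (intro integral_mono integrable_norm icon con_le iind integrable_mult_right iU)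
      have "(LINT x|lborel. dbar_dir (D x) v1 * f x * ?\<eta> x - ?d * (f x * ?\<eta> x)) = (LINT x|?M. dbar_dir (D x) v1 * f x * ?\<eta> x - ?d * (f x * ?\<eta> x))"
        by (rule integral_lebesgue_on_eq_lborel(1)[OF \<Omega>(1) mdiff zero, symmetric])
      also have "cmod \<dots> \<le> (LINT x|?M. ?ind x * (\<omega> * cmod (f x)))"
      proof (rule order_trans[OF integral_norm_bound], intro integral_mono integrable_norm diff_le iind integrable_mult_right if')
        show "integrable ?M (\<lambda>x. dbar_dir (D x) v1 * f x * ?\<eta> x - ?d * (f x * ?\<eta> x))"
          using integral_lebesgue_on_eq_lborel(2)[OF \<Omega>(1) mdiff zero] idiff by blast
      qed (use sqint_imp_integrable[OF sf] in simp)
      finally have b2: "cmod (LINT x|lborel. dbar_dir (D x) v1 * f x * ?\<eta> x - ?d * (f x * ?\<eta> x)) \<le> (LINT x|?M. ?ind x * (\<omega> * cmod (f x)))" .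
      have "k * cmod (f z) \<le> cmod ?d * (cmod (f z) * c)"
      proof -
        have "c0 * (c1 * ?mE) * cmod (f z) \<le> cmod ?d * c * cmod (f z)"
          using c0 c0(2)[OF z] c(2) c1 mE by (intro mult_right_mono mult_mono) auto
        then show ?thesis by (simp only: k_def mult_ac)
      qed
      also have "\<dots> = cmod (?d * (f z * complex_of_real c))" using c_pos by (simp add: norm_mult)
      also have "\<dots> \<le> cmod (LINT x|?M. ?con x) + cmod (LINT x|lborel. dbar_dir (D x) v1 * f x * ?\<eta> x - ?d * (f x * ?\<eta> x))"
      proof -
        have "cmod (- X - Y) \<le> cmod X + cmod Y" for X Y :: complex using norm_triangle_ineq4[of "- X" Y] by simp
        then show ?thesis unfolding eq .
      qed
      also have "\<dots> \<le> (LINT x|?M. ?ind x * ((C' * \<rho>) * U x)) + (LINT x|?M. ?ind x * (\<omega> * cmod (f x)))"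
        by (rule add_mono[OF b1 b2])
      also have "\<dots> = (LINT x|?M. ?ind x * ((C' * \<rho>) * U x) + ?ind x * (\<omega> * cmod (f x)))"
        by (rule Bochner_Integration.integral_add[symmetric]) (intro iind integrable_mult_right iU if')+
      also have "\<dots> = (LINT x|?M. ?ind x * h x)"
        by (intro Bochner_Integration.integral_cong refl) (simp add: h_def algebra_simps)
      finally show ?thesis .
    qed
    note av = averaging_estimate[OF \<Omega>(1) compact_ellipsoid[OF A] G sub ih ih2 h0 mfG k0 bound]
    have "(LINT z|lebesgue_on G. (k * cmod (f z))\<^sup>2) \<le> ?mE\<^sup>2 * (LINT x|?M. (h x)\<^sup>2)" using av(2) by blast
    moreover have "(LINT z|lebesgue_on G. (k * cmod (f z))\<^sup>2) = ?mE\<^sup>2 * (c0\<^sup>2 * c1\<^sup>2 * sq_mass G f)"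
    proof -
      have "(LINT z|lebesgue_on G. (k * cmod (f z))\<^sup>2) = (LINT z|lebesgue_on G. k\<^sup>2 * (cmod (f z))\<^sup>2)"
        by (simp only: power_mult_distrib)
      also have "\<dots> = k\<^sup>2 * sq_mass G f" unfolding sq_mass_def by (rule integral_mult_right_zero)
      finally show ?thesis by (simp only: k_def power_mult_distrib mult_ac)
    qed
    ultimately have "?mE\<^sup>2 * (c0\<^sup>2 * c1\<^sup>2 * sq_mass G f) \<le> ?mE\<^sup>2 * (LINT x|?M. (h x)\<^sup>2)" by simp
    then have "c0\<^sup>2 * c1\<^sup>2 * sq_mass G f \<le> (LINT x|?M. (h x)\<^sup>2)"
      by (rule mult_left_le_imp_le) (use mE in simp)
    also have "\<dots> \<le> (LINT x|?M. 2 * \<omega>\<^sup>2 * (cmod (f x))\<^sup>2 + 2 * (C' * \<rho>)\<^sup>2 * N * R x)"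
      by (intro integral_mono ih2 ibnd hR)
    also have "\<dots> = 2 * \<omega>\<^sup>2 * sq_mass \<Omega> f + 2 * (C' * \<rho>)\<^sup>2 * N * (LINT x|?M. R x)"
    proof -
      have "(LINT x|?M. a * g x + b * R x) = a * (LINT x|?M. g x) + b * (LINT x|?M. R x)" if "integrable ?M g" for a b g
        using that iR by simp
      from this[OF sqint_integrable[OF sf]] show ?thesis unfolding sq_mass_def .
    qed
    also have "(LINT x|?M. R x) = L2_sq p \<Omega> u"
      unfolding R_def L2_sq_def by (rule Bochner_Integration.integral_sum) (intro sqint_integrable su, simp)
    also have "2 * \<omega>\<^sup>2 * sq_mass \<Omega> f + 2 * (C' * \<rho>)\<^sup>2 * N * L2_sq p \<Omega> u
      \<le> (2 + 2 * C'\<^sup>2 * N) * (\<omega>\<^sup>2 * sq_mass \<Omega> f + \<rho>\<^sup>2 * L2_sq p \<Omega> u)"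
    proof -
      have "0 \<le> 2 * (\<rho>\<^sup>2 * L2_sq p \<Omega> u)" "0 \<le> 2 * C'\<^sup>2 * N * (\<omega>\<^sup>2 * sq_mass \<Omega> f)"
        using L2_sq_nonneg[of p \<Omega> u] sq_mass_nonneg[of \<Omega> f] N0 by simp_all
      then show ?thesis by (simp add: algebra_simps power_mult_distrib)
    qed
    finally have "c0\<^sup>2 * sq_mass G f * c1\<^sup>2 \<le> (2 + 2 * C'\<^sup>2 * N) * (\<omega>\<^sup>2 * sq_mass \<Omega> f + \<rho>\<^sup>2 * L2_sq p \<Omega> u)"
      by (simp only: mult_ac)
    then have "c0\<^sup>2 * sq_mass G f \<le> (2 + 2 * C'\<^sup>2 * N) * (\<omega>\<^sup>2 * sq_mass \<Omega> f + \<rho>\<^sup>2 * L2_sq p \<Omega> u) / c1\<^sup>2"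
      using c1 by (subst pos_le_divide_eq) auto
    then show ?thesis unfolding C_def u_def[abs_def] by (simp only: times_divide_eq_left)
  qed
  show ?thesis by (intro exI[of _ C] conjI C0 allI impI) (rule main; blast)
qed

section \<open>The symbol on the boundary\<close>

text \<open>
  Two points of the closure, moved slightly towards an interior point, lie in the part of the domain near \<open>y\<close>, which is convex; the mean value inequality for
  \<open>\<phi> - D y\<close> holds there and passes to the limit.
\<close>

lemma C1_closure_has_derivative:
  fixes D :: "'a::euclidean_space \<Rightarrow> 'a \<Rightarrow>\<^sub>L complex"
  assumes \<Omega>: "open \<Omega>" "convex \<Omega>" "\<Omega> \<noteq> {}"
    and \<phi>: "continuous_on (closure \<Omega>) \<phi>" and D: "continuous_on (closure \<Omega>) D"
    and d: "\<And>z. z \<in> \<Omega> \<Longrightarrow> (\<phi> has_derivative blinfun_apply (D z)) (at z)"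
    and y: "y \<in> closure \<Omega>"
  shows "(\<phi> has_derivative blinfun_apply (D y)) (at y within closure \<Omega>)"
  unfolding has_derivative_within_alt
proof (intro conjI allI impI)
  show "bounded_linear (blinfun_apply (D y))" by (rule blinfun.bounded_linear_right)
  fix e :: real assume e: "e > 0"
  obtain r where r: "r > 0" "\<And>x. x \<in> closure \<Omega> \<Longrightarrow> dist x y < r \<Longrightarrow> dist (D x) (D y) < e"
    using D y e unfolding continuous_on_iff by blast
  obtain a where a: "a \<in> interior \<Omega>" using \<Omega> by (auto simp: interior_open)
  define g where "g w = \<phi> w - blinfun_apply (D y) w" for w
  have lip: "norm (g p - g q) \<le> e * norm (p - q)" if "p \<in> \<Omega> \<inter> ball y r" "q \<in> \<Omega> \<inter> ball y r" for p q
  proof (rule differentiable_bound[OF _ _ _ that(1) that(2)])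
    show "convex (\<Omega> \<inter> ball y r)" using \<Omega>(2) by (intro convex_Int) auto
    fix w assume w: "w \<in> \<Omega> \<inter> ball y r"
    show "(g has_derivative blinfun_apply (D w - D y)) (at w within \<Omega> \<inter> ball y r)"
      unfolding g_def minus_blinfun.rep_eq
      by (intro has_derivative_diff has_derivative_at_withinI[OF d] bounded_linear_imp_has_derivative blinfun.bounded_linear_right)
         (use w in auto)
    have "dist (D w) (D y) < e" using w closure_subset by (intro r(2)) (auto simp: dist_commute)
    then show "onorm (blinfun_apply (D w - D y)) \<le> e" by (simp add: norm_blinfun.rep_eq[symmetric] dist_norm)
  qed
  define t where "t n = 1 / real (Suc n)" for n
  have t0: "t \<longlonglongrightarrow> 0" unfolding t_def by (rule LIMSEQ_Suc[OF lim_1_over_n])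
  define P where "P x n = x - t n *\<^sub>R (x - a)" for x n
  have Pin: "P x n \<in> \<Omega>" if "x \<in> closure \<Omega>" for x n
    using mem_interior_closure_convex_shrink[OF \<Omega>(2) a that, of "t n"] \<Omega>(1)
    by (simp add: P_def t_def interior_open)
  have Plim: "P x \<longlonglongrightarrow> x" for x
  proof -
    have "(\<lambda>n. x - t n *\<^sub>R (x - a)) \<longlonglongrightarrow> x - 0 *\<^sub>R (x - a)" by (intro tendsto_intros t0)
    then show ?thesis by (simp add: P_def[abs_def])
  qed
  have cg: "continuous_on (closure \<Omega>) g" unfolding g_def
    by (intro continuous_intros \<phi>)
  have glim: "(\<lambda>n. g (P x n)) \<longlonglongrightarrow> g x" if "x \<in> closure \<Omega>" for x
    by (rule continuous_on_tendsto_compose[OF cg Plim that])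
       (use Pin[OF that] closure_subset in \<open>auto intro!: always_eventually\<close>)
  have "norm (\<phi> x - \<phi> y - blinfun_apply (D y) (x - y)) \<le> e * norm (x - y)"
    if x: "x \<in> closure \<Omega>" "norm (x - y) < r" for x
  proof -
    have "\<forall>\<^sub>F n in sequentially. P x n \<in> ball y r"
      using topological_tendstoD[OF Plim, of "ball y r" x] x(2) by (simp add: dist_norm norm_minus_commute)
    moreover have "\<forall>\<^sub>F n in sequentially. P y n \<in> ball y r"
      using topological_tendstoD[OF Plim, of "ball y r" y] r(1) by simp
    ultimately have "\<forall>\<^sub>F n in sequentially. norm (g (P x n) - g (P y n)) \<le> e * norm (P x n - P y n)"
      by eventually_elim (use lip Pin x(1) y in auto)
    moreover have "(\<lambda>n. norm (g (P x n) - g (P y n))) \<longlonglongrightarrow> norm (g x - g y)"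
      by (intro tendsto_intros glim x(1) y)
    moreover have "(\<lambda>n. e * norm (P x n - P y n)) \<longlonglongrightarrow> e * norm (x - y)"
      by (intro tendsto_intros Plim)
    ultimately have "norm (g x - g y) \<le> e * norm (x - y)"
      by (intro tendsto_le[OF trivial_limit_sequentially])
    then show ?thesis by (simp add: g_def blinfun.diff_right algebra_simps)
  qed
  then show "\<exists>d>0. \<forall>x\<in>closure \<Omega>. norm (x - y) < d \<longrightarrow> norm (\<phi> x - \<phi> y - blinfun_apply (D y) (x - y)) \<le> e * norm (x - y)"
    using r(1) by blast
qed

lemma dbar_dir_zero_imp_complex_linear:
  fixes M :: "complex ^ 'q \<Rightarrow> complex"
  assumes M: "linear M" and z: "\<And>i. dbar_dir M (axis i 1) = 0"
  shows "M (c *s v) = c * M v"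
proof -
  have "dbar_dir M v = 0" for v unfolding dbar_dir_eq_sum[OF M, of v] by (simp add: z)
  then have "M v + \<i> * M (\<i> *s v) = 0" for v by (simp add: dbar_dir_def)
  then have "\<i> * (M v + \<i> * M (\<i> *s v)) = 0" for v by simp
  then have i: "M (\<i> *s v) = \<i> * M v" for v by (simp add: algebra_simps)
  have "c *s v = Re c *\<^sub>R v + Im c *\<^sub>R (\<i> *s v)"
    by (simp add: vec_eq_iff complex_eq_iff)
  then have "M (c *s v) = of_real (Re c) * M v + of_real (Im c) * (\<i> * M v)"
    by (simp only: linear_add[OF M] linear_scale[OF M] i) (simp add: scaleR_conv_of_real)
  also have "\<dots> = (of_real (Re c) + \<i> * of_real (Im c)) * M v" by (simp add: algebra_simps)
  finally show ?thesis by (simp add: complex_eq[symmetric])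
qed

text \<open>
  By the chain rule $\varphi\circ\psi$ is real differentiable; if its derivative had no antilinear part on any
  coordinate vector at any point, it would be holomorphic.
\<close>

lemma nonholomorphic_direction:
  fixes \<psi> :: "complex ^ 'q \<Rightarrow> complex ^ 'n"
  assumes hol: "holomorphic_map_on \<psi> polydisc" and im: "\<psi> ` polydisc \<subseteq> S"
    and \<phi>: "\<And>y. y \<in> S \<Longrightarrow> (\<phi> has_derivative D y) (at y within S)"
    and nh: "\<not> holomorphic_fun_on (\<phi> \<circ> \<psi>) polydisc"
  obtains z0 L i where "z0 \<in> polydisc" "(\<psi> has_derivative L) (at z0)" "\<And>c v. L (c *s v) = c *s L v"
    "dbar_dir (D (\<psi> z0)) (L (axis i 1)) \<noteq> 0"
proof (rule ccontr)
  assume "\<not> thesis"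
  then have n: "\<And>z0 L i. z0 \<in> polydisc \<Longrightarrow> (\<psi> has_derivative L) (at z0) \<Longrightarrow> (\<And>c v. L (c *s v) = c *s L v)
     \<Longrightarrow> dbar_dir (D (\<psi> z0)) (L (axis i 1)) = 0" using that by blast
  have "holomorphic_fun_on (\<phi> \<circ> \<psi>) polydisc"
    unfolding holomorphic_fun_on_def
  proof
    fix z :: "complex ^ 'q" assume z: "z \<in> polydisc"
    obtain L where L: "(\<psi> has_derivative L) (at z)" "\<And>c v. L (c *s v) = c *s L v"
      using holomorphic_map_on_derivative[OF hol z] by blast
    define M where "M v = D (\<psi> z) (L v)" for v
    have Pz: "\<psi> z \<in> S" using im z by blast
    have "(\<psi> has_derivative L) (at z within polydisc)" by (rule has_derivative_at_withinI[OF L(1)])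
    moreover have "(\<phi> has_derivative D (\<psi> z)) (at (\<psi> z) within \<psi> ` polydisc)"
      by (rule has_derivative_subset[OF \<phi>[OF Pz] im])
    ultimately have "((\<lambda>x. \<phi> (\<psi> x)) has_derivative (\<lambda>v. D (\<psi> z) (L v))) (at z within polydisc)"
      by (rule has_derivative_in_compose)
    then have dM: "((\<phi> \<circ> \<psi>) has_derivative M) (at z)"
      using at_within_open[OF z open_polydisc] by (simp add: M_def[abs_def] o_def)
    have "dbar_dir M (axis i 1) = dbar_dir (D (\<psi> z)) (L (axis i 1))" for i
      by (simp add: dbar_dir_def M_def L(2))
    then have "dbar_dir M (axis i 1) = 0" for i using n[OF z L(1) L(2)] by simp
    then have "\<forall>c v. M (c *s v) = c * M v"
      using dbar_dir_zero_imp_complex_linear[OF has_derivative_linear[OF dM]] by blast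
    then show "\<exists>L. ((\<phi> \<circ> \<psi>) has_derivative L) (at z) \<and> (\<forall>c v. L (c *s v) = c * L v)" using dM by blast
  qed
  then show False using nh by blast
qed

text \<open>
  The rows of the left inverse, conjugated because \<^const>\<open>conj_pair\<close> is antilinear in the vector, are the coframe dual to the columns of \<open>L\<close>.
\<close>

lemma complex_left_inverse:
  fixes L :: "complex ^ 'q \<Rightarrow> complex ^ 'n"
  assumes L: "linear L" "\<And>c v. L (c *s v) = c *s L v" "inj L"
  obtains P where "linear P" "\<And>c v. P (c *s v) = c *s P v" "\<And>v. P (L v) = v"
    "\<And>i j. conj_pair (\<lambda>k. cnj (P (axis k 1) $ i)) (L (axis j 1)) = (if i = j then 1 else 0)"
proof -
  have "Vector_Spaces.linear (*s) (*s) L"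
    by (unfold_locales) (simp_all add: linear_add[OF L(1)] L(2) vec.scale_right_distrib vec.scale_left_distrib)
  then have mw: "matrix L *v v = L v" for v by (rule matrix_works)
  have "inj ((*v) (matrix L))" using L(3) by (simp add: mw[abs_def])
  then obtain B where B: "B ** matrix L = mat 1" using matrix_left_invertible_injective by blast
  define P where "P v = B *v v" for v
  have lin: "linear P" unfolding P_def
    by (rule linearI) (simp_all add: matrix_vector_right_distrib matrix_vector_mult_def vec_eq_iff scaleR_sum_right distrib_left sum.distrib)
  have sc: "P (c *s v) = c *s P v" for c v unfolding P_def by (rule vec.scale)
  have PL: "P (L v) = v" for v
  proof -
    have "P (L v) = (B ** matrix L) *v v" by (simp add: P_def mw[symmetric] matrix_vector_mul_assoc)
    then show ?thesis by (simp add: B)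
  qed
  have "conj_pair (\<lambda>k. cnj (P (axis k 1) $ i)) (L (axis j 1)) = (if i = j then 1 else 0)" for i j
  proof -
    have Bk: "P (axis k 1) $ i = B $ i $ k" for k
      by (simp add: P_def matrix_vector_mult_def axis_def if_distrib cong: if_cong)
    have "(\<Sum>k\<in>UNIV. B $ i $ k * L (axis j 1) $ k) = P (L (axis j 1)) $ i"
      by (simp add: P_def matrix_vector_mult_def)
    also have "\<dots> = (if i = j then 1 else 0)" by (simp add: PL axis_def)
    finally have "cnj (\<Sum>k\<in>UNIV. B $ i $ k * L (axis j 1) $ k) = (if i = j then 1 else 0)" by simp
    then show ?thesis by (simp add: conj_pair_def Bk)
  qed
  with lin sc PL show ?thesis by (rule that)
qed

section \<open>Noncompactness\<close>

text \<open>
  With the projection \<open>Q\<close> onto the range of \<open>L\<close>, the map \<open>A\<close> is $1/r$ on that range and $1/\epsilon$ on the kernel of \<open>Q\<close>. A point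
  of the homothetic copy, moved by \<open>x\<close> in the ellipsoid, is a convex combination of \<open>w\<close>, a point of the disc \<open>p + L w'\<close> and a point
  near \<open>a0\<close>. The disc has fixed size, so \<open>r\<close> and with it \<open>\<rho>\<close> do not depend on \<open>t\<close>; only \<open>\<epsilon>\<close> shrinks with \<open>t\<close>.
\<close>

lemma anisotropic_ellipsoids:
  fixes \<Omega> :: "(complex ^ 'n) set" and L :: "complex ^ 'q \<Rightarrow> complex ^ 'n"
  assumes \<Omega>: "open \<Omega>" "convex \<Omega>" and a0: "a0 \<in> \<Omega>"
    and L: "linear L" "\<And>c v. L (c *s v) = c *s L v"
    and P: "linear P" "\<And>c v. P (c *s v) = c *s P v" "\<And>v. P (L v) = v"
    and disc: "\<rho>0 > 0" "\<And>w. norm w \<le> \<rho>0 \<Longrightarrow> p + L w \<in> closure \<Omega>" and \<delta>: "\<delta> > 0"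
  shows "\<exists>\<rho>\<ge>0. \<forall>t. 0 < t \<longrightarrow> t \<le> 1 / 2 \<longrightarrow> (\<exists>A. complex_iso A \<and> (\<forall>j. norm (A (L (axis j 1))) \<le> \<rho>) \<and>
     (\<forall>x\<in>ellipsoid A. norm x \<le> \<delta> \<and> (\<forall>l w. 0 < l \<longrightarrow> l \<le> 1 / 2 \<longrightarrow> w \<in> \<Omega> \<longrightarrow>
        ((1 - l) *\<^sub>R (p + t *\<^sub>R (a0 - p)) + l *\<^sub>R w) + x \<in> \<Omega>)))"
proof -
  define Q where "Q y = L (P y)" for y
  have lQ: "linear Q" unfolding Q_def using linear_compose[OF P(1) L(1)] by (simp add: o_def)
  have QQ: "Q (Q y) = Q y" for y by (simp add: Q_def P(3))
  have PQ: "P (Q y) = P y" for y by (simp add: Q_def P(3))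
  obtain mP where mP: "mP > 0" "\<And>y. norm (P y) \<le> norm y * mP"
    using bounded_linear.pos_bounded[of P] P(1) linear_conv_bounded_linear by blast
  obtain mQ where mQ: "mQ > 0" "\<And>y. norm (Q y) \<le> norm y * mQ"
    using bounded_linear.pos_bounded[of Q] lQ linear_conv_bounded_linear by blast
  define mN where "mN = 1 + mQ"
  have mN: "mN > 0" "\<And>y. norm (y - Q y) \<le> norm y * mN"
  proof -
    show "mN > 0" using mQ(1) by (simp add: mN_def)
    show "norm (y - Q y) \<le> norm y * mN" for y
      using norm_triangle_ineq4[of y "Q y"] mQ(2)[of y] by (simp add: mN_def algebra_simps)
  qed
  obtain \<rho>1 where \<rho>1: "\<rho>1 > 0" "cball a0 \<rho>1 \<subseteq> \<Omega>" using \<Omega>(1) a0 open_contains_cball by blast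
  \<comment> \<open>the factor 4 is a bound for \<open>1 / ((1 - l) * (1 - t))\<close>, by which the component along the disc is enlarged below\<close>
  define r where "r = min (\<rho>0 / (4 * mP)) (\<delta> / (2 * mQ))"
  have r: "r > 0" "r * mP \<le> \<rho>0 / 4" "r * mQ \<le> \<delta> / 2"
  proof -
    show "r > 0" using disc(1) \<delta> mP(1) mQ(1) by (simp add: r_def)
    have "r * mP \<le> \<rho>0 / (4 * mP) * mP" using mP(1) by (intro mult_right_mono) (auto simp: r_def)
    then show "r * mP \<le> \<rho>0 / 4" using mP(1) by simp
    have "r * mQ \<le> \<delta> / (2 * mQ) * mQ" using mQ(1) by (intro mult_right_mono) (auto simp: r_def)
    then show "r * mQ \<le> \<delta> / 2" using mQ(1) by simp
  qed
  define \<rho> where "\<rho> = (\<Sum>j\<in>UNIV. norm (L (axis j 1))) / r"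
  have "\<rho> \<ge> 0" using r by (simp add: \<rho>_def sum_nonneg)
  moreover have "\<exists>A. complex_iso A \<and> (\<forall>j. norm (A (L (axis j 1))) \<le> \<rho>) \<and>
     (\<forall>x\<in>ellipsoid A. norm x \<le> \<delta> \<and> (\<forall>l w. 0 < l \<longrightarrow> l \<le> 1 / 2 \<longrightarrow> w \<in> \<Omega> \<longrightarrow>
        ((1 - l) *\<^sub>R (p + t *\<^sub>R (a0 - p)) + l *\<^sub>R w) + x \<in> \<Omega>))" if t: "0 < t" "t \<le> 1 / 2" for t
  proof -
    define \<epsilon> where "\<epsilon> = min (\<rho>1 * t / (2 * mN)) (\<delta> / (2 * mN))"
    have e: "\<epsilon> > 0" "\<epsilon> * mN \<le> \<rho>1 * t / 2" "\<epsilon> * mN \<le> \<delta> / 2"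
    proof -
      show "\<epsilon> > 0" using \<rho>1(1) \<delta> mN(1) t by (simp add: \<epsilon>_def)
      have "\<epsilon> * mN \<le> \<rho>1 * t / (2 * mN) * mN" using mN(1) by (intro mult_right_mono) (auto simp: \<epsilon>_def)
      then show "\<epsilon> * mN \<le> \<rho>1 * t / 2" using mN(1) by simp
      have "\<epsilon> * mN \<le> \<delta> / (2 * mN) * mN" using mN(1) by (intro mult_right_mono) (auto simp: \<epsilon>_def)
      then show "\<epsilon> * mN \<le> \<delta> / 2" using mN(1) by simp
    qed
    define A where "A y = (1 / r) *\<^sub>R Q y + (1 / \<epsilon>) *\<^sub>R (y - Q y)" for y
    have lA: "linear A" unfolding A_def
      by (rule linearI) (simp_all add: linear_add[OF lQ] linear_scale[OF lQ] algebra_simps)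
    have PA: "P (A y) = (1 / r) *\<^sub>R P y" for y
      unfolding A_def by (simp add: linear_add[OF P(1)] linear_scale[OF P(1)] linear_diff[OF P(1)] PQ)
    have QA: "Q (A y) = (1 / r) *\<^sub>R Q y" for y unfolding Q_def PA by (simp add: linear_scale[OF L(1)])
    have NA: "A y - Q (A y) = (1 / \<epsilon>) *\<^sub>R (y - Q y)" for y unfolding QA by (simp add: A_def)
    have "inj A"
      unfolding linear_injective_0[OF lA]
    proof (intro allI impI)
      fix y assume "A y = 0"
      then have "(1 / r) *\<^sub>R P y = 0" "(1 / \<epsilon>) *\<^sub>R (y - Q y) = 0"
        using PA[of y] NA[of y] linear_0[OF P(1)] linear_0[OF lQ] by auto
      then have "P y = 0" "y = Q y" using r e by auto
      then show "y = 0" using linear_0[OF L(1)] by (simp add: Q_def)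
    qed
    moreover have "A (c *s v) = c *s A v" for c v
    proof -
      have "Q (c *s v) = c *s Q v" by (simp add: Q_def P(2) L(2))
      then show ?thesis by (simp add: A_def vec_eq_iff algebra_simps)
    qed
    ultimately have isoA: "complex_iso A" using lA by (simp add: complex_iso_def)
    have Aj: "norm (A (L (axis j 1))) \<le> \<rho>" for j
    proof -
      have "Q (L (axis j 1)) = L (axis j 1)" by (simp add: Q_def P(3))
      then have "A (L (axis j 1)) = (1 / r) *\<^sub>R L (axis j 1)" by (simp add: A_def)
      then have "norm (A (L (axis j 1))) = norm (L (axis j 1)) / r" using r(1) by simp
      also have "\<dots> \<le> \<rho>" unfolding \<rho>_def using r(1) by (intro divide_right_mono member_le_sum) auto
      finally show ?thesis .
    qed
    have dec: "norm x \<le> \<delta> \<and> (\<forall>l w. 0 < l \<longrightarrow> l \<le> 1 / 2 \<longrightarrow> w \<in> \<Omega> \<longrightarrow>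
        ((1 - l) *\<^sub>R (p + t *\<^sub>R (a0 - p)) + l *\<^sub>R w) + x \<in> \<Omega>)" if x: "x \<in> ellipsoid A" for x
    proof (intro conjI allI impI)
      have n1: "norm (A x) \<le> 1" using x by (simp add: ellipsoid_def)
      have nP: "norm (P x) \<le> r * mP"
      proof -
        have "P x = r *\<^sub>R P (A x)" using r by (simp add: PA)
        then have "norm (P x) = r * norm (P (A x))" using r by simp
        also have "\<dots> \<le> r * (1 * mP)" using r(1) mP n1 by (intro mult_left_mono order_trans[OF mP(2)] mult_right_mono) auto
        finally show ?thesis by simp
      qed
      have nQ: "norm (Q x) \<le> r * mQ"
      proof -
        have "Q x = r *\<^sub>R Q (A x)" using r by (simp add: QA)
        then have "norm (Q x) = r * norm (Q (A x))" using r by simp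
        also have "\<dots> \<le> r * (1 * mQ)" using r(1) mQ n1 by (intro mult_left_mono order_trans[OF mQ(2)] mult_right_mono) auto
        finally show ?thesis by simp
      qed
      have nN: "norm (x - Q x) \<le> \<epsilon> * mN"
      proof -
        have "x - Q x = \<epsilon> *\<^sub>R (A x - Q (A x))" unfolding NA using e by simp
        then have "norm (x - Q x) = \<epsilon> * norm (A x - Q (A x))" using e by simp
        also have "\<dots> \<le> \<epsilon> * (1 * mN)" using e(1) mN n1 by (intro mult_left_mono order_trans[OF mN(2)] mult_right_mono) auto
        finally show ?thesis by simp
      qed
      show "norm x \<le> \<delta>" using norm_triangle_ineq[of "Q x" "x - Q x"] nQ nN r(3) e(3) by simp
      fix l :: real and w assume l: "0 < l" "l \<le> 1 / 2" and w: "w \<in> \<Omega>"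
      define s where "s = 1 / ((1 - l) * (1 - t))"
      have "1 / 2 * (1 / 2) \<le> (1 - l) * (1 - t)" using l t by (intro mult_mono) auto
      then have lt: "1 / 4 \<le> (1 - l) * (1 - t)" by simp
      then have s: "0 < s" "s \<le> 4" unfolding s_def using divide_left_mono[OF lt, of 1] by auto
      define b where "b = p + L (s *\<^sub>R P x)"
      have "norm (s *\<^sub>R P x) \<le> 4 * (r * mP)" using s nP by (simp add: mult_mono)
      then have bC: "b \<in> closure \<Omega>" unfolding b_def using r(2) by (intro disc(2)) simp
      define c where "c = a0 + (1 / (t * (1 - l))) *\<^sub>R (x - Q x)"
      have "norm ((1 / (t * (1 - l))) *\<^sub>R (x - Q x)) \<le> \<rho>1"
      proof -
        have "norm ((1 / (t * (1 - l))) *\<^sub>R (x - Q x)) = norm (x - Q x) / (t * (1 - l))" using t l by simp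
        also have "\<dots> \<le> \<rho>1"
        proof -
          have "norm (x - Q x) \<le> \<rho>1 * t / 2" using nN e(2) by linarith
          also have "\<dots> \<le> \<rho>1 * (t * (1 - l))"
          proof -
            have "t * (1 / 2) \<le> t * (1 - l)" using t l by (intro mult_left_mono) auto
            then have "\<rho>1 * (t * (1 / 2)) \<le> \<rho>1 * (t * (1 - l))" using \<rho>1(1) by (rule mult_left_mono[OF _ less_imp_le])
            then show ?thesis by simp
          qed
          finally show ?thesis using t l by (simp add: pos_divide_le_eq)
        qed
        finally show ?thesis .
      qed
      then have "c \<in> cball a0 \<rho>1" by (simp add: c_def dist_norm)
      then have "c \<in> \<Omega>" using \<rho>1(2) by (rule subsetD[rotated])
      then have "c \<in> interior \<Omega>" using \<Omega>(1) by (simp add: interior_open)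
      from mem_interior_closure_convex_shrink[OF \<Omega>(2) this bC, of t]
      have q: "b - t *\<^sub>R (b - c) \<in> \<Omega>" using t \<Omega>(1) by (simp add: interior_open)
      have "(1 - l) *\<^sub>R (b - t *\<^sub>R (b - c)) + l *\<^sub>R w \<in> \<Omega>"
        using l by (intro convexD[OF \<Omega>(2) q w]) auto
      moreover have "(1 - l) *\<^sub>R (b - t *\<^sub>R (b - c)) + l *\<^sub>R w = ((1 - l) *\<^sub>R (p + t *\<^sub>R (a0 - p)) + l *\<^sub>R w) + x"
      proof -
        have "(1 - l) *\<^sub>R (b - t *\<^sub>R (b - c)) = (1 - l) *\<^sub>R (p + t *\<^sub>R (a0 - p)) + ((1 - l) * (1 - t) * s) *\<^sub>R Q x + ((1 - l) * t * (1 / (t * (1 - l)))) *\<^sub>R (x - Q x)"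
          unfolding b_def c_def Q_def linear_scale[OF L(1)] by (simp add: algebra_simps)
        also have "(1 - l) * (1 - t) * s = 1" using l t by (simp add: s_def)
        also have "(1 - l) * t * (1 / (t * (1 - l))) = 1" using l t by simp
        finally show ?thesis by simp
      qed
      ultimately show "((1 - l) *\<^sub>R (p + t *\<^sub>R (a0 - p)) + l *\<^sub>R w) + x \<in> \<Omega>" by simp
    qed
    show ?thesis by (intro exI[of _ A] conjI isoA allI Aj ballI dec)
  qed
  ultimately show ?thesis by blast
qed

text \<open>
  Chooses the points at which the evaluation norm dominates all earlier functions.
\<close>

lemma sparse_subsequence:
  fixes K M :: "nat \<Rightarrow> real"
  assumes "\<forall>B. \<forall>\<^sub>F k in sequentially. B < K k"
  obtains s :: "nat \<Rightarrow> nat" where "strict_mono s" "\<And>i j. i < j \<Longrightarrow> M (s i) \<le> K (s j)"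
proof -
  have ex: "\<exists>l>m. \<forall>j\<le>m. M j \<le> K l" for m
  proof -
    have "\<forall>\<^sub>F k in sequentially. Max (M ` {..m}) < K k \<and> m < k"
      using assms by (intro eventually_conj eventually_gt_at_top) blast
    then obtain l where l: "Max (M ` {..m}) < K l" "m < l" by (auto simp: eventually_sequentially)
    have "M j \<le> K l" if "j \<le> m" for j
    proof -
      have "M j \<le> Max (M ` {..m})" using that by (intro Max_ge) auto
      then show ?thesis using l(1) by linarith
    qed
    with l(2) show ?thesis by blast
  qed
  define nxt where "nxt m = (SOME l. l > m \<and> (\<forall>j\<le>m. M j \<le> K l))" for m
  have nxt: "nxt m > m" "\<And>j. j \<le> m \<Longrightarrow> M j \<le> K (nxt m)" for m
    using someI_ex[OF ex[of m]] by (auto simp: nxt_def)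
  define s where "s = rec_nat 0 (\<lambda>_. nxt)"
  have sS: "s (Suc n) = nxt (s n)" for n by (simp add: s_def)
  have mono: "strict_mono s" by (rule strict_monoI_Suc) (simp add: sS nxt(1))
  have "M (s i) \<le> K (s j)" if "i < j" for i j
  proof -
    obtain j' where j: "j = Suc j'" "i \<le> j'" using \<open>i < j\<close> by (cases j) auto
    have "s i \<le> s j'" using mono j(2) by (simp add: strict_mono_less_eq)
    then show ?thesis unfolding j(1) sS by (rule nxt(2))
  qed
  with mono show ?thesis by (rule that)
qed

theorem theorem1:
  fixes \<Omega> :: "(complex, 'n::{finite,linorder}) vec set"
    and \<phi> :: "(complex, 'n) vec \<Rightarrow> complex"
    and \<psi> :: "complex ^ 'q \<Rightarrow> (complex, 'n) vec"
  assumes "CARD('n) \<ge> 2"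
    and "open \<Omega>" and "\<Omega> \<noteq> {}" and "bounded \<Omega>" and "convex \<Omega>"
    and "C1_closure \<Omega> \<phi>"
    and "1 \<le> CARD('q)" and "CARD('q) \<le> CARD('n) - 1"
    and "holomorphic_embedding_on \<psi> polydisc"
    and "\<psi> ` polydisc \<subseteq> frontier \<Omega>"
    and "\<not> holomorphic_fun_on (\<phi> \<circ> \<psi>) polydisc"
  shows "\<not> compact_operator_on (CARD('q) - 1) \<Omega> (A2_forms (CARD('q) - 1) \<Omega>)
             (hankel (CARD('q) - 1) \<Omega> \<phi>)
       \<and> \<not> compact_operator_on (CARD('q) - 1) \<Omega> (K2_forms (CARD('q) - 1) \<Omega>)
             (hankel (CARD('q) - 1) \<Omega> \<phi>)"
proof -
  define p where "p = CARD('q) - 1"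
  have \<Omega>: "open \<Omega>" "bounded \<Omega>" and conv: "convex \<Omega>" and ne: "\<Omega> \<noteq> {}" using assms by auto
  have "\<not> compact_operator_on p \<Omega> (A2_forms p \<Omega>) (hankel p \<Omega> \<phi>)"
  proof
    assume compact: "compact_operator_on p \<Omega> (A2_forms p \<Omega>) (hankel p \<Omega> \<phi>)"
    obtain Db :: "(complex, 'n) vec \<Rightarrow> (complex, 'n) vec \<Rightarrow>\<^sub>L complex" where
      c\<phi>: "continuous_on (closure \<Omega>) \<phi>" and cD: "continuous_on (closure \<Omega>) Db"
      and d\<phi>: "\<And>z. z \<in> \<Omega> \<Longrightarrow> (\<phi> has_derivative blinfun_apply (Db z)) (at z)"
      using \<open>C1_closure \<Omega> \<phi>\<close> unfolding C1_closure_def by blast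
    have ccl: "compact (closure \<Omega>)" using \<Omega>(2) by (simp add: compact_closure)
    have OC: "\<Omega> \<subseteq> closure \<Omega>" by (rule closure_subset)

    \<comment> \<open>\<open>i0\<close> is a direction in which the symbol is not holomorphic; the other basis vectors complete the frame\<close>
    have hol: "holomorphic_map_on \<psi> polydisc" using assms(9) by (simp add: holomorphic_embedding_on_def)
    have imC: "\<psi> ` polydisc \<subseteq> closure \<Omega>" using assms(10) by (auto simp: frontier_def)
    obtain z0 L i0 where z0: "z0 \<in> polydisc" and L: "(\<psi> has_derivative L) (at z0)" and Ls: "\<And>c v. L (c *s v) = c *s L v"
      and nz: "dbar_dir (blinfun_apply (Db (\<psi> z0))) (L (axis i0 1)) \<noteq> 0"
      by (rule nonholomorphic_direction[OF hol imC C1_closure_has_derivative[OF \<Omega>(1) conv ne c\<phi> cD d\<phi>] assms(11)]) auto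
    have lL: "linear L" using L by (rule has_derivative_linear)
    have injL: "inj L"
      using assms(9) z0 frechet_derivative_at[OF L] by (auto simp: holomorphic_embedding_on_def)
    obtain P where P: "linear P" "\<And>c v. P (c *s v) = c *s P v" "\<And>v. P (L v) = v"
      and dual0: "\<And>i j. conj_pair (\<lambda>k. cnj (P (axis k 1) $ i)) (L (axis j 1)) = (if i = j then 1 else 0)"
      using complex_left_inverse[OF lL Ls injL] by blast
    define pt where "pt = \<psi> z0"
    have pF: "pt \<in> frontier \<Omega>" using assms(10) z0 by (auto simp: pt_def)
    then have pC: "pt \<in> closure \<Omega>" by (simp add: frontier_def)
    obtain \<rho>0 where \<rho>0: "\<rho>0 > 0" "\<And>w. norm w \<le> \<rho>0 \<Longrightarrow> pt + L w \<in> closure \<Omega>"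
      using tangent_disc_in_closure[OF conv hol imC z0 L Ls] unfolding pt_def by blast
    obtain a0 where a0: "a0 \<in> \<Omega>" using ne by blast
    obtain b where b: "\<And>x. x \<in> \<Omega> \<Longrightarrow> 0 < Re (herm_pair b (x - pt))"
      using supporting_functional[OF \<Omega>(1) conv pF] by blast

    \<comment> \<open>\<open>\<theta>\<close> is 1 on the remaining frame vectors and is annihilated by \<open>v1\<close>, so that only the derivative of the symbol along \<open>v1\<close> is tested\<close>
    define v1 where "v1 = L (axis i0 1)"
    obtain js where js: "set js = - {i0}" "distinct js" using finite_distinct_list[of "- {i0}"] by auto
    define vs where "vs = map (\<lambda>j. L (axis j 1)) js"
    define ws where "ws = map (\<lambda>i k. cnj (P (axis k 1) $ i)) js"
    have len: "length vs = p"
    proof -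
      have "length js = card (- {i0})" using js by (metis distinct_card)
      also have "\<dots> = p" by (simp add: p_def Compl_eq_Diff_UNIV)
      finally show ?thesis by (simp add: vs_def)
    qed
    have dual1: "conj_pair w v1 = 0" if w: "w \<in> set ws" for w
    proof -
      obtain i where i: "i \<in> set js" "w = (\<lambda>k. cnj (P (axis k 1) $ i))" using w unfolding ws_def set_map by blast
      then have "i \<noteq> i0" unfolding js(1) by blast
      then show ?thesis unfolding i(2) v1_def dual0 by simp
    qed
    have dual2: "contract_list vs (wedge_list ws) {} = 1"
    proof (rule contract_list_dual)
      show "list_all2 (\<lambda>v w. conj_pair w v = 1) vs ws"
        by (simp add: vs_def ws_def list_all2_conv_all_nth dual0)
      show "conj_pair (ws ! j) (vs ! i) = 0" if "i < length vs" "j < length ws" "i \<noteq> j" for i j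
        using that js(2) by (simp add: vs_def ws_def dual0 nth_eq_iff_index_eq)
    qed
    define \<theta> where "\<theta> = wedge_list ws"

    \<comment> \<open>half of its value at \<open>pt\<close> bounds \<open>\<Phi>\<close> from below near \<open>pt\<close>\<close>
    define \<Phi> where "\<Phi> z = dbar_dir (blinfun_apply (Db z)) v1" for z
    have c\<Phi>: "continuous_on (closure \<Omega>) \<Phi>"
      unfolding \<Phi>_def dbar_dir_def by (intro continuous_intros cD) simp
    have uc: "uniformly_continuous_on (closure \<Omega>) \<Phi>" by (rule compact_uniformly_continuous[OF c\<Phi> ccl])
    define c0 where "c0 = cmod (\<Phi> pt) / 2"
    have c0: "c0 > 0" using nz by (simp add: c0_def \<Phi>_def pt_def v1_def)
    obtain \<delta>1 where \<delta>1: "\<delta>1 > 0" "\<And>x y. x \<in> closure \<Omega> \<Longrightarrow> y \<in> closure \<Omega> \<Longrightarrow> dist x y < \<delta>1 \<Longrightarrow> dist (\<Phi> x) (\<Phi> y) < c0"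
      using uc c0 unfolding uniformly_continuous_on_def by metis
    have \<Phi>_ge: "c0 \<le> cmod (\<Phi> x)" if "x \<in> closure \<Omega>" "dist x pt < \<delta>1" for x
    proof -
      have "dist (\<Phi> x) (\<Phi> pt) < c0" by (rule \<delta>1(2)[OF that(1) pC that(2)])
      then have "cmod (\<Phi> pt) - cmod (\<Phi> x) < c0"
        using norm_triangle_ineq2[of "\<Phi> pt" "\<Phi> x"] by (simp add: dist_norm norm_minus_commute)
      then show ?thesis by (simp add: c0_def)
    qed
    have bD: "\<exists>B. \<forall>z\<in>\<Omega>. cmod (blinfun_apply (Db z) v) \<le> B" for v
    proof -
      have "compact ((\<lambda>z. blinfun_apply (Db z) v) ` closure \<Omega>)"
        by (intro compact_continuous_image ccl continuous_intros cD)
      from compact_imp_bounded[OF this] obtain B where "\<forall>z\<in>closure \<Omega>. cmod (blinfun_apply (Db z) v) \<le> B"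
        by (auto simp: bounded_iff)
      then show ?thesis using OC by blast
    qed
    have b\<phi>: "bounded (\<phi> ` \<Omega>)"
      by (rule bounded_subset[OF compact_imp_bounded[OF compact_continuous_image[OF c\<phi> ccl]] image_mono[OF OC]])
    note ke = key_estimate[OF \<Omega> d\<phi> bD b\<phi> dual1 dual2 len, folded \<Phi>_def \<theta>_def]
    obtain C where C: "C \<ge> 0" and key: "\<And>A \<rho> \<omega> c0 G f \<kappa>. complex_iso A \<Longrightarrow> open G \<Longrightarrow> (\<forall>z\<in>G. \<forall>w\<in>ellipsoid A. z + w \<in> \<Omega>) \<Longrightarrow>
      0 \<le> \<rho> \<Longrightarrow> (\<forall>v\<in>set (v1 # vs). norm (A v) \<le> \<rho>) \<Longrightarrow>
      0 \<le> \<omega> \<Longrightarrow> (\<forall>z\<in>G. \<forall>w\<in>ellipsoid A. cmod (\<Phi> (z + w) - \<Phi> z) \<le> \<omega>) \<Longrightarrow>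
      0 \<le> c0 \<Longrightarrow> (\<forall>z\<in>G. c0 \<le> cmod (\<Phi> z)) \<Longrightarrow>
      f \<in> bounded_holomorphic \<Omega> \<Longrightarrow> \<kappa> \<in> K2_forms p \<Omega> \<Longrightarrow>
      c0\<^sup>2 * sq_mass G f \<le> C * (\<omega>\<^sup>2 * sq_mass \<Omega> f + \<rho>\<^sup>2 * L2_sq p \<Omega> (\<lambda>J z. \<phi> z * (f z * \<theta> J) - \<kappa> J z))"
      using ke by blast

    \<comment> \<open>the bounds on \<open>l\<close> and on \<open>t k\<close> keep the homothetic copies in the ball of radius \<open>\<delta>1\<close> around \<open>pt\<close>, where \<open>\<Phi>\<close> is at least \<open>c0\<close>\<close>
    obtain R where R: "R > 0" "\<And>x. x \<in> \<Omega> \<Longrightarrow> norm x \<le> R" using \<Omega>(2) bounded_pos by blast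
    define l where "l = min (1 / 2) (\<delta>1 / (8 * R))"
    have l: "0 < l" "l \<le> 1 / 2" "l * (2 * R) < \<delta>1 / 2"
    proof -
      show "0 < l" "l \<le> 1 / 2" using \<delta>1(1) R(1) by (simp_all add: l_def)
      have "l * (2 * R) \<le> \<delta>1 / (8 * R) * (2 * R)" using R(1) by (intro mult_right_mono) (auto simp: l_def)
      also have "\<dots> = \<delta>1 / 4" using R(1) by simp
      finally show "l * (2 * R) < \<delta>1 / 2" using \<delta>1(1) by linarith
    qed
    define \<tau> where "\<tau> = min 1 (\<delta>1 / (norm (a0 - pt) + 1))"
    have np: "norm (a0 - pt) + 1 > 0" by (rule add_nonneg_pos) auto
    have \<tau>: "0 < \<tau>" "\<tau> \<le> 1" "\<tau> * norm (a0 - pt) \<le> \<delta>1"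
    proof -
      show "0 < \<tau>" "\<tau> \<le> 1" using \<delta>1(1) np by (simp_all add: \<tau>_def)
      have "\<tau> * norm (a0 - pt) \<le> \<delta>1 / (norm (a0 - pt) + 1) * (norm (a0 - pt) + 1)"
        using np \<delta>1(1) by (intro mult_mono) (auto simp: \<tau>_def)
      then show "\<tau> * norm (a0 - pt) \<le> \<delta>1" using np by simp
    qed
    define t where "t k = \<tau> * (1 / real (Suc (Suc k)))" for k
    have t: "0 < t k" "t k \<le> 1 / 2" "t k * norm (a0 - pt) \<le> \<delta>1 / 2" for k
    proof -
      have h: "1 / real (Suc (Suc k)) \<le> 1 / 2" by simp
      show "0 < t k" using \<tau>(1) by (simp add: t_def)
      have "t k \<le> 1 * (1 / 2)" unfolding t_def using \<tau> h by (intro mult_mono) auto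
      then show "t k \<le> 1 / 2" by simp
      have "t k * norm (a0 - pt) = (\<tau> * norm (a0 - pt)) * (1 / real (Suc (Suc k)))" by (simp add: t_def)
      also have "\<dots> \<le> \<delta>1 * (1 / 2)" using \<tau> h \<delta>1(1) by (intro mult_mono) auto
      finally show "t k * norm (a0 - pt) \<le> \<delta>1 / 2" by simp
    qed
    have t0: "t \<longlonglongrightarrow> 0"
    proof -
      have "(\<lambda>k. \<tau> * (1 / real (Suc (Suc k)))) \<longlonglongrightarrow> \<tau> * 0"
        by (intro tendsto_mult tendsto_const LIMSEQ_Suc[OF LIMSEQ_Suc[OF lim_1_over_n]])
      then show ?thesis by (simp add: t_def[abs_def])
    qed
    define a where "a k = pt + t k *\<^sub>R (a0 - pt)" for k
    have aO: "a k \<in> \<Omega>" for k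
    proof -
      have "a0 \<in> interior \<Omega>" using a0 \<Omega>(1) by (simp add: interior_open)
      from mem_interior_closure_convex_shrink[OF conv this pC, of "t k"]
      have "pt - t k *\<^sub>R (pt - a0) \<in> interior \<Omega>" using t[of k] by simp
      moreover have "pt - t k *\<^sub>R (pt - a0) = a k" by (simp add: a_def algebra_simps)
      ultimately show ?thesis using \<Omega>(1) by (simp add: interior_open)
    qed
    have "\<forall>k. \<exists>K g. K > 0 \<and> (\<forall>f\<in>bounded_holomorphic \<Omega>. cmod (f (a k)) \<le> K * sqrt (sq_mass \<Omega> f))
       \<and> g \<in> bounded_holomorphic \<Omega> \<and> sq_mass \<Omega> g \<le> 1 \<and> K / 2 \<le> cmod (g (a k))"
      using evaluation_norm_exists[OF \<Omega> aO] by meson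
    from choice[OF this] obtain K where "\<forall>k. \<exists>g. K k > 0 \<and> (\<forall>f\<in>bounded_holomorphic \<Omega>. cmod (f (a k)) \<le> K k * sqrt (sq_mass \<Omega> f))
       \<and> g \<in> bounded_holomorphic \<Omega> \<and> sq_mass \<Omega> g \<le> 1 \<and> K k / 2 \<le> cmod (g (a k))" by blast
    from choice[OF this] obtain g where K: "\<And>k. K k > 0" "\<And>k f. f \<in> bounded_holomorphic \<Omega> \<Longrightarrow> cmod (f (a k)) \<le> K k * sqrt (sq_mass \<Omega> f)"
       and g: "\<And>k. g k \<in> bounded_holomorphic \<Omega>" "\<And>k. sq_mass \<Omega> (g k) \<le> 1" "\<And>k. K k / 2 \<le> cmod (g k (a k))" by blast
    have "\<forall>k. \<exists>M. \<forall>x\<in>\<Omega>. cmod (g k x) \<le> M" using g(1) by (auto simp: bounded_holomorphic_def bounded_iff)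
    from choice[OF this] obtain M where M: "\<And>k x. x \<in> \<Omega> \<Longrightarrow> cmod (g k x) \<le> M k" by blast
    have blow: "\<forall>B. \<forall>\<^sub>F k in sequentially. B < K k"
      by (rule evaluation_norm_blowup[OF \<Omega> b a0 t(1) t0]) (use aO K(2) in \<open>auto simp: a_def\<close>)
    obtain s :: "nat \<Rightarrow> nat" where s: "strict_mono s" "\<And>i j. i < j \<Longrightarrow> 4 * M (s i) \<le> K (s j)"
      by (rule sparse_subsequence[OF blow, where M = "\<lambda>k. 4 * M k"]) blast

    \<comment> \<open>\<open>a k\<close> is the fixed point of the homothety onto \<open>G k\<close>: the value of a difference there is not changed by composition, and it is at least a quarter of the evaluation norm\<close>
    define G where "G k = (\<lambda>w. (1 - l) *\<^sub>R a k + l *\<^sub>R w) ` \<Omega>" for k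
    define m0 where "m0 = l ^ DIM((complex, 'n) vec) / 16"
    have m0: "m0 > 0" using l(1) by (simp add: m0_def)
    have TO: "(1 - l) *\<^sub>R a k + l *\<^sub>R w \<in> \<Omega>" if "w \<in> \<Omega>" for k w
      using l by (intro convexD[OF conv aO that]) auto
    have mass: "m0 \<le> sq_mass (G (s j)) (\<lambda>z. g (s j) z - g (s i) z)" if ij: "i < j" for i j
    proof -
      define f where "f z = g (s j) z - g (s i) z" for z
      have fB: "f \<in> bounded_holomorphic \<Omega>" unfolding f_def[abs_def] by (rule bounded_holomorphic_diff[OF g(1) g(1)])
      let ?T = "\<lambda>w. (1 - l) *\<^sub>R a (s j) + l *\<^sub>R w"
      have fTB: "(\<lambda>w. f (?T w)) \<in> bounded_holomorphic \<Omega>"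
        by (rule bounded_holomorphic_affine[OF fB TO])
      have "cmod (f (a (s j))) \<ge> K (s j) / 2 - K (s j) / 4"
        using norm_triangle_ineq2[of "g (s j) (a (s j))" "g (s i) (a (s j))"] g(3)[of "s j"] M[OF aO, of "s i" "s j"] s(2)[OF ij]
        by (simp add: f_def)
      then have "K (s j) / 4 \<le> cmod (f (a (s j)))" by simp
      also have "f (a (s j)) = (\<lambda>w. f (?T w)) (a (s j))" by (simp add: scaleR_left_distrib[symmetric])
      also have "cmod \<dots> \<le> K (s j) * sqrt (sq_mass \<Omega> (\<lambda>w. f (?T w)))" by (rule K(2)[OF fTB])
      finally have "K (s j) * (1 / 4) \<le> K (s j) * sqrt (sq_mass \<Omega> (\<lambda>w. f (?T w)))" by simp
      then have "1 / 4 \<le> sqrt (sq_mass \<Omega> (\<lambda>w. f (?T w)))" by (rule mult_left_le_imp_le[OF _ K(1)])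
      then have "(1 / 4)\<^sup>2 \<le> (sqrt (sq_mass \<Omega> (\<lambda>w. f (?T w))))\<^sup>2" by (intro power_mono) auto
      then have i16: "1 / 16 \<le> sq_mass \<Omega> (\<lambda>w. f (?T w))" by (simp add: sq_mass_nonneg power2_eq_square)
      have "continuous_on (?T ` \<Omega>) f"
      proof (rule continuous_on_subset)
        show "continuous_on \<Omega> f" using fB by (simp add: bounded_holomorphic_def holomorphic_fun_on_imp_continuous_on)
      qed (use TO in auto)
      then have "sq_mass (G (s j)) f = l ^ DIM((complex, 'n) vec) * sq_mass \<Omega> (\<lambda>w. f (?T w))"
        unfolding G_def by (rule sq_mass_homothety[OF \<Omega>(1) l(1)])
      also have "\<dots> \<ge> l ^ DIM((complex, 'n) vec) * (1 / 16)" using i16 l(1) by (intro mult_left_mono) auto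
      finally show ?thesis unfolding m0_def f_def by simp
    qed
    have mass4: "sq_mass \<Omega> (\<lambda>z. g j z - g i z) \<le> 4" for i j
    proof -
      have sg: "sqint (lebesgue_on \<Omega>) (g k)" for k by (rule bounded_holomorphic_sqint[OF \<Omega> g(1)])
      have "sq_mass \<Omega> (\<lambda>z. g j z - g i z) \<le> (LINT z|lebesgue_on \<Omega>. 2 * (cmod (g j z))\<^sup>2 + 2 * (cmod (g i z))\<^sup>2)"
        unfolding sq_mass_def
        by (intro integral_mono cmod_diff_sq_le sqint_integrable[OF sqint_diff[OF sg sg]] Bochner_Integration.integrable_add integrable_mult_right sqint_integrable[OF sg])
      also have "\<dots> = 2 * sq_mass \<Omega> (g j) + 2 * sq_mass \<Omega> (g i)"
        unfolding sq_mass_def using sqint_integrable[OF sg] by simp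
      also have "\<dots> \<le> 4" using g(2)[of i] g(2)[of j] by simp
      finally show ?thesis .
    qed
    have near: "dist z pt < \<delta>1 \<and> z \<in> \<Omega>" if zG: "z \<in> G k" for z k
    proof -
      obtain w where w: "w \<in> \<Omega>" "z = (1 - l) *\<^sub>R a k + l *\<^sub>R w" using zG by (auto simp: G_def)
      have "z - pt = t k *\<^sub>R (a0 - pt) + l *\<^sub>R (w - a k)" unfolding w(2) by (simp add: a_def algebra_simps)
      then have "norm (z - pt) \<le> t k * norm (a0 - pt) + l * norm (w - a k)"
        using norm_triangle_ineq[of "t k *\<^sub>R (a0 - pt)" "l *\<^sub>R (w - a k)"] t(1)[of k] l(1) by simp
      moreover have "l * norm (w - a k) \<le> l * (2 * R)"
        using norm_triangle_ineq4[of w "a k"] R(2)[OF w(1)] R(2)[OF aO[of k]] l(1) by (intro mult_left_mono) auto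
      ultimately have "norm (z - pt) < \<delta>1" using t(3)[of k] l(3) by linarith
      then show ?thesis using TO[OF w(1)] w(2) by (simp add: dist_norm)
    qed

    \<comment> \<open>as differences have mass at most 4, this \<open>\<omega>\<close> makes the first term of the key estimate at most a quarter of \<open>c0\<^sup>2 * m0\<close>; it determines the size of the ellipsoids before the sequence is thinned out\<close>
    define \<omega> where "\<omega> = sqrt (c0\<^sup>2 * m0 / (16 * (C + 1)))"
    have \<omega>: "\<omega> > 0" "\<omega>\<^sup>2 = c0\<^sup>2 * m0 / (16 * (C + 1))"
      unfolding \<omega>_def using c0 m0 C by (auto intro!: divide_pos_pos mult_pos_pos)
    obtain \<delta>2 where \<delta>2: "\<delta>2 > 0" "\<And>x y. x \<in> closure \<Omega> \<Longrightarrow> y \<in> closure \<Omega> \<Longrightarrow> dist x y < \<delta>2 \<Longrightarrow> dist (\<Phi> x) (\<Phi> y) < \<omega>"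
      using uc \<omega>(1) unfolding uniformly_continuous_on_def by metis
    have "\<delta>2 / 2 > 0" using \<delta>2(1) by simp
    from anisotropic_ellipsoids[OF \<Omega>(1) conv a0 lL Ls P \<rho>0 this]
    obtain \<rho> where \<rho>: "\<rho> \<ge> 0" and ell: "\<And>t. 0 < t \<Longrightarrow> t \<le> 1 / 2 \<Longrightarrow> \<exists>A. complex_iso A \<and> (\<forall>j. norm (A (L (axis j 1))) \<le> \<rho>) \<and>
     (\<forall>x\<in>ellipsoid A. norm x \<le> \<delta>2 / 2 \<and> (\<forall>l w. 0 < l \<longrightarrow> l \<le> 1 / 2 \<longrightarrow> w \<in> \<Omega> \<longrightarrow>
        ((1 - l) *\<^sub>R (pt + t *\<^sub>R (a0 - pt)) + l *\<^sub>R w) + x \<in> \<Omega>))" by blast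
    have lower: "c0\<^sup>2 * m0 \<le> C * (\<omega>\<^sup>2 * 4 + \<rho>\<^sup>2 * L2_sq p \<Omega> (\<lambda>J z. \<phi> z * ((g (s j) z - g (s i) z) * \<theta> J) - \<kappa> J z))"
      if ij: "i < j" and \<kappa>: "\<kappa> \<in> K2_forms p \<Omega>" for i j \<kappa>
    proof -
      let ?k = "s j"
      obtain A where A: "complex_iso A" "\<And>i. norm (A (L (axis i 1))) \<le> \<rho>" "\<And>x. x \<in> ellipsoid A \<Longrightarrow> norm x \<le> \<delta>2 / 2"
        and Ain: "\<And>x w. x \<in> ellipsoid A \<Longrightarrow> w \<in> \<Omega> \<Longrightarrow> ((1 - l) *\<^sub>R (pt + t ?k *\<^sub>R (a0 - pt)) + l *\<^sub>R w) + x \<in> \<Omega>"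
        using ell[OF t(1,2)[of ?k]] l(1,2) by blast
      have GE: "z + x \<in> \<Omega>" if "z \<in> G ?k" "x \<in> ellipsoid A" for z x
        using that Ain[OF that(2)] by (auto simp: G_def a_def)
      define f where "f z = g ?k z - g (s i) z" for z
      have "c0\<^sup>2 * sq_mass (G ?k) f \<le> C * (\<omega>\<^sup>2 * sq_mass \<Omega> f + \<rho>\<^sup>2 * L2_sq p \<Omega> (\<lambda>J z. \<phi> z * (f z * \<theta> J) - \<kappa> J z))"
      proof (rule key[OF A(1)])
        show "open (G ?k)" unfolding G_def using open_affinity[OF \<Omega>(1), of l "(1 - l) *\<^sub>R a ?k"] l(1) by simp
        show "\<forall>z\<in>G ?k. \<forall>w\<in>ellipsoid A. z + w \<in> \<Omega>" using GE by blast
        show "\<forall>v\<in>set (v1 # vs). norm (A v) \<le> \<rho>" using A(2) by (auto simp: v1_def vs_def)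
        show "\<forall>z\<in>G ?k. \<forall>w\<in>ellipsoid A. cmod (\<Phi> (z + w) - \<Phi> z) \<le> \<omega>"
        proof (intro ballI)
          fix z w assume z: "z \<in> G ?k" and w: "w \<in> ellipsoid A"
          have "dist (z + w) z < \<delta>2" using A(3)[OF w] \<delta>2(1) by (simp add: dist_norm)
          moreover have "z + w \<in> closure \<Omega>" "z \<in> closure \<Omega>" using GE[OF z w] near[OF z] OC by auto
          ultimately have "dist (\<Phi> (z + w)) (\<Phi> z) < \<omega>" by (intro \<delta>2(2))
          then show "cmod (\<Phi> (z + w) - \<Phi> z) \<le> \<omega>" by (simp add: dist_norm)
        qed
        show "\<forall>z\<in>G ?k. c0 \<le> cmod (\<Phi> z)" using near \<Phi>_ge OC by blast
        show "f \<in> bounded_holomorphic \<Omega>" unfolding f_def[abs_def] by (rule bounded_holomorphic_diff[OF g(1) g(1)])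
      qed (use \<rho> \<omega> c0 \<kappa> in auto)
      moreover have "c0\<^sup>2 * m0 \<le> c0\<^sup>2 * sq_mass (G ?k) f"
        using mass[OF ij] unfolding f_def[abs_def] by (intro mult_left_mono) auto
      moreover have "C * (\<omega>\<^sup>2 * sq_mass \<Omega> f + X) \<le> C * (\<omega>\<^sup>2 * 4 + X)" for X
        using mass4[of ?k "s i"] C unfolding f_def[abs_def] by (intro mult_left_mono add_right_mono) auto
      ultimately show ?thesis unfolding f_def by (meson order_trans)
    qed
    define \<alpha> where "\<alpha> k = (\<lambda>J z. g (s k) z * \<theta> J)" for k :: nat
    have \<alpha>A: "\<alpha> k \<in> A2_forms p \<Omega>" for k unfolding \<alpha>_def by (rule holomorphic_form_in_A2[OF \<Omega> g(1)])
    have "L2_norm p \<Omega> (\<alpha> k) \<le> sqrt (\<Sum>J | card J = p. (cmod (\<theta> J))\<^sup>2)" for k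
    proof -
      have "(LINT z|lebesgue_on \<Omega>. (cmod (\<alpha> k J z))\<^sup>2) \<le> (cmod (\<theta> J))\<^sup>2" for J
      proof -
        have "(LINT z|lebesgue_on \<Omega>. (cmod (\<alpha> k J z))\<^sup>2) = (cmod (\<theta> J))\<^sup>2 * sq_mass \<Omega> (g (s k))"
          by (simp add: \<alpha>_def sq_mass_def norm_mult power_mult_distrib)
        also have "\<dots> \<le> (cmod (\<theta> J))\<^sup>2 * 1" using g(2) by (intro mult_left_mono) auto
        finally show ?thesis by simp
      qed
      then show ?thesis unfolding L2_norm_def by (intro real_sqrt_le_mono sum_mono)
    qed
    then obtain r h where r: "strict_mono r" and h: "h \<in> L2_forms p \<Omega>"
      and lim: "(\<lambda>m. L2_norm p \<Omega> (\<lambda>J z. hankel p \<Omega> \<phi> (\<alpha> (r m)) J z - h J z)) \<longlonglongrightarrow> 0"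
      using compact \<alpha>A unfolding compact_operator_on_def by blast
    define \<beta> where "\<beta> m = (\<lambda>J z. hankel p \<Omega> \<phi> (\<alpha> (r m)) J z - h J z)" for m
    have lim2: "(\<lambda>m. L2_sq p \<Omega> (\<beta> m)) \<longlonglongrightarrow> 0"
    proof -
      have "(\<lambda>m. (L2_norm p \<Omega> (\<beta> m))\<^sup>2) \<longlonglongrightarrow> 0\<^sup>2"
        by (rule tendsto_power) (use lim in \<open>simp add: \<beta>_def\<close>)
      then show ?thesis by (simp add: L2_norm_eq L2_sq_nonneg)
    qed
    have \<phi>\<alpha>: "(\<lambda>J z. \<phi> z * \<alpha> k J z) \<in> L2_forms p \<Omega>" for k
      unfolding L2_forms_iff
    proof (intro allI impI)
      fix J :: "'n set" assume J: "card J = p"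
      obtain B where "\<And>x. x \<in> \<Omega> \<Longrightarrow> cmod (\<phi> x) \<le> B" using b\<phi> by (auto simp: bounded_iff)
      moreover have "\<phi> \<in> borel_measurable (lebesgue_on \<Omega>)"
        using \<Omega>(1) continuous_on_subset[OF c\<phi> OC] by (intro continuous_imp_measurable_on_sets_lebesgue) auto
      moreover have "sqint (lebesgue_on \<Omega>) (\<alpha> k J)"
        using \<alpha>A[of k] J by (auto simp: A2_forms_def K2_forms_def L2_forms_iff)
      ultimately show "sqint (lebesgue_on \<Omega>) (\<lambda>z. \<phi> z * \<alpha> k J z)"
        by (intro sqint_mult_bounded[of _ _ _ B]) auto
    qed
    define \<pi> where "\<pi> k = bergman_projection p \<Omega> (\<lambda>J z. \<phi> z * \<alpha> k J z)" for k
    have \<pi>K: "\<pi> k \<in> K2_forms p \<Omega>" for k unfolding \<pi>_def by (rule bergman_projection_in_K2[OF \<Omega> \<phi>\<alpha>])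
    have hank: "hankel p \<Omega> \<phi> (\<alpha> k) = (\<lambda>J z. \<phi> z * \<alpha> k J z - \<pi> k J z)" for k
      by (simp add: hankel_def \<pi>_def)
    have \<beta>L: "\<beta> m \<in> L2_forms p \<Omega>" for m
      unfolding \<beta>_def hank by (intro L2_forms_diff \<phi>\<alpha> h) (use \<pi>K in \<open>simp add: K2_forms_def\<close>)
    \<comment> \<open>makes the second term of the key estimate at most a quarter of \<open>c0\<^sup>2 * m0\<close>\<close>
    define e where "e = c0\<^sup>2 * m0 / (16 * (C + 1) * (\<rho>\<^sup>2 + 1))"
    have e: "e > 0" unfolding e_def using c0 m0 C by (intro divide_pos_pos mult_pos_pos add_nonneg_pos) auto
    have "\<forall>\<^sub>F m in sequentially. L2_sq p \<Omega> (\<beta> m) < e" using order_tendstoD(2)[OF lim2 e] .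
    then obtain m where m: "L2_sq p \<Omega> (\<beta> m) < e" "L2_sq p \<Omega> (\<beta> (Suc m)) < e"
      unfolding eventually_sequentially by (meson le_SucI order_refl)
    define i where "i = r m"
    define j where "j = r (Suc m)"
    have ij: "i < j" using r by (simp add: i_def j_def strict_mono_def)
    define \<kappa> where "\<kappa> = (\<lambda>J z. \<pi> j J z - 1 * \<pi> i J z)"
    have \<kappa>K: "\<kappa> \<in> K2_forms p \<Omega>" unfolding \<kappa>_def by (rule K2_forms_diff_cmult[OF \<Omega> \<pi>K \<pi>K])
    have "(\<lambda>J z. \<phi> z * ((g (s j) z - g (s i) z) * \<theta> J) - \<kappa> J z) = (\<lambda>J z. \<beta> (Suc m) J z - \<beta> m J z)"
      unfolding \<beta>_def hank \<kappa>_def i_def j_def by (simp add: fun_eq_iff \<alpha>_def algebra_simps)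
    then have "L2_sq p \<Omega> (\<lambda>J z. \<phi> z * ((g (s j) z - g (s i) z) * \<theta> J) - \<kappa> J z) \<le> 2 * L2_sq p \<Omega> (\<beta> (Suc m)) + 2 * L2_sq p \<Omega> (\<beta> m)"
      using L2_sq_diff_le[OF \<beta>L \<beta>L] by simp
    also have "\<dots> \<le> 4 * e" using m by simp
    finally have u: "L2_sq p \<Omega> (\<lambda>J z. \<phi> z * ((g (s j) z - g (s i) z) * \<theta> J) - \<kappa> J z) \<le> 4 * e" .
    have "c0\<^sup>2 * m0 \<le> C * (\<omega>\<^sup>2 * 4 + \<rho>\<^sup>2 * (4 * e))"
      by (rule order_trans[OF lower[OF ij \<kappa>K]]) (intro mult_left_mono add_left_mono u C, simp)
    also have "\<dots> \<le> (C + 1) * (\<omega>\<^sup>2 * 4 + (\<rho>\<^sup>2 + 1) * (4 * e))"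
      using C e by (intro mult_mono add_left_mono mult_right_mono) auto
    also have "\<dots> = c0\<^sup>2 * m0 / 2"
    proof -
      have C1: "C + 1 > 0" "\<rho>\<^sup>2 + 1 > 0" using C by (simp_all add: add_nonneg_pos)
      have "x * (y / (16 * x) * 4 + w * (4 * (y / (16 * x * w)))) = y / 2" if "x > 0" "w > 0" for x y w :: real
        using that by (simp add: distrib_left)
      from this[OF C1] show ?thesis unfolding \<omega>(2) e_def .
    qed
    finally show False using c0 m0 by (simp add: mult_le_0_iff)
  qed
  moreover have "compact_operator_on p \<Omega> (A2_forms p \<Omega>) (hankel p \<Omega> \<phi>)"
    if "compact_operator_on p \<Omega> (K2_forms p \<Omega>) (hankel p \<Omega> \<phi>)"
    using that unfolding compact_operator_on_def A2_forms_def by blast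
  ultimately show ?thesis unfolding p_def by blast
qed

end
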